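(* Let $W$ be a graphon over a probability space $(\Omega,\mathcal F,\pi)$ normalized so that $\|W\|_1=1$. For $n\ge2$, a target density $\rho=\rho_n\in(0,1]$ and $\kappa=\kappa_n\in(0,1]$, let $G$ be a $W$-random graph on $n$ vertices with target density $\rho$, and let $\widehat W=(\hat{\mathbf p},\hat B)$ be the output of the least cut norm algorithm with input $G$ and parameter $\kappa$. (i) If $\kappa\in[\frac{\log n}{n},1]$, then as $n\to\infty$ \[ \delta_\square\Big(\tfrac1\rho\widehat W,W\Big)=O_p\left(\varepsilon^{(1)}_{\ge\kappa}(W)+\sqrt{\frac1{\rho n}}+\sqrt{\frac{\log n}{\kappa n}}+\mathrm{tail}^{(1)}_\rho(W)\right). \] (ii) If $\kappa\in(0,1]$ is fixed and $\rho_n\to0$, $n\rho_n\to\infty$, then $\limsup_{n\to\infty}\delta_\square(\frac1\rho\widehat W,W)\le2\varepsilon^{(1)}_{\ge\kappa}(W)$ with probability $1$. (iii) If $\rho_n\to0$, $n\rho_n\to\infty$, $\kappa_n\to0$ and $\frac{\log n}{n\kappa_n}\to0$, then $\delta_\square(\frac1\rho\widehat W,W)\to0$ with probability $1$.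
   Context: A graphon over $(\Omega,\mathcal F,\pi)$ is a measurable symmetric $W:\Omega\times\Omega\to[0,\infty)$ with $\|W\|_1<\infty$, where $\|f\|_p^p=\int|f|^p\,d\pi\,d\pi$. $W$-random graph with target density $\rho$ on $n$ vertices: choose $x_1,\dots,x_n$ i.i.d. from $\pi$ and include each edge $\{i,j\}$ ($i\neq j$) independently with probability $\min\{1,\rho W(x_i,x_j)\}$. For an $n\times n$ matrix $A$, its cut norm is $\|A\|_\square=\max_{S,T\subseteq[n]}\frac1{n^2}|\sum_{(i,j)\in S\times T}A_{ij}|$. For $\pi:[n]\to[k]$ with classes $V_i=\pi^{-1}(i)$, $A/\pi$ is the $k\times k$ matrix with $(A/\pi)_{ij}=\frac1{|V_i||V_j|}\sum_{(u,v)\in V_i\times V_j}A_{uv}$ (defined as $0$ if $V_i$ or $V_j$ is empty), and $A_\pi$ is the $n\times n$ matrix with entries $(A/\pi)_{\pi(u)\pi(v)}$. Least cut norm algorithm: with $k=\lceil n/\lfloor n\kappa\rfloor\rceil$ and $A(G)$ the adjacency matrix, choose $\hat\pi\in\operatorname{argmin}_\pi\|A(G)-A(G)_\pi\|_\square$ over $\pi:[n]\to[k]$ whose non-empty classes have size at least $\lfloor\kappa n\rfloor$; output the block model $\widehat W=(\hat{\mathbf p},\hat B)$ with $\hat p_i=|V_i(\hat\pi)|/n$ and $\hat B=A(G)/\hat\pi$. A block model $(\mathbf p,B)$ is the graphon on $[k]$ with measure $\mathbf p$ and $W(i,j)=B_{ij}$. For graphons $W$ on $(\Omega,\pi)$,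 $W'$ on $(\Omega',\pi')$: $\delta_p(W,W')=\inf_\nu(\int|W(x,y)-W'(x',y')|^pd\nu(x,x')d\nu(y,y'))^{1/p}$ and $\delta_\square(W,W')=\inf_\nu\sup_{S,T\subseteq\Omega\times\Omega'}|\int_{S\times T}(W(x,y)-W'(x',y'))\,d\nu(x,x')\,d\nu(y,y')|$, infima over couplings $\nu$ of $\pi,\pi'$ and supremum over measurable $S,T$. $\varepsilon^{(p)}_{\ge\kappa}(W)=\inf\{\delta_p(W,W'):W'=(\mathbf p,B)\text{ block model},\min_ip_i\ge\kappa\}$; $\mathrm{tail}^{(p)}_\rho(W)=\|W-\min\{W,\rho^{-1}\}\|_p$. $X=O_p(Y)$: for every $\varepsilon>0$ there is $M$ with $|X|\le M|Y|$ with probability at least $1-\varepsilon$. *)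

theory Defs
  imports "HOL-Probability.Probability"
begin

definition graphon :: "'a measure \<Rightarrow> ('a \<Rightarrow> 'a \<Rightarrow> real) \<Rightarrow> bool" where
  "graphon M W \<longleftrightarrow>
     (\<lambda>(x,y). W x y) \<in> borel_measurable (M \<Otimes>\<^sub>M M) \<and>
     (\<forall>x\<in>space M. \<forall>y\<in>space M. W x y = W y x \<and> 0 \<le> W x y) \<and>
     integrable (M \<Otimes>\<^sub>M M) (\<lambda>(x,y). W x y)"

definition lp_int :: "real \<Rightarrow> 'b measure \<Rightarrow> ('b \<Rightarrow> real) \<Rightarrow> real" where
  "lp_int p \<mu> f = (\<integral>z. \<bar>f z\<bar> powr p \<partial>\<mu>) powr (1 / p)"

definition graphon_norm :: "real \<Rightarrow> 'a measure \<Rightarrow> ('a \<Rightarrow> 'a \<Rightarrow> real) \<Rightarrow> real" where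
  "graphon_norm p M W = lp_int p (M \<Otimes>\<^sub>M M) (\<lambda>(x,y). W x y)"

definition couplings :: "'a measure \<Rightarrow> 'b measure \<Rightarrow> ('a \<times> 'b) measure set" where
  "couplings M N = {\<nu>. sets \<nu> = sets (M \<Otimes>\<^sub>M N) \<and> distr \<nu> M fst = M \<and> distr \<nu> N snd = N}"

definition delta_p :: "real \<Rightarrow> 'a measure \<Rightarrow> ('a \<Rightarrow> 'a \<Rightarrow> real) \<Rightarrow> 'b measure \<Rightarrow> ('b \<Rightarrow> 'b \<Rightarrow> real) \<Rightarrow> real" where
  "delta_p p M W N V =
     (INF \<nu>\<in>couplings M N. lp_int p (\<nu> \<Otimes>\<^sub>M \<nu>) (\<lambda>((x,x'),(y,y')). W x y - V x' y'))"

definition cut_dist :: "'a measure \<Rightarrow> ('a \<Rightarrow> 'a \<Rightarrow> real) \<Rightarrow> 'b measure \<Rightarrow> ('b \<Rightarrow> 'b \<Rightarrow> real) \<Rightarrow> real" where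
  "cut_dist M W N V =
     (INF \<nu>\<in>couplings M N.
        SUP ST\<in>sets (M \<Otimes>\<^sub>M N) \<times> sets (M \<Otimes>\<^sub>M N).
          \<bar>set_lebesgue_integral (\<nu> \<Otimes>\<^sub>M \<nu>) (fst ST \<times> snd ST) (\<lambda>((x,x'),(y,y')). W x y - V x' y')\<bar>)"

text \<open>A block model \<open>(p,B)\<close> with \<open>k\<close> blocks is the graphon on \<open>{..<k}\<close> with weights \<open>p\<close>.\<close>
definition bm_measure :: "nat \<Rightarrow> (nat \<Rightarrow> real) \<Rightarrow> nat measure" where
  "bm_measure k p = point_measure {..<k} (\<lambda>i. ennreal (p i))"

definition eps_block :: "real \<Rightarrow> 'a measure \<Rightarrow> ('a \<Rightarrow> 'a \<Rightarrow> real) \<Rightarrow> real \<Rightarrow> real" where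
  "eps_block p M W \<kappa> =
     Inf {delta_p p M W (bm_measure k q) B | k q B.
            (\<forall>i<k. 0 \<le> q i) \<and> (\<Sum>i<k. q i) = 1 \<and> (\<forall>i<k. \<kappa> \<le> q i) \<and>
            graphon (bm_measure k q) B}"

definition tail :: "real \<Rightarrow> 'a measure \<Rightarrow> ('a \<Rightarrow> 'a \<Rightarrow> real) \<Rightarrow> real \<Rightarrow> real" where
  "tail p M W \<rho> = graphon_norm p M (\<lambda>x y. W x y - min (W x y) (1 / \<rho>))"

text \<open>Graphs on vertex set \<open>{..<n}\<close> are edge sets of pairs \<open>(i,j)\<close> with \<open>i < j < n\<close>.\<close>
definition vpairs :: "nat \<Rightarrow> (nat \<times> nat) set" where
  "vpairs n = {(i,j). i < j \<and> j < n}"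

definition wrg_prob :: "('a \<Rightarrow> 'a \<Rightarrow> real) \<Rightarrow> real \<Rightarrow> nat \<Rightarrow> (nat \<Rightarrow> 'a) \<Rightarrow> (nat \<times> nat) set \<Rightarrow> real" where
  "wrg_prob W \<rho> n x E =
     (if E \<subseteq> vpairs n then
        (\<Prod>e\<in>vpairs n. let q = min 1 (\<rho> * W (x (fst e)) (x (snd e))) in if e \<in> E then q else 1 - q)
      else 0)"

definition wrg_sequence ::
  "'a measure \<Rightarrow> ('a \<Rightarrow> 'a \<Rightarrow> real) \<Rightarrow> (nat \<Rightarrow> real) \<Rightarrow> 'q measure \<Rightarrow> (nat \<Rightarrow> 'q \<Rightarrow> 'a)
     \<Rightarrow> (nat \<Rightarrow> 'q \<Rightarrow> (nat \<times> nat) set) \<Rightarrow> bool" where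
  "wrg_sequence M W \<rho> Q X G \<longleftrightarrow>
     prob_space Q \<and>
     (\<forall>i. X i \<in> measurable Q M \<and> distr Q M (X i) = M) \<and>
     prob_space.indep_vars Q (\<lambda>_. M) X UNIV \<and>
     (\<forall>n. G n \<in> measurable Q (count_space UNIV)) \<and>
     (\<forall>n A E. A \<in> sets (PiM {..<n} (\<lambda>_. M)) \<longrightarrow>
        measure Q {\<omega>\<in>space Q. restrict (\<lambda>i. X i \<omega>) {..<n} \<in> A \<and> G n \<omega> = E}
          = (\<integral>x. indicator A x * wrg_prob W (\<rho> n) n x E \<partial>(PiM {..<n} (\<lambda>_. M))))"

definition adj :: "(nat \<times> nat) set \<Rightarrow> nat \<Rightarrow> nat \<Rightarrow> real" where
  "adj E u v = (if (min u v, max u v) \<in> E then 1 else 0)"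

definition cut_norm :: "nat \<Rightarrow> (nat \<Rightarrow> nat \<Rightarrow> real) \<Rightarrow> real" where
  "cut_norm n A = Max {\<bar>\<Sum>(u,v)\<in>S \<times> T. A u v\<bar> / (real n)^2 | S T. S \<subseteq> {..<n} \<and> T \<subseteq> {..<n}}"

definition cls :: "nat \<Rightarrow> (nat \<Rightarrow> nat) \<Rightarrow> nat \<Rightarrow> nat set" where
  "cls n \<pi> i = {u\<in>{..<n}. \<pi> u = i}"

definition quot :: "nat \<Rightarrow> (nat \<Rightarrow> nat) \<Rightarrow> (nat \<Rightarrow> nat \<Rightarrow> real) \<Rightarrow> nat \<Rightarrow> nat \<Rightarrow> real" where
  "quot n \<pi> A i j =
     (if cls n \<pi> i = {} \<or> cls n \<pi> j = {} then 0
      else (\<Sum>(u,v)\<in>cls n \<pi> i \<times> cls n \<pi> j. A u v) / (real (card (cls n \<pi> i)) * real (card (cls n \<pi> j))))"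

definition blowup :: "nat \<Rightarrow> (nat \<Rightarrow> nat) \<Rightarrow> (nat \<Rightarrow> nat \<Rightarrow> real) \<Rightarrow> nat \<Rightarrow> nat \<Rightarrow> real" where
  "blowup n \<pi> A u v = quot n \<pi> A (\<pi> u) (\<pi> v)"

definition lcn_k :: "nat \<Rightarrow> real \<Rightarrow> nat" where
  "lcn_k n \<kappa> = nat \<lceil>real n / real (nat \<lfloor>real n * \<kappa>\<rfloor>)\<rceil>"

definition admissible :: "nat \<Rightarrow> real \<Rightarrow> (nat \<Rightarrow> nat) set" where
  "admissible n \<kappa> = {\<pi> \<in> {..<n} \<rightarrow>\<^sub>E {..<lcn_k n \<kappa>}.
      \<forall>i<lcn_k n \<kappa>. cls n \<pi> i \<noteq> {} \<longrightarrow> nat \<lfloor>\<kappa> * real n\<rfloor> \<le> card (cls n \<pi> i)}"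

definition lcn_argmin :: "nat \<Rightarrow> real \<Rightarrow> (nat \<times> nat) set \<Rightarrow> (nat \<Rightarrow> nat) set" where
  "lcn_argmin n \<kappa> E = {\<pi> \<in> admissible n \<kappa>. \<forall>\<pi>'\<in>admissible n \<kappa>.
      cut_norm n (\<lambda>u v. adj E u v - blowup n \<pi> (adj E) u v)
        \<le> cut_norm n (\<lambda>u v. adj E u v - blowup n \<pi>' (adj E) u v)}"

definition lcn_outputs :: "nat \<Rightarrow> real \<Rightarrow> (nat \<times> nat) set \<Rightarrow> (nat \<times> (nat \<Rightarrow> real) \<times> (nat \<Rightarrow> nat \<Rightarrow> real)) set" where
  "lcn_outputs n \<kappa> E =
     (\<lambda>\<pi>. (lcn_k n \<kappa>, \<lambda>i. real (card (cls n \<pi> i)) / real n, quot n \<pi> (adj E))) ` lcn_argmin n \<kappa> E"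

definition lcn_selection :: "(nat \<Rightarrow> real) \<Rightarrow> (nat \<Rightarrow> (nat \<times> nat) set \<Rightarrow> nat \<times> (nat \<Rightarrow> real) \<times> (nat \<Rightarrow> nat \<Rightarrow> real)) \<Rightarrow> bool" where
  "lcn_selection \<kappa> alg \<longleftrightarrow>
     (\<forall>n E. lcn_outputs n (\<kappa> n) E \<noteq> {} \<longrightarrow> alg n E \<in> lcn_outputs n (\<kappa> n) E)"

definition scaled_err :: "'a measure \<Rightarrow> ('a \<Rightarrow> 'a \<Rightarrow> real) \<Rightarrow> real \<Rightarrow> nat \<times> (nat \<Rightarrow> real) \<times> (nat \<Rightarrow> nat \<Rightarrow> real) \<Rightarrow> real" where
  "scaled_err M W \<rho> out =
     (case out of (k, p, B) \<Rightarrow> cut_dist (bm_measure k p) (\<lambda>i j. B i j / \<rho>) M W)"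

end

theory Submission
  imports Defs
begin

text \<open>Let \<open>A\<close> be the adjacency matrix and \<open>Q\<close> the matrix of edge probabilities given the sample. Along a
  coupling of the uniform measure on the vertices with \<open>M\<close>, the cut distance of the estimate to \<open>W\<close> is at
  most the sum of the cut norms of \<open>A - A\<^sub>\<pi>\<close>, for the chosen classes \<open>\<pi>\<close>, and of \<open>A - Q\<close>, divided by \<open>\<rho>\<close>, and the \<open>L\<^sup>1\<close> distance of \<open>Q / \<rho>\<close>
  to \<open>W\<close>. As averaging contracts both norms, minimality bounds the first by \<open>2\<close> times the cut norm
  of \<open>A - Q\<close> plus \<open>2\<close> times the \<open>L\<^sup>1\<close> distance of \<open>Q\<close> to any block matrix on admissible classes. Exponential
  moments and a union bound over the \<open>4\<^sup>n\<close> cuts control \<open>A - Q\<close>. To control the \<open>L\<^sup>1\<close> distances, sample the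
  points together with labels from a coupling of \<open>W\<close> with a block model; the class sizes are then
  nearly proportional to the weights, and correcting them costs only their relative deviation, whose
  second moment is at most \<open>1 / (\<kappa> n)\<close>. Markov's inequality gives (i). For the almost sure statements
  a maximal inequality for averages over pairs reduces an integrable kernel to a step function,
  and comparing \<open>Q / \<rho>\<close> with \<open>W\<close> through a fine step function instead of the optimal block model makes the
  last term negligible, which leaves the constant \<open>2\<close>.\<close>

section \<open>Cut norm and averaging over classes\<close>

text \<open>Two obstacles shape the argument. The kernel is only integrable, so no bound may involve
  a supremum or a second moment of \<open>W\<close>; second moments occur for label frequencies
  alone. The cost of correcting class sizes is therefore arranged as a sum of
  \<open>q i * q j * B i j\<close> times a random factor, so that the $L^1$ norm of the block model
  controls it whatever the number of blocks. Moreover, the labels of a near-optimal coupling do not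
  live on the space of the graphs. They are sampled on an auxiliary space, and what is carried over
  is an event that depends on the points alone: some labelling with rounded class sizes fits the
  sample. Rounding matters because of the size constraint: \<lfloor>n q\<rfloor> is at least
  \<lfloor>\<kappa> n\<rfloor> as soon as q \<ge> \<kappa>, while random class sizes may fall below
  it. In (i) the bound obtained has 1 / sqrt(\<kappa> n) as its sampling term, which the stated
  logarithmic term dominates for n \<ge> 3, and the lower bound on \<kappa> yields \<kappa> n \<ge>
  1. Two regimes are needed for the noise: for \<rho> n < 1 exponential moments cannot beat the
  number of cuts, but there the target bound exceeds a constant and counting edges suffices.\<close>

lemma cut_norm_set_finite: "finite {\<bar>\<Sum>(u,v)\<in>S \<times> T. A u v\<bar> / (real n)^2 | S T. S \<subseteq> {..<n} \<and> T \<subseteq> {..<n}}"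
proof -
  have "{\<bar>\<Sum>(u,v)\<in>S \<times> T. A u v\<bar> / (real n)^2 | S T. S \<subseteq> {..<n} \<and> T \<subseteq> {..<n}}
     = (\<lambda>(S,T). \<bar>\<Sum>(u,v)\<in>S \<times> T. A u v\<bar> / (real n)^2) ` (Pow {..<n} \<times> Pow {..<n})"
    by auto
  then show ?thesis by simp
qed

lemma cut_norm_ge:
  assumes "S \<subseteq> {..<n}" "T \<subseteq> {..<n}"
  shows "\<bar>\<Sum>u\<in>S. \<Sum>v\<in>T. A u v\<bar> / (real n)^2 \<le> cut_norm n A"
  unfolding cut_norm_def using assms
  by (intro Max_ge cut_norm_set_finite) (auto simp: sum.cartesian_product)

lemma cut_norm_attained:
  obtains S T where "S \<subseteq> {..<n}" "T \<subseteq> {..<n}" "cut_norm n A = \<bar>\<Sum>u\<in>S. \<Sum>v\<in>T. A u v\<bar> / (real n)^2"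
proof -
  have "cut_norm n A \<in> {\<bar>\<Sum>(u,v)\<in>S \<times> T. A u v\<bar> / (real n)^2 | S T. S \<subseteq> {..<n} \<and> T \<subseteq> {..<n}}"
    unfolding cut_norm_def by (intro Max_in cut_norm_set_finite) auto
  then show ?thesis using that by (auto simp: sum.cartesian_product)
qed

lemma cut_norm_leI:
  assumes "\<And>S T. S \<subseteq> {..<n} \<Longrightarrow> T \<subseteq> {..<n} \<Longrightarrow> \<bar>\<Sum>u\<in>S. \<Sum>v\<in>T. A u v\<bar> / (real n)^2 \<le> c"
  shows "cut_norm n A \<le> c"
  using assms cut_norm_attained by metis

lemma cut_norm_cong:
  assumes "\<And>u v. u < n \<Longrightarrow> v < n \<Longrightarrow> A u v = B u v"
  shows "cut_norm n A = cut_norm n B"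
proof -
  have "cut_norm n A \<le> cut_norm n B" if "\<And>u v. u < n \<Longrightarrow> v < n \<Longrightarrow> A u v = B u v" for A B :: "nat \<Rightarrow> nat \<Rightarrow> real"
  proof (rule cut_norm_leI)
    fix S T assume *: "S \<subseteq> {..<n}" "T \<subseteq> {..<n}"
    have "(\<Sum>u\<in>S. \<Sum>v\<in>T. A u v) = (\<Sum>u\<in>S. \<Sum>v\<in>T. B u v)"
      using * by (intro sum.cong that) auto
    then show "\<bar>\<Sum>u\<in>S. \<Sum>v\<in>T. A u v\<bar> / (real n)^2 \<le> cut_norm n B"
      using cut_norm_ge[OF *, of B] by simp
  qed
  then show ?thesis using assms by (intro antisym) auto
qed

lemma cut_norm_triangle: "cut_norm n (\<lambda>u v. A u v + B u v) \<le> cut_norm n A + cut_norm n B"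
proof (rule cut_norm_leI)
  fix S T assume *: "S \<subseteq> {..<n}" "T \<subseteq> {..<n}"
  have "\<bar>\<Sum>u\<in>S. \<Sum>v\<in>T. A u v + B u v\<bar> \<le> \<bar>\<Sum>u\<in>S. \<Sum>v\<in>T. A u v\<bar> + \<bar>\<Sum>u\<in>S. \<Sum>v\<in>T. B u v\<bar>"
    by (simp add: sum.distrib)
  then have "\<bar>\<Sum>u\<in>S. \<Sum>v\<in>T. A u v + B u v\<bar> / (real n)^2 \<le> \<bar>\<Sum>u\<in>S. \<Sum>v\<in>T. A u v\<bar> / (real n)^2 + \<bar>\<Sum>u\<in>S. \<Sum>v\<in>T. B u v\<bar> / (real n)^2"
    by (simp add: divide_right_mono flip: add_divide_distrib)
  then show "\<bar>\<Sum>u\<in>S. \<Sum>v\<in>T. A u v + B u v\<bar> / (real n)^2 \<le> cut_norm n A + cut_norm n B"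
    using cut_norm_ge[OF *, of A] cut_norm_ge[OF *, of B] by linarith
qed

lemma cut_norm_uminus: "cut_norm n (\<lambda>u v. - A u v) = cut_norm n A"
  by (simp add: cut_norm_def case_prod_unfold sum_negf)

definition l1_norm :: "nat \<Rightarrow> (nat \<Rightarrow> nat \<Rightarrow> real) \<Rightarrow> real" where
  "l1_norm n A = (\<Sum>u<n. \<Sum>v<n. \<bar>A u v\<bar>) / (real n)^2"

lemma l1_norm_triangle: "l1_norm n (\<lambda>u v. A u v + B u v) \<le> l1_norm n A + l1_norm n B"
  unfolding l1_norm_def add_divide_distrib[symmetric] sum.distrib[symmetric]
  by (intro divide_right_mono sum_mono abs_triangle_ineq) auto

lemma cut_norm_le_l1_norm: "cut_norm n A \<le> l1_norm n A"
proof (rule cut_norm_leI)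
  fix S T assume *: "S \<subseteq> {..<n}" "T \<subseteq> {..<n}"
  have "\<bar>\<Sum>u\<in>S. \<Sum>v\<in>T. A u v\<bar> \<le> (\<Sum>u\<in>S. \<Sum>v\<in>T. \<bar>A u v\<bar>)"
    by (intro order_trans[OF sum_abs] sum_mono sum_abs)
  also have "\<dots> \<le> (\<Sum>u\<in>S. \<Sum>v<n. \<bar>A u v\<bar>)"
    using * by (intro sum_mono sum_mono2) auto
  also have "\<dots> \<le> (\<Sum>u<n. \<Sum>v<n. \<bar>A u v\<bar>)"
    using * by (intro sum_mono2) (auto intro: sum_nonneg)
  finally show "\<bar>\<Sum>u\<in>S. \<Sum>v\<in>T. A u v\<bar> / (real n)^2 \<le> l1_norm n A"
    unfolding l1_norm_def by (intro divide_right_mono) auto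
qed

text \<open>A linear form on a cube attains its extreme values at vertices.\<close>
lemma fractional_sum_le:
  fixes c :: "'i \<Rightarrow> real"
  assumes "finite I" "\<And>u. u \<in> I \<Longrightarrow> 0 \<le> a u \<and> a u \<le> 1"
  obtains S where "S \<subseteq> I" "\<bar>\<Sum>u\<in>I. a u * c u\<bar> \<le> \<bar>\<Sum>u\<in>S. c u\<bar>"
proof (cases "(\<Sum>u\<in>I. a u * c u) \<ge> 0")
  case True
  have "(\<Sum>u\<in>I. a u * c u) \<le> (\<Sum>u\<in>I. if c u \<ge> 0 then c u else 0)"
    using assms by (intro sum_mono) (auto simp: mult_left_le_one_le mult_nonneg_nonpos)
  also have "\<dots> = (\<Sum>u\<in>{u\<in>I. c u \<ge> 0}. c u)"
    using assms(1) by (simp add: sum.inter_filter)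
  finally show ?thesis using True by (intro that[of "{u\<in>I. c u \<ge> 0}"]) auto
next
  case False
  have "(\<Sum>u\<in>I. a u * c u) \<ge> (\<Sum>u\<in>I. if c u \<le> 0 then c u else 0)"
  proof (intro sum_mono)
    fix u assume "u \<in> I"
    then have "0 \<le> a u" "a u \<le> 1" using assms by auto
    then show "(if c u \<le> 0 then c u else 0) \<le> a u * c u"
      using mult_right_mono_neg[of "a u" 1 "c u"] by auto
  qed
  also have "(\<Sum>u\<in>I. if c u \<le> 0 then c u else 0) = (\<Sum>u\<in>{u\<in>I. c u \<le> 0}. c u)"
    using assms(1) by (simp add: sum.inter_filter)
  finally show ?thesis using False by (intro that[of "{u\<in>I. c u \<le> 0}"]) auto
qed

text \<open>The form is linear in \<open>a\<close> for fixed \<open>b\<close> and conversely, so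
  first \<open>a\<close> and then \<open>b\<close> can be replaced by a set. Fractional sets arise
  twice: from averaging over classes and from measurable sets in a coupling.\<close>

lemma fractional_cut_le:
  assumes "\<And>u. u < n \<Longrightarrow> 0 \<le> a u \<and> a u \<le> 1" "\<And>u. u < n \<Longrightarrow> 0 \<le> b u \<and> b u \<le> 1"
  shows "\<bar>\<Sum>u<n. \<Sum>v<n. a u * b v * F u v\<bar> / (real n)^2 \<le> cut_norm n F"
proof -
  obtain S where S: "S \<subseteq> {..<n}"
    and 1: "\<bar>\<Sum>u<n. a u * (\<Sum>v<n. b v * F u v)\<bar> \<le> \<bar>\<Sum>u\<in>S. (\<Sum>v<n. b v * F u v)\<bar>"
    using fractional_sum_le[of "{..<n}" a "\<lambda>u. \<Sum>v<n. b v * F u v"] assms(1) by auto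
  have "(\<Sum>u\<in>S. (\<Sum>v<n. b v * F u v)) = (\<Sum>v<n. b v * (\<Sum>u\<in>S. F u v))"
    by (subst sum.swap) (simp add: sum_distrib_left)
  moreover obtain T where T: "T \<subseteq> {..<n}"
    and 2: "\<bar>\<Sum>v<n. b v * (\<Sum>u\<in>S. F u v)\<bar> \<le> \<bar>\<Sum>v\<in>T. (\<Sum>u\<in>S. F u v)\<bar>"
    using fractional_sum_le[of "{..<n}" b "\<lambda>v. \<Sum>u\<in>S. F u v"] assms(2) by auto
  moreover have "(\<Sum>v\<in>T. (\<Sum>u\<in>S. F u v)) = (\<Sum>u\<in>S. \<Sum>v\<in>T. F u v)" by (rule sum.swap)
  moreover have "(\<Sum>u<n. \<Sum>v<n. a u * b v * F u v) = (\<Sum>u<n. a u * (\<Sum>v<n. b v * F u v))"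
    by (simp add: sum_distrib_left mult.assoc)
  ultimately have "\<bar>\<Sum>u<n. \<Sum>v<n. a u * b v * F u v\<bar> \<le> \<bar>\<Sum>u\<in>S. \<Sum>v\<in>T. F u v\<bar>"
    using 1 by linarith
  then show ?thesis using cut_norm_ge[OF S T, of F]
    by (meson divide_right_mono order_trans zero_le_power2)
qed

text \<open>The matrix of the orthogonal projection P onto vectors constant on the classes. On the
  vertices below \<open>n\<close> it is symmetric and doubly stochastic, and averaging
  \<open>A\<close> over classes is P A P.\<close>

definition avg_weight :: "nat \<Rightarrow> (nat \<Rightarrow> nat) \<Rightarrow> nat \<Rightarrow> nat \<Rightarrow> real" where
  "avg_weight n \<pi> u v = (if \<pi> u = \<pi> v then 1 / real (card (cls n \<pi> (\<pi> u))) else 0)"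

lemma avg_weight_nonneg: "0 \<le> avg_weight n \<pi> u v"
  by (simp add: avg_weight_def)

lemma finite_cls [simp]: "finite (cls n \<pi> i)"
  by (simp add: cls_def)

lemma sum_avg_weight: "v < n \<Longrightarrow> (\<Sum>u<n. avg_weight n \<pi> u v) = 1"
proof -
  assume "v < n"
  then have ne: "cls n \<pi> (\<pi> v) \<noteq> {}" by (auto simp: cls_def)
  have "(\<Sum>u<n. avg_weight n \<pi> u v) = (\<Sum>u<n. if \<pi> u = \<pi> v then 1 / real (card (cls n \<pi> (\<pi> v))) else 0)"
    by (intro sum.cong) (auto simp: avg_weight_def)
  also have "\<dots> = (\<Sum>u\<in>cls n \<pi> (\<pi> v). 1 / real (card (cls n \<pi> (\<pi> v))))"
    by (subst sum.inter_filter[symmetric]) (auto simp: cls_def)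
  finally show ?thesis using ne by simp
qed

lemma avg_weight_commute: "avg_weight n \<pi> u v = avg_weight n \<pi> v u"
  by (simp add: avg_weight_def)

text \<open>Makes averaging visibly linear in \<open>A\<close>, with nonnegative weights whose row
  and column sums are 1. All contraction properties come from this form.\<close>

lemma blowup_eq_avg:
  assumes "u < n" "v < n"
  shows "blowup n \<pi> A u v = (\<Sum>u'<n. \<Sum>v'<n. avg_weight n \<pi> u u' * avg_weight n \<pi> v v' * A u' v')"
proof -
  have ne: "cls n \<pi> (\<pi> u) \<noteq> {}" "cls n \<pi> (\<pi> v) \<noteq> {}" using assms by (auto simp: cls_def)
  have w: "(\<Sum>v'<n. avg_weight n \<pi> v v' * f v') = (\<Sum>v'\<in>cls n \<pi> (\<pi> v). f v' / real (card (cls n \<pi> (\<pi> v))))" for f v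
  proof -
    have "(\<Sum>v'<n. avg_weight n \<pi> v v' * f v') = (\<Sum>v'<n. if \<pi> v' = \<pi> v then f v' / real (card (cls n \<pi> (\<pi> v))) else 0)"
      by (intro sum.cong) (auto simp: avg_weight_def)
    then show ?thesis by (subst (asm) sum.inter_filter[symmetric]) (auto simp: cls_def)
  qed
  have "(\<Sum>u'<n. \<Sum>v'<n. avg_weight n \<pi> u u' * avg_weight n \<pi> v v' * A u' v')
     = (\<Sum>u'<n. avg_weight n \<pi> u u' * (\<Sum>v'<n. avg_weight n \<pi> v v' * A u' v'))"
    by (simp add: sum_distrib_left mult.assoc)
  also have "\<dots> = (\<Sum>(u',v')\<in>cls n \<pi> (\<pi> u) \<times> cls n \<pi> (\<pi> v). A u' v') / (real (card (cls n \<pi> (\<pi> u))) * real (card (cls n \<pi> (\<pi> v))))"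
    unfolding w by (simp add: sum_divide_distrib[symmetric] sum.cartesian_product mult.commute)
  finally show ?thesis using ne by (simp add: blowup_def quot_def)
qed

lemma blowup_diff:
  assumes "u < n" "v < n"
  shows "blowup n \<pi> (\<lambda>u v. A u v - B u v) u v = blowup n \<pi> A u v - blowup n \<pi> B u v"
  unfolding blowup_eq_avg[OF assms] by (simp add: algebra_simps sum_subtractf)

lemma sum_product_const:
  fixes c :: real
  shows "(\<Sum>u\<in>S. \<Sum>v\<in>T. f u * g v * c) = (\<Sum>u\<in>S. f u) * (\<Sum>v\<in>T. g v) * c"
  by (subst sum_product) (simp add: sum_distrib_right)

text \<open>Block matrices are fixed points of averaging, so they cancel when a matrix is compared
  with its own average.\<close>

lemma blowup_step:
  assumes "u < n" "v < n"
  shows "blowup n \<pi> (\<lambda>u v. B (\<pi> u) (\<pi> v)) u v = B (\<pi> u) (\<pi> v)"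
proof -
  have "blowup n \<pi> (\<lambda>u v. B (\<pi> u) (\<pi> v)) u v = (\<Sum>u'<n. \<Sum>v'<n. avg_weight n \<pi> u u' * avg_weight n \<pi> v v' * B (\<pi> u) (\<pi> v))"
    unfolding blowup_eq_avg[OF assms] by (intro sum.cong) (auto simp: avg_weight_def)
  also have "\<dots> = (\<Sum>u'<n. avg_weight n \<pi> u u') * (\<Sum>v'<n. avg_weight n \<pi> v v') * B (\<pi> u) (\<pi> v)"
    by (simp add: sum_product_const)
  also have "\<dots> = B (\<pi> u) (\<pi> v)"
    using sum_avg_weight[OF assms(1)] sum_avg_weight[OF assms(2)] by (simp add: avg_weight_commute)
  finally show ?thesis .
qed

lemma sum_swap4:
  "(\<Sum>u\<in>S. \<Sum>v\<in>T. \<Sum>u'\<in>U. \<Sum>v'\<in>V. f u v u' v') = (\<Sum>u'\<in>U. \<Sum>v'\<in>V. \<Sum>u\<in>S. \<Sum>v\<in>T. f u v u' v')"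
proof -
  have "(\<Sum>u\<in>S. \<Sum>v\<in>T. \<Sum>u'\<in>U. \<Sum>v'\<in>V. f u v u' v') = (\<Sum>x\<in>S\<times>T. \<Sum>y\<in>U\<times>V. f (fst x) (snd x) (fst y) (snd y))"
    by (simp add: sum.cartesian_product')
  also have "\<dots> = (\<Sum>y\<in>U\<times>V. \<Sum>x\<in>S\<times>T. f (fst x) (snd x) (fst y) (snd y))" by (rule sum.swap)
  finally show ?thesis by (simp add: sum.cartesian_product')
qed

lemma sum_avg_weight_subset:
  assumes "S \<subseteq> {..<n}" "u < n"
  shows "(\<Sum>v\<in>S. avg_weight n \<pi> v u) \<le> 1"
  using sum_mono2[of "{..<n}" S "\<lambda>v. avg_weight n \<pi> v u"] assms avg_weight_nonneg sum_avg_weight[of u n \<pi>]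
  by auto

text \<open>Moving the sums over \<open>S\<close> and \<open>T\<close> inside turns these sets into
  column sums of the averaging matrix, which lie between 0 and 1: a fractional cut of
  \<open>F\<close>.\<close>

lemma cut_norm_blowup_le: "cut_norm n (blowup n \<pi> F) \<le> cut_norm n F"
proof (rule cut_norm_leI)
  fix S T assume *: "S \<subseteq> {..<n}" "T \<subseteq> {..<n}"
  have "(\<Sum>u\<in>S. \<Sum>v\<in>T. blowup n \<pi> F u v)
      = (\<Sum>u\<in>S. \<Sum>v\<in>T. \<Sum>u'<n. \<Sum>v'<n. avg_weight n \<pi> u u' * avg_weight n \<pi> v v' * F u' v')"
    using * by (intro sum.cong blowup_eq_avg) auto
  also have "\<dots> = (\<Sum>u'<n. \<Sum>v'<n. \<Sum>u\<in>S. \<Sum>v\<in>T. avg_weight n \<pi> u u' * avg_weight n \<pi> v v' * F u' v')"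
    by (rule sum_swap4)
  also have "\<dots> = (\<Sum>u'<n. \<Sum>v'<n. (\<Sum>u\<in>S. avg_weight n \<pi> u u') * (\<Sum>v\<in>T. avg_weight n \<pi> v v') * F u' v')"
    by (simp add: sum_product_const)
  finally show "\<bar>\<Sum>u\<in>S. \<Sum>v\<in>T. blowup n \<pi> F u v\<bar> / (real n)^2 \<le> cut_norm n F"
    using * by (simp add: fractional_cut_le sum_nonneg avg_weight_nonneg sum_avg_weight_subset)
qed

lemma l1_norm_blowup_le: "l1_norm n (blowup n \<pi> F) \<le> l1_norm n F"
proof -
  have "(\<Sum>u<n. \<Sum>v<n. \<bar>blowup n \<pi> F u v\<bar>)
      \<le> (\<Sum>u<n. \<Sum>v<n. \<Sum>u'<n. \<Sum>v'<n. avg_weight n \<pi> u u' * avg_weight n \<pi> v v' * \<bar>F u' v'\<bar>)"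
  proof (intro sum_mono)
    fix u v assume "u \<in> {..<n}" "v \<in> {..<n}"
    then have "\<bar>blowup n \<pi> F u v\<bar> = \<bar>\<Sum>u'<n. \<Sum>v'<n. avg_weight n \<pi> u u' * avg_weight n \<pi> v v' * F u' v'\<bar>"
      by (simp add: blowup_eq_avg)
    also have "\<dots> \<le> (\<Sum>u'<n. \<Sum>v'<n. \<bar>avg_weight n \<pi> u u' * avg_weight n \<pi> v v' * F u' v'\<bar>)"
      by (intro order_trans[OF sum_abs] sum_mono sum_abs)
    also have "\<dots> = (\<Sum>u'<n. \<Sum>v'<n. avg_weight n \<pi> u u' * avg_weight n \<pi> v v' * \<bar>F u' v'\<bar>)"
      by (simp add: abs_mult avg_weight_nonneg)
    finally show "\<bar>blowup n \<pi> F u v\<bar> \<le> \<dots>" .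
  qed
  also have "\<dots> = (\<Sum>u'<n. \<Sum>v'<n. \<Sum>u<n. \<Sum>v<n. avg_weight n \<pi> u u' * avg_weight n \<pi> v v' * \<bar>F u' v'\<bar>)"
    by (rule sum_swap4)
  also have "\<dots> = (\<Sum>u'<n. \<Sum>v'<n. (\<Sum>u<n. avg_weight n \<pi> u u') * (\<Sum>v<n. avg_weight n \<pi> v v') * \<bar>F u' v'\<bar>)"
    by (simp add: sum_product_const)
  also have "\<dots> = (\<Sum>u'<n. \<Sum>v'<n. \<bar>F u' v'\<bar>)"
    by (intro sum.cong) (auto simp: sum_avg_weight)
  finally show ?thesis unfolding l1_norm_def by (intro divide_right_mono) auto
qed

text \<open>With D = A - H and F = H - B the block part drops out, leaving D + F minus the averages
  of D and F. Each of D and F is paid twice, once directly and once averaged; this is the origin of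
  the factors 2.\<close>

lemma cut_norm_sub_blowup_le:
  "cut_norm n (\<lambda>u v. A u v - blowup n \<pi> A u v)
     \<le> 2 * cut_norm n (\<lambda>u v. A u v - H u v) + 2 * l1_norm n (\<lambda>u v. H u v - B (\<pi> u) (\<pi> v))"
proof -
  let ?D = "\<lambda>u v. A u v - H u v" and ?F = "\<lambda>u v. H u v - B (\<pi> u) (\<pi> v)"
  have "cut_norm n (\<lambda>u v. A u v - blowup n \<pi> A u v)
      = cut_norm n (\<lambda>u v. (?D u v + ?F u v) + (- blowup n \<pi> ?D u v + - blowup n \<pi> ?F u v))"
    by (intro cut_norm_cong) (simp add: blowup_diff blowup_step)
  also have "\<dots> \<le> (cut_norm n ?D + cut_norm n ?F) + (cut_norm n (blowup n \<pi> ?D) + cut_norm n (blowup n \<pi> ?F))"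
    using cut_norm_triangle[of n ?D ?F] cut_norm_uminus[of n "blowup n \<pi> ?D"] cut_norm_uminus[of n "blowup n \<pi> ?F"]
      cut_norm_triangle[of n "\<lambda>u v. - blowup n \<pi> ?D u v" "\<lambda>u v. - blowup n \<pi> ?F u v"]
      cut_norm_triangle[of n "\<lambda>u v. ?D u v + ?F u v" "\<lambda>u v. - blowup n \<pi> ?D u v + - blowup n \<pi> ?F u v"]
    by linarith
  also have "\<dots> \<le> (cut_norm n ?D + l1_norm n ?F) + (cut_norm n ?D + l1_norm n ?F)"
    using cut_norm_blowup_le[of n \<pi> ?D] cut_norm_le_l1_norm[of n ?F]
      cut_norm_le_l1_norm[of n "blowup n \<pi> ?F"] l1_norm_blowup_le[of n \<pi> ?F] by linarith
  finally show ?thesis by simp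
qed

section \<open>Changing class sizes\<close>

lemma sum_labels:
  fixes w :: "'x \<Rightarrow> real"
  assumes "finite X" "p ` X \<subseteq> {..<k::nat}"
  shows "(\<Sum>x\<in>X. w x * h (p x)) = (\<Sum>j<k. h j * (\<Sum>x\<in>X. if p x = j then w x else 0))"
proof -
  have "(\<Sum>x\<in>X. w x * h (p x)) = (\<Sum>x\<in>X. \<Sum>j<k. if p x = j then w x * h j else 0)"
    using assms by (intro sum.cong refl) (auto simp: image_subset_iff)
  also have "\<dots> = (\<Sum>j<k. \<Sum>x\<in>X. if p x = j then w x * h j else 0)" by (rule sum.swap)
  finally show ?thesis by (simp add: sum_distrib_left if_distrib mult.commute cong: if_cong)
qed

text \<open>A weighted set is used because the same estimate serves vertices with weight 1/n and
  vertex-label pairs with the weights of a coupling.\<close>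

definition moved_mass :: "'x set \<Rightarrow> ('x \<Rightarrow> real) \<Rightarrow> ('x \<Rightarrow> nat) \<Rightarrow> ('x \<Rightarrow> nat) \<Rightarrow> nat \<Rightarrow> real" where
  "moved_mass X w p p' j = (\<Sum>x\<in>X. if p x \<noteq> p' x \<and> (p x = j \<or> p' x = j) then w x else 0)"

lemma sum_moved_labels:
  fixes w :: "'x \<Rightarrow> real"
  assumes "finite X" "p ` X \<subseteq> {..<k::nat}" "p' ` X \<subseteq> {..<k}"
  shows "(\<Sum>x\<in>X. w x * (if p x \<noteq> p' x then h (p x) + h (p' x) else 0)) = (\<Sum>j<k. h j * moved_mass X w p p' j)"
proof -
  have "(\<Sum>x\<in>X. w x * (if p x \<noteq> p' x then h (p x) + h (p' x) else 0))
     = (\<Sum>x\<in>X. \<Sum>j<k. (if p x = j then (if p x \<noteq> p' x then w x * h j else 0) else 0)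
                    + (if p' x = j then (if p x \<noteq> p' x then w x * h j else 0) else 0))"
    using assms by (intro sum.cong refl) (auto simp: image_subset_iff sum.distrib distrib_left)
  also have "\<dots> = (\<Sum>x\<in>X. \<Sum>j<k. h j * (if p x \<noteq> p' x \<and> (p x = j \<or> p' x = j) then w x else 0))"
    by (intro sum.cong refl) auto
  also have "\<dots> = (\<Sum>j<k. \<Sum>x\<in>X. h j * (if p x \<noteq> p' x \<and> (p x = j \<or> p' x = j) then w x else 0))" by (rule sum.swap)
  finally show ?thesis by (simp add: sum_distrib_left moved_mass_def)
qed

text \<open>Only pairs with a changed label contribute, and a changed label is charged to its old
  and its new class. The bound stays linear in \<open>B\<close>, so an entry \<open>B i j\<close> is
  paid only in proportion to the mass moved at \<open>i\<close> or \<open>j\<close>.\<close>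

lemma relabel_cost:
  fixes w :: "'x \<Rightarrow> real" and B :: "nat \<Rightarrow> nat \<Rightarrow> real"
  assumes fin: "finite X" and p: "p ` X \<subseteq> {..<k}" and p': "p' ` X \<subseteq> {..<k}"
    and w: "\<And>x. x \<in> X \<Longrightarrow> 0 \<le> w x"
    and B: "\<And>i j. i < k \<Longrightarrow> j < k \<Longrightarrow> 0 \<le> B i j"
  shows "(\<Sum>x\<in>X. \<Sum>y\<in>X. w x * w y * \<bar>B (p x) (p y) - B (p' x) (p' y)\<bar>)
    \<le> (\<Sum>i<k. \<Sum>j<k. B i j *
         (moved_mass X w p p' i * (\<Sum>y\<in>X. if p y = j then w y else 0)
          + (\<Sum>x\<in>X. if p' x = i then w x else 0) * moved_mass X w p p' j))"
proof -
  define c where "c x = (if p x \<noteq> p' x then 1 else 0 :: real)" for x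
  \<comment> \<open>One label is changed at a time through the mixed entry
    \<open>B (p' x) (p y)\<close>. As entries are nonnegative, a difference is at most the
    sum.\<close>
  have "\<bar>B (p x) (p y) - B (p' x) (p' y)\<bar>
      \<le> c x * (B (p x) (p y) + B (p' x) (p y)) + c y * (B (p' x) (p y) + B (p' x) (p' y))"
    if "x \<in> X" "y \<in> X" for x y
  proof -
    have "0 \<le> B (p x) (p y)" "0 \<le> B (p' x) (p y)" "0 \<le> B (p' x) (p' y)"
      using that p p' by (auto intro!: B)
    then show ?thesis by (auto simp: c_def)
  qed
  then have "(\<Sum>x\<in>X. \<Sum>y\<in>X. w x * w y * \<bar>B (p x) (p y) - B (p' x) (p' y)\<bar>)
     \<le> (\<Sum>x\<in>X. \<Sum>y\<in>X. w x * w y * (c x * (B (p x) (p y) + B (p' x) (p y)) + c y * (B (p' x) (p y) + B (p' x) (p' y))))"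
    by (intro sum_mono mult_left_mono) (auto intro: w mult_nonneg_nonneg)
  also have "\<dots> = (\<Sum>x\<in>X. w x * (c x * ((\<Sum>y\<in>X. w y * B (p x) (p y)) + (\<Sum>y\<in>X. w y * B (p' x) (p y)))))
      + (\<Sum>x\<in>X. w x * (\<Sum>y\<in>X. w y * (c y * (B (p' x) (p y) + B (p' x) (p' y)))))"
    by (simp add: sum_distrib_left sum.distrib algebra_simps)
  also have "(\<Sum>x\<in>X. w x * (\<Sum>y\<in>X. w y * (c y * (B (p' x) (p y) + B (p' x) (p' y)))))
     = (\<Sum>x\<in>X. w x * (\<Sum>j<k. B (p' x) j * moved_mass X w p p' j))"
    by (subst sum_moved_labels[OF fin p p', symmetric]) (auto simp: c_def intro!: sum.cong)
  also have "\<dots> = (\<Sum>i<k. (\<Sum>j<k. B i j * moved_mass X w p p' j) * (\<Sum>x\<in>X. if p' x = i then w x else 0))"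
    by (rule sum_labels[OF fin p', where h = "\<lambda>i. \<Sum>j<k. B i j * moved_mass X w p p' j"])
  also have "(\<Sum>x\<in>X. w x * (c x * ((\<Sum>y\<in>X. w y * B (p x) (p y)) + (\<Sum>y\<in>X. w y * B (p' x) (p y)))))
     = (\<Sum>x\<in>X. w x * (if p x \<noteq> p' x then (\<Sum>y\<in>X. w y * B (p x) (p y)) + (\<Sum>y\<in>X. w y * B (p' x) (p y)) else 0))"
    by (intro sum.cong refl) (simp add: c_def)
  also have "\<dots> = (\<Sum>i<k. (\<Sum>y\<in>X. w y * B i (p y)) * moved_mass X w p p' i)"
    by (rule sum_moved_labels[OF fin p p', where h = "\<lambda>i. \<Sum>y\<in>X. w y * B i (p y)"])
  also have "\<dots> = (\<Sum>i<k. (\<Sum>j<k. B i j * (\<Sum>y\<in>X. if p y = j then w y else 0)) * moved_mass X w p p' i)"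
    by (subst sum_labels[OF fin p]) simp
  finally show ?thesis
    by (simp add: sum_distrib_right sum_distrib_left sum.distrib algebra_simps)
qed

lemma sum_card_cls:
  assumes "\<pi> ` {..<n} \<subseteq> {..<k}"
  shows "(\<Sum>i<k. card (cls n \<pi> i)) = n"
proof -
  have "(\<Sum>i<k. card (cls n \<pi> i)) = card (\<Union>i<k. cls n \<pi> i)"
    by (rule card_UN_disjoint[symmetric]) (auto simp: cls_def)
  also have "(\<Union>i<k. cls n \<pi> i) = {..<n}" using assms by (auto simp: cls_def)
  finally show ?thesis by simp
qed

definition touched :: "nat \<Rightarrow> (nat \<Rightarrow> nat) \<Rightarrow> (nat \<Rightarrow> nat) \<Rightarrow> nat \<Rightarrow> nat set" where
  "touched n \<pi> \<pi>' i = {u\<in>{..<n}. \<pi> u \<noteq> \<pi>' u \<and> (\<pi> u = i \<or> \<pi>' u = i)}"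

text \<open>Greedy: as the sizes have equal totals, a wrong size forces one class above and one
  below its target; moving a vertex from the former to the latter lowers both discrepancies by 1.
  The induction is on the total discrepancy.\<close>

lemma relabel_sizes:
  assumes "\<pi> \<in> {..<n} \<rightarrow>\<^sub>E {..<k}" "(\<Sum>i<k. t i) = n"
  shows "\<exists>\<pi>'. \<pi>' \<in> {..<n} \<rightarrow>\<^sub>E {..<k} \<and> (\<forall>i<k. card (cls n \<pi>' i) = t i) \<and>
     (\<forall>i<k. int (card (touched n \<pi> \<pi>' i)) \<le> \<bar>int (card (cls n \<pi> i)) - int (t i)\<bar>)"
  using assms(1)
proof (induction "nat (\<Sum>i<k. \<bar>int (card (cls n \<pi> i)) - int (t i)\<bar>)" arbitrary: \<pi> rule: less_induct)
  case less
  let ?N = "\<lambda>\<pi> i. card (cls n \<pi> i)"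
  show ?case
  proof (cases "\<forall>i<k. ?N \<pi> i = t i")
    case True
    then show ?thesis using less.prems by (intro exI[of _ \<pi>]) (auto simp: touched_def)
  next
    case False
    have im: "\<pi> ` {..<n} \<subseteq> {..<k}" using less.prems by auto
    have eq: "(\<Sum>i<k. ?N \<pi> i) = (\<Sum>i<k. t i)" using sum_card_cls[OF im] assms(2) by simp
    have "\<exists>i<k. ?N \<pi> i > t i"
    proof (rule ccontr)
      assume c: "\<not> (\<exists>i<k. ?N \<pi> i > t i)"
      obtain i where "i < k" "?N \<pi> i \<noteq> t i" using False by auto
      moreover have "\<And>i. i < k \<Longrightarrow> ?N \<pi> i \<le> t i" using c not_less by blast
      ultimately have "(\<Sum>i<k. ?N \<pi> i) < (\<Sum>i<k. t i)"
        by (intro sum_strict_mono_ex1) (auto intro!: bexI[of _ i] simp: order_less_le)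
      with eq show False by simp
    qed
    then obtain i0 where i0: "i0 < k" "?N \<pi> i0 > t i0" by auto
    have "\<exists>i<k. ?N \<pi> i < t i"
    proof (rule ccontr)
      assume c: "\<not> (\<exists>i<k. ?N \<pi> i < t i)"
      have "(\<Sum>i<k. t i) < (\<Sum>i<k. ?N \<pi> i)"
        using c i0 by (intro sum_strict_mono_ex1) (use c not_less in blast)+
      with eq show False by simp
    qed
    then obtain j0 where j0: "j0 < k" "?N \<pi> j0 < t j0" by auto
    have ij: "i0 \<noteq> j0" using i0 j0 by auto
    have "cls n \<pi> i0 \<noteq> {}" using i0 by auto
    then obtain u0 where u0: "u0 < n" "\<pi> u0 = i0" by (auto simp: cls_def)
    define \<pi>1 where "\<pi>1 = \<pi>(u0 := j0)"
    have pi1: "\<pi>1 \<in> {..<n} \<rightarrow>\<^sub>E {..<k}" using less.prems j0 u0 by (auto simp: \<pi>1_def PiE_iff extensional_def)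
    have c_i0: "cls n \<pi> i0 = insert u0 (cls n \<pi>1 i0)" "u0 \<notin> cls n \<pi>1 i0"
      using u0 ij by (auto simp: cls_def \<pi>1_def)
    have c_j0: "cls n \<pi>1 j0 = insert u0 (cls n \<pi> j0)" "u0 \<notin> cls n \<pi> j0"
      using u0 ij by (auto simp: cls_def \<pi>1_def)
    have c_o: "cls n \<pi>1 i = cls n \<pi> i" if "i \<noteq> i0" "i \<noteq> j0" for i
      using that u0 by (auto simp: cls_def \<pi>1_def)
    have N_i0: "?N \<pi> i0 = Suc (?N \<pi>1 i0)" using c_i0 by simp
    have N_j0: "?N \<pi>1 j0 = Suc (?N \<pi> j0)" using c_j0 by simp
    have dec: "\<bar>int (?N \<pi>1 i) - int (t i)\<bar> = \<bar>int (?N \<pi> i) - int (t i)\<bar> - (if i = i0 \<or> i = j0 then 1 else 0)" for i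
      using N_i0 N_j0 i0 j0 c_o ij by auto
    have "(\<Sum>i<k. \<bar>int (?N \<pi>1 i) - int (t i)\<bar>) < (\<Sum>i<k. \<bar>int (?N \<pi> i) - int (t i)\<bar>)"
      by (rule sum_strict_mono_ex1) (use i0 dec in auto)
    moreover have "0 \<le> (\<Sum>i<k. \<bar>int (?N \<pi>1 i) - int (t i)\<bar>)" by (intro sum_nonneg) auto
    ultimately have "nat (\<Sum>i<k. \<bar>int (?N \<pi>1 i) - int (t i)\<bar>) < nat (\<Sum>i<k. \<bar>int (?N \<pi> i) - int (t i)\<bar>)"
      by linarith
    from less.hyps[OF this pi1] obtain \<pi>' where \<pi>': "\<pi>' \<in> {..<n} \<rightarrow>\<^sub>E {..<k}" "\<forall>i<k. ?N \<pi>' i = t i"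
      "\<And>i. i < k \<Longrightarrow> int (card (touched n \<pi>1 \<pi>' i)) \<le> \<bar>int (?N \<pi>1 i) - int (t i)\<bar>" by blast
    have "int (card (touched n \<pi> \<pi>' i)) \<le> \<bar>int (?N \<pi> i) - int (t i)\<bar>" if i: "i < k" for i
    proof -
      \<comment> \<open>Even if \<open>u0\<close> is moved again later, a class other than
        \<open>i0\<close> and \<open>j0\<close> sees it only through its final label, which
        \<open>touched n \<pi>1 \<pi>' i\<close> already records.\<close>
      have "touched n \<pi> \<pi>' i \<subseteq> touched n \<pi>1 \<pi>' i \<union> (if i = i0 \<or> i = j0 then {u0} else {})"
        using u0 by (auto simp: touched_def \<pi>1_def split: if_splits)
      then have "card (touched n \<pi> \<pi>' i) \<le> card (touched n \<pi>1 \<pi>' i \<union> (if i = i0 \<or> i = j0 then {u0} else {}))"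
        by (intro card_mono) (auto simp: touched_def)
      also have "\<dots> \<le> card (touched n \<pi>1 \<pi>' i) + (if i = i0 \<or> i = j0 then 1 else 0)"
        by (rule order_trans[OF card_Un_le]) auto
      finally show ?thesis using \<pi>'(3)[OF i] dec[of i] by (auto split: if_splits)
    qed
    then show ?thesis using \<pi>' by blast
  qed
qed

text \<open>The partial sums are rounded instead of the weights. Their increments telescope to
  exactly \<open>n\<close>, and an increment of floors lies between floor and ceiling of the
  increment.\<close>

lemma round_weights:
  assumes "\<And>i. i < k \<Longrightarrow> 0 \<le> q i" "(\<Sum>i<k. q i) = (1::real)"
  obtains t :: "nat \<Rightarrow> nat" where "(\<Sum>i<k. t i) = n"
    "\<And>i. i < k \<Longrightarrow> \<lfloor>real n * q i\<rfloor> \<le> int (t i)" "\<And>i. i < k \<Longrightarrow> int (t i) \<le> \<lceil>real n * q i\<rceil>"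
proof -
  define c where "c i = \<lfloor>\<Sum>j<i. real n * q j\<rfloor>" for i
  define t where "t i = nat (c (Suc i) - c i)" for i
  have lo: "\<lfloor>real n * q i\<rfloor> \<le> c (Suc i) - c i" and hi: "c (Suc i) - c i \<le> \<lceil>real n * q i\<rceil>" for i
    unfolding c_def sum.lessThan_Suc by linarith+
  have nn: "0 \<le> c (Suc i) - c i" if "i < k" for i
    by (rule order_trans[OF _ lo]) (use assms(1)[OF that] in auto)
  have "int (\<Sum>i<k. t i) = (\<Sum>i<k. c (Suc i) - c i)" using nn by (simp add: t_def)
  also have "\<dots> = c k - c 0" by (rule sum_lessThan_telescope)
  also have "\<dots> = int n" using assms(2) by (simp add: c_def sum_distrib_left[symmetric])
  finally have "(\<Sum>i<k. t i) = n" by linarith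
  then show ?thesis using lo hi nn by (intro that[of t]) (auto simp: t_def)
qed

text \<open>The common part min(a, b) stays on the diagonal and the excess of \<open>a\<close> is
  matched with the deficit by a scaled product. At a given \<open>l\<close> only one of excess and
  deficit is nonzero, so the mass leaving or entering \<open>l\<close> is exactly |a l - b
  l|.\<close>

lemma maximal_coupling:
  fixes a b :: "nat \<Rightarrow> real"
  assumes "\<And>i. i < k \<Longrightarrow> 0 \<le> a i" "\<And>i. i < k \<Longrightarrow> 0 \<le> b i" "(\<Sum>i<k. a i) = (\<Sum>i<k. b i)"
  obtains s where "\<And>i j. i < k \<Longrightarrow> j < k \<Longrightarrow> 0 \<le> s i j"
    "\<And>i. i < k \<Longrightarrow> (\<Sum>j<k. s i j) = a i" "\<And>j. j < k \<Longrightarrow> (\<Sum>i<k. s i j) = b j"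
    "\<And>l. l < k \<Longrightarrow> (\<Sum>i<k. \<Sum>j<k. if i \<noteq> j \<and> (i = l \<or> j = l) then s i j else 0) \<le> \<bar>a l - b l\<bar>"
proof -
  define D where "D = (\<Sum>i<k. max 0 (a i - b i))"
  have "D - (\<Sum>i<k. max 0 (b i - a i)) = (\<Sum>i<k. a i - b i)"
    unfolding D_def sum_subtractf[symmetric] by (intro sum.cong) auto
  then have D': "D = (\<Sum>i<k. max 0 (b i - a i))" using assms(3) by (simp add: sum_subtractf)
  have D0: "0 \<le> D" unfolding D_def by (intro sum_nonneg) auto
  \<comment> \<open>If D = 0 the quotient is 0 by convention, which is the right value: there is no
    excess to move.\<close>
  define \<tau> where "\<tau> i j = max 0 (a i - b i) * max 0 (b j - a j) / D" for i j
  define s where "s i j = (if i = j then min (a i) (b i) else 0) + \<tau> i j" for i j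
  have tau_diag: "\<tau> i i = 0" for i by (auto simp: \<tau>_def max_def)
  have z: "max 0 (a i - b i) = 0" if "D = 0" "i < k" for i
    using that sum_nonneg_eq_0_iff[of "{..<k}" "\<lambda>i. max 0 (a i - b i)"] by (auto simp: D_def)
  have z': "max 0 (b i - a i) = 0" if "D = 0" "i < k" for i
    using that sum_nonneg_eq_0_iff[of "{..<k}" "\<lambda>i. max 0 (b i - a i)"] by (auto simp: D')
  have row: "(\<Sum>j<k. \<tau> i j) = max 0 (a i - b i)" if "i < k" for i
  proof -
    have "(\<Sum>j<k. \<tau> i j) = max 0 (a i - b i) * D / D"
      unfolding \<tau>_def D' by (simp add: sum_divide_distrib[symmetric] sum_distrib_left)
    then show ?thesis using z[OF _ that] by (cases "D = 0") auto
  qed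
  have col: "(\<Sum>i<k. \<tau> i j) = max 0 (b j - a j)" if "j < k" for j
  proof -
    have "(\<Sum>i<k. \<tau> i j) = D * max 0 (b j - a j) / D"
      unfolding \<tau>_def D_def by (simp add: sum_divide_distrib[symmetric] sum_distrib_right)
    then show ?thesis using z'[OF _ that] by (cases "D = 0") auto
  qed
  have tau_nn: "0 \<le> \<tau> i j" for i j unfolding \<tau>_def using D0 by auto
  show ?thesis
  proof (rule that[of s])
    show "0 \<le> s i j" if "i < k" "j < k" for i j using tau_nn assms that by (auto simp: s_def)
    show "(\<Sum>j<k. s i j) = a i" if "i < k" for i
      using that by (auto simp: s_def sum.distrib row)
    show "(\<Sum>i<k. s i j) = b j" if "j < k" for j
      using that by (auto simp: s_def sum.distrib col)
    fix l assume l: "l < k"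
    have "(\<Sum>i<k. \<Sum>j<k. if i \<noteq> j \<and> (i = l \<or> j = l) then s i j else 0)
       \<le> (\<Sum>i<k. \<Sum>j<k. (if i = l then \<tau> i j else 0) + (if j = l then \<tau> i j else 0))"
      by (intro sum_mono) (auto simp: s_def tau_nn)
    also have "\<dots> = (\<Sum>i<k. if i = l then (\<Sum>j<k. \<tau> i j) else 0) + (\<Sum>i<k. \<tau> i l)"
    proof -
      have "(\<Sum>i<k. \<Sum>j<k. if i = l then \<tau> i j else 0) = (\<Sum>i<k. if i = l then (\<Sum>j<k. \<tau> i j) else 0)"
        by (intro sum.cong) auto
      then show ?thesis using l by (simp add: sum.distrib)
    qed
    also have "\<dots> = \<bar>a l - b l\<bar>" using l row[OF l] col[OF l] by auto
    finally show "(\<Sum>i<k. \<Sum>j<k. if i \<noteq> j \<and> (i = l \<or> j = l) then s i j else 0) \<le> \<bar>a l - b l\<bar>" .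
  qed
qed

lemma sum_over_classes:
  assumes "\<pi> ` {..<n} \<subseteq> {..<k}" "\<And>j. j < k \<Longrightarrow> cls n \<pi> j = {} \<Longrightarrow> h j = 0"
  shows "(\<Sum>u<n. h (\<pi> u) / real (card (cls n \<pi> (\<pi> u)))) = (\<Sum>j<k. h j :: real)"
proof -
  have "(\<Sum>u<n. if \<pi> u = j then 1 else 0) = real (card (cls n \<pi> j))" for j
    by (subst sum.inter_filter[symmetric]) (auto simp: cls_def)
  then have "(\<Sum>u<n. 1 * (h (\<pi> u) / real (card (cls n \<pi> (\<pi> u)))))
    = (\<Sum>j<k. h j / real (card (cls n \<pi> j)) * real (card (cls n \<pi> j)))"
    using sum_labels[OF finite_lessThan assms(1), of "\<lambda>_. 1" "\<lambda>j. h j / real (card (cls n \<pi> j))"]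
    by simp
  also have "\<dots> = (\<Sum>j<k. h j)"
    using assms(2) by (intro sum.cong refl) auto
  finally show ?thesis by simp
qed

text \<open>Each vertex receives a probability distribution on labels such that the total label
  masses are exactly those prescribed by \<open>q\<close>, which no integral labelling can achieve
  in general. Exactness is what later allows gluing with a space whose labels have law
  \<open>q\<close>.\<close>

lemma fractional_labels:
  fixes q :: "nat \<Rightarrow> real"
  assumes \<pi>: "\<pi> ` {..<n} \<subseteq> {..<k}" and n: "n > 0"
    and q: "\<And>i. i < k \<Longrightarrow> 0 \<le> q i" "(\<Sum>i<k. q i) = 1"
  defines "a \<equiv> \<lambda>i. real (card (cls n \<pi> i)) / real n"
  obtains g where "\<And>u i. u < n \<Longrightarrow> i < k \<Longrightarrow> 0 \<le> g u i"
    "\<And>u. u < n \<Longrightarrow> (\<Sum>i<k. g u i) = 1"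
    "\<And>i. i < k \<Longrightarrow> (\<Sum>u<n. g u i) = real n * q i"
    "\<And>B. (\<And>i j. i < k \<Longrightarrow> j < k \<Longrightarrow> 0 \<le> B i j) \<Longrightarrow>
      (\<Sum>x\<in>{..<n} \<times> {..<k}. \<Sum>y\<in>{..<n} \<times> {..<k}.
          (g (fst x) (snd x) / real n) * (g (fst y) (snd y) / real n) * \<bar>B (\<pi> (fst x)) (\<pi> (fst y)) - B (snd x) (snd y)\<bar>)
      \<le> (\<Sum>i<k. \<Sum>j<k. B i j * (\<bar>a i - q i\<bar> * a j + q i * \<bar>a j - q j\<bar>))"
proof -
  have "(\<Sum>i<k. a i) = 1"
    unfolding a_def sum_divide_distrib[symmetric] of_nat_sum[symmetric] sum_card_cls[OF \<pi>] using n by simp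
  then obtain s where s0: "\<And>i j. i < k \<Longrightarrow> j < k \<Longrightarrow> 0 \<le> s i j"
    and row: "\<And>i. i < k \<Longrightarrow> (\<Sum>j<k. s i j) = a i" and col: "\<And>j. j < k \<Longrightarrow> (\<Sum>i<k. s i j) = q j"
    and off: "\<And>l. l < k \<Longrightarrow> (\<Sum>i<k. \<Sum>j<k. if i \<noteq> j \<and> (i = l \<or> j = l) then s i j else 0) \<le> \<bar>a l - q l\<bar>"
    using maximal_coupling[of k a q] q by (auto simp: a_def)
  \<comment> \<open>The conditional law of the second label given the first under the coupling
    \<open>s\<close>, the same for all vertices of a class.\<close>
  define g where "g u i = real n * s (\<pi> u) i / real (card (cls n \<pi> (\<pi> u)))" for u i
  define w where "w x = g (fst x) (snd x) / real n" for x
  let ?X = "{..<n} \<times> {..<k}"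
  have lt: "\<pi> u < k" if "u < n" for u using \<pi> that by auto
  have ne: "card (cls n \<pi> (\<pi> u)) \<noteq> 0" if "u < n" for u using that by (auto simp: cls_def)
  have s_zero: "s j i = 0" if "j < k" "i < k" "cls n \<pi> j = {}" for i j
    using row[OF that(1)] that sum_nonneg_eq_0_iff[of "{..<k}" "s j"] s0 by (auto simp: a_def)
  have g0: "0 \<le> g u i" if "u < n" "i < k" for u i
    unfolding g_def using s0 lt that by auto
  have g1: "(\<Sum>i<k. g u i) = 1" if "u < n" for u
    unfolding g_def sum_divide_distrib[symmetric] sum_distrib_left[symmetric]
    using row[OF lt[OF that]] ne[OF that] n by (simp add: a_def)
  have g2: "(\<Sum>u<n. g u i) = real n * q i" if "i < k" for i
  proof -
    have "(\<Sum>u<n. g u i) = (\<Sum>j<k. real n * s j i)"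
      unfolding g_def using s_zero that by (intro sum_over_classes[OF \<pi>]) auto
    then show ?thesis using col[OF that] by (simp add: sum_distrib_left[symmetric])
  qed
  have mv: "moved_mass ?X w (\<lambda>x. \<pi> (fst x)) snd l \<le> \<bar>a l - q l\<bar>" if "l < k" for l
  proof -
    have "moved_mass ?X w (\<lambda>x. \<pi> (fst x)) snd l
       = (\<Sum>u<n. \<Sum>i<k. if \<pi> u \<noteq> i \<and> (\<pi> u = l \<or> i = l) then g u i / real n else 0)"
      by (simp add: moved_mass_def sum.cartesian_product' w_def cong: if_cong)
    also have "\<dots> = (\<Sum>u<n. (\<Sum>i<k. if \<pi> u \<noteq> i \<and> (\<pi> u = l \<or> i = l) then s (\<pi> u) i else 0) / real (card (cls n \<pi> (\<pi> u))))"
      unfolding sum_divide_distrib using n by (intro sum.cong refl) (auto simp: g_def)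
    also have "\<dots> = (\<Sum>j<k. \<Sum>i<k. if j \<noteq> i \<and> (j = l \<or> i = l) then s j i else 0)"
      using s_zero by (intro sum_over_classes[OF \<pi>]) (auto intro!: sum.neutral)
    also have "\<dots> \<le> \<bar>a l - q l\<bar>" by (rule off[OF that])
    finally show ?thesis .
  qed
  show ?thesis
  proof (rule that[of g])
    fix B :: "nat \<Rightarrow> nat \<Rightarrow> real" assume B: "\<And>i j. i < k \<Longrightarrow> j < k \<Longrightarrow> 0 \<le> B i j"
    have m0: "0 \<le> moved_mass ?X w (\<lambda>x. \<pi> (fst x)) snd l" for l
      unfolding moved_mass_def using g0 by (intro sum_nonneg) (auto simp: w_def)
    have a0: "0 \<le> a j" for j by (simp add: a_def)
    have a': "(\<Sum>y\<in>?X. if \<pi> (fst y) = j then w y else 0) = a j" if "j < k" for j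
    proof -
      have "(\<Sum>y\<in>?X. if \<pi> (fst y) = j then w y else 0) = (\<Sum>u<n. if \<pi> u = j then (\<Sum>i<k. g u i) / real n else 0)"
        by (auto simp: sum.cartesian_product' w_def sum_divide_distrib intro!: sum.cong)
      also have "\<dots> = (\<Sum>u<n. if \<pi> u = j then 1 / real n else 0)"
        using g1 by (intro sum.cong) auto
      also have "\<dots> = a j" by (subst sum.inter_filter[symmetric]) (auto simp: a_def cls_def)
      finally show ?thesis .
    qed
    have q': "(\<Sum>y\<in>?X. if snd y = i then w y else 0) = q i" if "i < k" for i
    proof -
      have "(\<Sum>y\<in>?X. if snd y = i then w y else 0) = (\<Sum>u<n. g u i / real n)"
        using that by (simp add: sum.cartesian_product' w_def)
      then show ?thesis using g2[OF that] n by (simp add: sum_divide_distrib[symmetric])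
    qed
    have "(\<Sum>x\<in>?X. \<Sum>y\<in>?X. w x * w y * \<bar>B (\<pi> (fst x)) (\<pi> (fst y)) - B (snd x) (snd y)\<bar>)
      \<le> (\<Sum>i<k. \<Sum>j<k. B i j *
         (moved_mass ?X w (\<lambda>x. \<pi> (fst x)) snd i * (\<Sum>y\<in>?X. if \<pi> (fst y) = j then w y else 0)
          + (\<Sum>x\<in>?X. if snd x = i then w x else 0) * moved_mass ?X w (\<lambda>x. \<pi> (fst x)) snd j))"
      by (rule relabel_cost) (use lt g0 B in \<open>auto simp: w_def\<close>)
    also have "\<dots> \<le> (\<Sum>i<k. \<Sum>j<k. B i j * (\<bar>a i - q i\<bar> * a j + q i * \<bar>a j - q j\<bar>))"
      using B q(1) by (intro sum_mono mult_left_mono add_mono mult_mono) (auto simp: mv a' q' a0 m0)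
    finally show "(\<Sum>x\<in>?X. \<Sum>y\<in>?X. (g (fst x) (snd x) / real n) * (g (fst y) (snd y) / real n) * \<bar>B (\<pi> (fst x)) (\<pi> (fst y)) - B (snd x) (snd y)\<bar>)
      \<le> (\<Sum>i<k. \<Sum>j<k. B i j * (\<bar>a i - q i\<bar> * a j + q i * \<bar>a j - q j\<bar>))"
      by (simp add: w_def)
  qed (use g0 g1 g2 in auto)
qed

lemma l1_norm_relabel:
  fixes B :: "nat \<Rightarrow> nat \<Rightarrow> real"
  assumes "\<pi> ` {..<n} \<subseteq> {..<k}" "\<pi>' ` {..<n} \<subseteq> {..<k}"
    and B: "\<And>i j. i < k \<Longrightarrow> j < k \<Longrightarrow> 0 \<le> B i j"
    and d: "\<And>i. i < k \<Longrightarrow> real (card (touched n \<pi> \<pi>' i)) / real n \<le> d i"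
  shows "l1_norm n (\<lambda>u v. B (\<pi> u) (\<pi> v) - B (\<pi>' u) (\<pi>' v))
    \<le> (\<Sum>i<k. \<Sum>j<k. B i j * (d i * (real (card (cls n \<pi> j)) / real n) + real (card (cls n \<pi>' i)) / real n * d j))"
proof -
  have c: "(\<Sum>y<n. if p y = j then 1 / real n else 0) = real (card (cls n p j)) / real n" for p :: "nat \<Rightarrow> nat" and j
    by (subst sum.inter_filter[symmetric]) (auto simp: cls_def)
  have m: "moved_mass {..<n} (\<lambda>_. 1 / real n) \<pi> \<pi>' i = real (card (touched n \<pi> \<pi>' i)) / real n" for i
    unfolding moved_mass_def by (subst sum.inter_filter[symmetric]) (auto simp: touched_def)
  have "l1_norm n (\<lambda>u v. B (\<pi> u) (\<pi> v) - B (\<pi>' u) (\<pi>' v))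
     = (\<Sum>u<n. \<Sum>v<n. 1 / real n * (1 / real n) * \<bar>B (\<pi> u) (\<pi> v) - B (\<pi>' u) (\<pi>' v)\<bar>)"
    by (simp add: l1_norm_def sum_divide_distrib power2_eq_square)
  also have "\<dots> \<le> (\<Sum>i<k. \<Sum>j<k. B i j *
         (moved_mass {..<n} (\<lambda>_. 1 / real n) \<pi> \<pi>' i * (\<Sum>y<n. if \<pi> y = j then 1 / real n else 0)
          + (\<Sum>x<n. if \<pi>' x = i then 1 / real n else 0) * moved_mass {..<n} (\<lambda>_. 1 / real n) \<pi> \<pi>' j))"
    by (rule relabel_cost) (use assms in auto)
  also have "\<dots> \<le> (\<Sum>i<k. \<Sum>j<k. B i j * (d i * (real (card (cls n \<pi> j)) / real n) + real (card (cls n \<pi>' i)) / real n * d j))"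
    unfolding c m by (intro sum_mono mult_left_mono add_mono mult_right_mono) (auto simp: B d)
  finally show ?thesis .
qed

section \<open>Vertex couplings\<close>

lemma integral_pair_discrete:
  fixes F :: "'y \<Rightarrow> 'y \<Rightarrow> real"
  assumes P: "prob_space P" and Y[measurable]: "Y \<in> measurable P (count_space UNIV)"
    and X: "\<And>z. z \<in> space P \<Longrightarrow> Y z \<in> X" "finite X"
    and S[measurable]: "S \<in> sets P" and T[measurable]: "T \<in> sets P"
  shows "integrable (P \<Otimes>\<^sub>M P) (\<lambda>z. indicator S (fst z) * indicator T (snd z) * F (Y (fst z)) (Y (snd z)))" (is ?int)
    and "(\<integral>z. indicator S (fst z) * indicator T (snd z) * F (Y (fst z)) (Y (snd z)) \<partial>(P \<Otimes>\<^sub>M P))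
       = (\<Sum>x\<in>X. \<Sum>y\<in>X. measure P {z\<in>S. Y z = x} * measure P {z\<in>T. Y z = y} * F x y)" (is ?eq)
proof -
  interpret P: prob_space P by fact
  interpret PP: pair_prob_space P P ..
  have Ss: "S \<subseteq> space P" "T \<subseteq> space P" using sets.sets_into_space[OF S] sets.sets_into_space[OF T] by auto
  have mS[measurable]: "{z\<in>S. Y z = x} \<in> sets P" "{z\<in>T. Y z = x} \<in> sets P" for x
  proof -
    have "{z\<in>S. Y z = x} = S \<inter> {z\<in>space P. Y z = x}" "{z\<in>T. Y z = x} = T \<inter> {z\<in>space P. Y z = x}"
      using Ss by auto
    then show "{z\<in>S. Y z = x} \<in> sets P" "{z\<in>T. Y z = x} \<in> sets P" by simp_all
  qed
  have eq: "indicator S (fst z) * indicator T (snd z) * F (Y (fst z)) (Y (snd z))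
     = (\<Sum>x\<in>X. \<Sum>y\<in>X. F x y * indicator ({z\<in>S. Y z = x} \<times> {z\<in>T. Y z = y}) z)" if "z \<in> space (P \<Otimes>\<^sub>M P)" for z
  proof -
    have z: "Y (fst z) \<in> X" "Y (snd z) \<in> X" using that X by (auto simp: space_pair_measure)
    have "(\<Sum>x\<in>X. \<Sum>y\<in>X. F x y * indicator ({z\<in>S. Y z = x} \<times> {z\<in>T. Y z = y}) z)
      = (\<Sum>x\<in>X. \<Sum>y\<in>X. if y = Y (snd z) then (if x = Y (fst z) then indicator S (fst z) * indicator T (snd z) * F x y else 0) else 0)"
      by (intro sum.cong refl) (auto simp: indicator_def mem_Times_iff)
    also have "\<dots> = indicator S (fst z) * indicator T (snd z) * F (Y (fst z)) (Y (snd z))"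
      using z X(2) by simp
    finally show ?thesis ..
  qed
  have ms: "measure (P \<Otimes>\<^sub>M P) (A \<times> B) = measure P A * measure P B" if "A \<in> sets P" "B \<in> sets P" for A B
    using that by (simp add: measure_def P.emeasure_pair_measure_Times enn2real_mult)
  show ?int
    by (subst Bochner_Integration.integrable_cong[OF refl eq]) (auto simp: less_top[symmetric])
  show ?eq
    by (subst Bochner_Integration.integral_cong[OF refl eq])
      (auto simp: ms Bochner_Integration.integral_sum less_top[symmetric] mult.commute)
qed

lemma (in prob_space) integral_pair_finite:
  fixes F :: "'y \<Rightarrow> 'y \<Rightarrow> real"
  assumes Y: "Y \<in> measurable M (count_space UNIV)" and X: "\<And>z. z \<in> space M \<Longrightarrow> Y z \<in> X" "finite X"
  shows "integrable (M \<Otimes>\<^sub>M M) (\<lambda>z. F (Y (fst z)) (Y (snd z)))"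
    and "(\<integral>z. F (Y (fst z)) (Y (snd z)) \<partial>(M \<Otimes>\<^sub>M M))
       = (\<Sum>x\<in>X. \<Sum>y\<in>X. prob {z\<in>space M. Y z = x} * prob {z\<in>space M. Y z = y} * F x y)"
proof -
  note d = integral_pair_discrete[OF prob_space_axioms Y X sets.top sets.top, of F]
  have eq: "F (Y (fst z)) (Y (snd z)) = indicator (space M) (fst z) * indicator (space M) (snd z) * F (Y (fst z)) (Y (snd z))"
    if "z \<in> space (M \<Otimes>\<^sub>M M)" for z
    using that by (auto simp: space_pair_measure)
  show "integrable (M \<Otimes>\<^sub>M M) (\<lambda>z. F (Y (fst z)) (Y (snd z)))"
    by (subst Bochner_Integration.integrable_cong[OF refl eq]) (use d(1) in auto)
  show "(\<integral>z. F (Y (fst z)) (Y (snd z)) \<partial>(M \<Otimes>\<^sub>M M))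
       = (\<Sum>x\<in>X. \<Sum>y\<in>X. prob {z\<in>space M. Y z = x} * prob {z\<in>space M. Y z = y} * F x y)"
    by (subst Bochner_Integration.integral_cong[OF refl eq]) (use d(2) in auto)
qed

lemma space_bm_measure [simp]: "space (bm_measure k p) = {..<k}"
  and sets_bm_measure [simp]: "sets (bm_measure k p) = Pow {..<k}"
  by (simp_all add: bm_measure_def space_point_measure sets_point_measure)

lemma measurable_to_bm:
  "f \<in> measurable N (count_space UNIV) \<Longrightarrow> (\<And>z. z \<in> space N \<Longrightarrow> f z < k) \<Longrightarrow> f \<in> measurable N (bm_measure k p)"
  by (subst measurable_cong_sets[OF refl, of _ "count_space {..<k}"])
    (auto simp: measurable_def)

lemma measurable_from_bm: "f ` {..<k} \<subseteq> space N \<Longrightarrow> f \<in> measurable (bm_measure k p) N"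
  by (auto simp: measurable_def)

lemma coupling_prob_space:
  assumes "prob_space N" "\<nu> \<in> couplings M N"
  shows "prob_space \<nu>"
proof -
  interpret N: prob_space N by fact
  have s: "sets \<nu> = sets (M \<Otimes>\<^sub>M N)" and d: "distr \<nu> N snd = N" using assms by (auto simp: couplings_def)
  have [measurable]: "snd \<in> measurable \<nu> N" by (subst measurable_cong_sets[OF s refl]) simp
  have "emeasure \<nu> (space \<nu>) = emeasure (distr \<nu> N snd) (space N)"
    by (subst emeasure_distr) (auto intro!: arg_cong2[where f = emeasure] measurable_space[of snd \<nu> N])
  then show ?thesis unfolding d by (intro prob_spaceI) (simp add: N.emeasure_space_1)
qed

text \<open>Two independent copies of \<open>y\<close> have joint law
  \<open>M \<Otimes>\<^sub>M M\<close>, so this is a change of variables.\<close>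

lemma integrable_pair_comp:
  fixes W :: "'a \<Rightarrow> 'a \<Rightarrow> real"
  assumes P: "prob_space P" and y[measurable]: "y \<in> measurable P M" and d: "distr P M y = M"
    and W: "integrable (M \<Otimes>\<^sub>M M) (\<lambda>(x,y). W x y)"
  shows "integrable (P \<Otimes>\<^sub>M P) (\<lambda>z. W (y (fst z)) (y (snd z)))"
    and "(\<integral>z. W (y (fst z)) (y (snd z)) \<partial>(P \<Otimes>\<^sub>M P)) = (\<integral>z. W (fst z) (snd z) \<partial>(M \<Otimes>\<^sub>M M))"
proof -
  interpret P: prob_space P by fact
  interpret D: prob_space "distr P M y" by (rule P.prob_space_distr) simp
  have eq: "M \<Otimes>\<^sub>M M = distr (P \<Otimes>\<^sub>M P) (M \<Otimes>\<^sub>M M) (\<lambda>(a,b). (y a, y b))"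
    using pair_measure_distr[OF y y D.sigma_finite_measure] d by simp
  have W': "integrable (M \<Otimes>\<^sub>M M) (\<lambda>z. W (fst z) (snd z))" using W by (simp add: case_prod_unfold)
  then have m[measurable]: "(\<lambda>z. W (fst z) (snd z)) \<in> borel_measurable (M \<Otimes>\<^sub>M M)" by auto
  show "integrable (P \<Otimes>\<^sub>M P) (\<lambda>z. W (y (fst z)) (y (snd z)))"
    using W' by (subst (asm) eq, subst (asm) integrable_distr_eq) (auto simp: case_prod_unfold)
  have "(\<integral>z. W (fst z) (snd z) \<partial>(M \<Otimes>\<^sub>M M)) = (\<integral>z. W (fst z) (snd z) \<partial>distr (P \<Otimes>\<^sub>M P) (M \<Otimes>\<^sub>M M) (\<lambda>(a,b). (y a, y b)))"
    by (simp add: eq[symmetric])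
  also have "\<dots> = (\<integral>z. W (y (fst z)) (y (snd z)) \<partial>(P \<Otimes>\<^sub>M P))"
    by (subst integral_distr) (auto simp: case_prod_unfold)
  finally show "(\<integral>z. W (y (fst z)) (y (snd z)) \<partial>(P \<Otimes>\<^sub>M P)) = (\<integral>z. W (fst z) (snd z) \<partial>(M \<Otimes>\<^sub>M M))" ..
qed

lemma coupling_integrable:
  fixes V :: "nat \<Rightarrow> nat \<Rightarrow> real"
  assumes M: "prob_space M" and W: "graphon M W" and c: "\<nu> \<in> couplings (bm_measure k p) M"
  shows "integrable (\<nu> \<Otimes>\<^sub>M \<nu>) (\<lambda>((x,x'),(y,y')). V x y - W x' y')"
proof -
  interpret nu: prob_space \<nu> by (rule coupling_prob_space[OF M c])
  have s: "sets \<nu> = sets (bm_measure k p \<Otimes>\<^sub>M M)" and d: "distr \<nu> M snd = M" using c by (auto simp: couplings_def)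
  have sp: "space \<nu> = {..<k} \<times> space M" using sets_eq_imp_space_eq[OF s] by (simp add: space_pair_measure)
  have snd: "snd \<in> measurable \<nu> M" by (subst measurable_cong_sets[OF s refl]) simp
  have "fst \<in> measurable \<nu> (bm_measure k p)" by (subst measurable_cong_sets[OF s refl]) simp
  then have fst: "fst \<in> measurable \<nu> (count_space UNIV)"
    by (rule measurable_compose[OF _ measurable_from_bm, of fst _ k p "\<lambda>x. x", simplified]) simp
  have "integrable (\<nu> \<Otimes>\<^sub>M \<nu>) (\<lambda>z. V (fst (fst z)) (fst (snd z)))"
    by (rule nu.integral_pair_finite(1)[OF fst, of "{..<k}"]) (auto simp: sp)
  moreover have "integrable (\<nu> \<Otimes>\<^sub>M \<nu>) (\<lambda>z. W (snd (fst z)) (snd (snd z)))"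
    using W integrable_pair_comp(1)[OF nu.prob_space_axioms snd d] by (auto simp: graphon_def)
  ultimately show ?thesis by (simp add: case_prod_unfold)
qed

lemma abs_set_integral_le:
  fixes f :: "'b \<Rightarrow> real"
  assumes "integrable \<mu> f" "A \<in> sets \<mu>"
  shows "\<bar>set_lebesgue_integral \<mu> A f\<bar> \<le> (\<integral>z. \<bar>f z\<bar> \<partial>\<mu>)"
proof -
  have i: "integrable \<mu> (\<lambda>x. indicator A x *\<^sub>R f x)"
    using assms by (intro integrable_mult_indicator) auto
  have "\<bar>set_lebesgue_integral \<mu> A f\<bar> \<le> (\<integral>z. \<bar>indicator A z *\<^sub>R f z\<bar> \<partial>\<mu>)"
    unfolding set_lebesgue_integral_def using integral_norm_bound[of \<mu> "\<lambda>z. indicator A z *\<^sub>R f z"] by simp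
  also have "\<dots> \<le> (\<integral>z. \<bar>f z\<bar> \<partial>\<mu>)"
    using assms(1) i by (intro integral_mono) (auto simp: indicator_def)
  finally show ?thesis .
qed

text \<open>The quantity minimized over couplings in \<open>cut_dist\<close>, isolated because
  real-valued infima and suprema need explicit boundedness.\<close>

definition cut_sup where
  "cut_sup M W N V \<nu> = (SUP ST\<in>sets (M \<Otimes>\<^sub>M N) \<times> sets (M \<Otimes>\<^sub>M N).
          \<bar>set_lebesgue_integral (\<nu> \<Otimes>\<^sub>M \<nu>) (fst ST \<times> snd ST) (\<lambda>((x,x'),(y,y')). W x y - V x' y' :: real)\<bar>)"

text \<open>The $L^1$ norm bounds the family from above, so the supremum dominates its value 0 at
  the empty rectangle. This also bounds the infimum over couplings from below.\<close>

lemma cut_sup_nonneg: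
  fixes V :: "nat \<Rightarrow> nat \<Rightarrow> real"
  assumes M: "prob_space M" and W: "graphon M W" and c: "\<nu> \<in> couplings (bm_measure k p) M"
  shows "0 \<le> cut_sup (bm_measure k p) V M W \<nu>"
proof -
  have s: "sets \<nu> = sets (bm_measure k p \<Otimes>\<^sub>M M)" using c by (auto simp: couplings_def)
  let ?f = "\<lambda>((x,x'),(y,y')). V x y - W x' y'"
  let ?g = "\<lambda>ST. \<bar>set_lebesgue_integral (\<nu> \<Otimes>\<^sub>M \<nu>) (fst ST \<times> snd ST) ?f\<bar>"
  have "bdd_above (?g ` (sets (bm_measure k p \<Otimes>\<^sub>M M) \<times> sets (bm_measure k p \<Otimes>\<^sub>M M)))"
    by (rule bdd_aboveI2[where M = "\<integral>z. \<bar>?f z\<bar> \<partial>(\<nu> \<Otimes>\<^sub>M \<nu>)"], rule abs_set_integral_le)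
       (auto simp: s intro!: coupling_integrable[OF M W c] pair_measureI)
  then have "?g ({},{}) \<le> cut_sup (bm_measure k p) V M W \<nu>"
    unfolding cut_sup_def by (intro cSUP_upper) auto
  then show ?thesis by linarith
qed

lemma cut_dist_le_cut_sup:
  fixes V :: "nat \<Rightarrow> nat \<Rightarrow> real"
  assumes M: "prob_space M" and W: "graphon M W" and c: "\<nu> \<in> couplings (bm_measure k p) M"
  shows "cut_dist (bm_measure k p) V M W \<le> cut_sup (bm_measure k p) V M W \<nu>"
  unfolding cut_dist_def cut_sup_def[symmetric]
  by (intro cINF_lower c bdd_belowI2[where m = 0] cut_sup_nonneg M W)

lemma cut_dist_nonneg:
  fixes V :: "nat \<Rightarrow> nat \<Rightarrow> real"
  assumes M: "prob_space M" and W: "graphon M W" and "couplings (bm_measure k p) M \<noteq> {}"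
  shows "0 \<le> cut_dist (bm_measure k p) V M W"
  unfolding cut_dist_def cut_sup_def[symmetric]
  using assms by (intro cINF_greatest cut_sup_nonneg M W)

text \<open>A uniform vertex has a class label whose law is given by the class frequencies, so any
  joint realization of a uniform vertex and a point of law \<open>M\<close> yields a coupling for
  the estimate.\<close>

lemma vertex_coupling:
  assumes P: "prob_space P" and M: "prob_space M"
    and f[measurable]: "f \<in> measurable P (count_space UNIV)" and fn: "\<And>z. z \<in> space P \<Longrightarrow> f z < n"
    and unif: "\<And>u. u < n \<Longrightarrow> measure P {z\<in>space P. f z = u} = 1 / real n"
    and y[measurable]: "y \<in> measurable P M" and d: "distr P M y = M"
    and \<pi>: "\<pi> ` {..<n} \<subseteq> {..<k}"
  shows "(\<lambda>z. (\<pi> (f z), y z)) \<in> measurable P (bm_measure k (\<lambda>i. real (card (cls n \<pi> i)) / real n) \<Otimes>\<^sub>M M)"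
    and "distr P (bm_measure k (\<lambda>i. real (card (cls n \<pi> i)) / real n) \<Otimes>\<^sub>M M) (\<lambda>z. (\<pi> (f z), y z))
       \<in> couplings (bm_measure k (\<lambda>i. real (card (cls n \<pi> i)) / real n)) M"
proof -
  interpret P: prob_space P by fact
  let ?bm = "bm_measure k (\<lambda>i. real (card (cls n \<pi> i)) / real n)"
  have pf[measurable]: "(\<lambda>z. \<pi> (f z)) \<in> measurable P ?bm"
    by (rule measurable_to_bm) (use fn \<pi> in auto)
  show m[measurable]: "(\<lambda>z. (\<pi> (f z), y z)) \<in> measurable P (?bm \<Otimes>\<^sub>M M)" by measurable
  have "distr P ?bm (\<lambda>z. \<pi> (f z)) = ?bm"
  proof (rule measure_eqI_finite[of _ "{..<k}"])
    fix i assume "i \<in> {..<k}"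
    then have i: "i < k" by simp
    have "emeasure (distr P ?bm (\<lambda>z. \<pi> (f z))) {i} = emeasure P (\<Union>u\<in>cls n \<pi> i. {z\<in>space P. f z = u})"
      using i fn by (subst emeasure_distr[OF pf]) (auto simp: cls_def intro!: arg_cong2[where f = emeasure])
    also have "\<dots> = ennreal (measure P (\<Union>u\<in>cls n \<pi> i. {z\<in>space P. f z = u}))"
      by (rule P.emeasure_eq_measure)
    also have "measure P (\<Union>u\<in>cls n \<pi> i. {z\<in>space P. f z = u}) = (\<Sum>u\<in>cls n \<pi> i. measure P {z\<in>space P. f z = u})"
      by (intro P.finite_measure_finite_Union) (auto simp: disjoint_family_on_def)
    also have "\<dots> = (\<Sum>u\<in>cls n \<pi> i. 1 / real n)"
      by (intro sum.cong refl unif) (auto simp: cls_def)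
    also have "ennreal \<dots> = emeasure ?bm {i}"
      using i unfolding bm_measure_def by (subst emeasure_point_measure_finite) auto
    finally show "emeasure (distr P ?bm (\<lambda>z. \<pi> (f z))) {i} = emeasure ?bm {i}" .
  qed auto
  then show "distr P (?bm \<Otimes>\<^sub>M M) (\<lambda>z. (\<pi> (f z), y z)) \<in> couplings ?bm M"
    using d by (simp add: couplings_def distr_distr comp_def)
qed

text \<open>The integrand splits as (V - H) + (H - W). The first part depends on the two vertices
  only, so test sets act on it as fractional vertex sets and the cut norm bounds it; the second is
  bounded in $L^1$. The cut norm is thus kept exactly where randomness makes it small.\<close>

lemma cut_dist_le_vertex_coupling:
  fixes V H :: "nat \<Rightarrow> nat \<Rightarrow> real"
  assumes P: "prob_space P" and M: "prob_space M" and W: "graphon M W" and n: "n > 0"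
    and f[measurable]: "f \<in> measurable P (count_space UNIV)" and fn: "\<And>z. z \<in> space P \<Longrightarrow> f z < n"
    and unif: "\<And>u. u < n \<Longrightarrow> measure P {z\<in>space P. f z = u} = 1 / real n"
    and y[measurable]: "y \<in> measurable P M" and d: "distr P M y = M"
    and \<pi>: "\<pi> ` {..<n} \<subseteq> {..<k}"
  shows "cut_dist (bm_measure k (\<lambda>i. real (card (cls n \<pi> i)) / real n)) V M W
    \<le> cut_norm n (\<lambda>u v. V (\<pi> u) (\<pi> v) - H u v)
      + (\<integral>z. \<bar>H (f (fst z)) (f (snd z)) - W (y (fst z)) (y (snd z))\<bar> \<partial>(P \<Otimes>\<^sub>M P))"
    (is "?cd \<le> ?cn + ?I")
proof -
  interpret P: prob_space P by fact
  let ?bm = "bm_measure k (\<lambda>i. real (card (cls n \<pi> i)) / real n)"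
  note vc = vertex_coupling[OF P M f fn unif y d \<pi>]
  define T where "T z = (\<pi> (f z), y z)" for z
  have mT[measurable]: "T \<in> measurable P (?bm \<Otimes>\<^sub>M M)" using vc(1) by (simp add: T_def[abs_def])
  define \<nu> where "\<nu> = distr P (?bm \<Otimes>\<^sub>M M) T"
  have nu: "\<nu> \<in> couplings ?bm M" using vc(2) by (simp add: T_def[abs_def] \<nu>_def)
  interpret nu: prob_space \<nu> unfolding \<nu>_def by (rule P.prob_space_distr) simp
  have nn: "\<nu> \<Otimes>\<^sub>M \<nu> = distr (P \<Otimes>\<^sub>M P) (\<nu> \<Otimes>\<^sub>M \<nu>) (\<lambda>(a,b). (T a, T b))"
  proof -
    have "\<nu> \<Otimes>\<^sub>M \<nu> = distr (P \<Otimes>\<^sub>M P) ((?bm \<Otimes>\<^sub>M M) \<Otimes>\<^sub>M (?bm \<Otimes>\<^sub>M M)) (\<lambda>(a,b). (T a, T b))"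
      unfolding \<nu>_def using nu.sigma_finite_measure unfolding \<nu>_def by (intro pair_measure_distr) auto
    also have "\<dots> = distr (P \<Otimes>\<^sub>M P) (\<nu> \<Otimes>\<^sub>M \<nu>) (\<lambda>(a,b). (T a, T b))"
      by (intro distr_cong refl sets_pair_measure_cong) (auto simp: \<nu>_def)
    finally show ?thesis .
  qed
  have T': "T \<in> measurable P \<nu>" using mT by (simp add: \<nu>_def)
  note [measurable] = T'
  have iW: "integrable (P \<Otimes>\<^sub>M P) (\<lambda>z. W (y (fst z)) (y (snd z)))"
    using W integrable_pair_comp(1)[OF P y d] by (auto simp: graphon_def)
  have iF: "integrable (P \<Otimes>\<^sub>M P) (\<lambda>z. F (f (fst z)) (f (snd z)))" for F :: "nat \<Rightarrow> nat \<Rightarrow> real"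
    by (rule P.integral_pair_finite(1)[OF f, of "{..<n}"]) (auto simp: fn)
  have "cut_sup ?bm V M W \<nu> \<le> ?cn + ?I"
    unfolding cut_sup_def
  proof (rule cSUP_least)
    fix ST assume "ST \<in> sets (?bm \<Otimes>\<^sub>M M) \<times> sets (?bm \<Otimes>\<^sub>M M)"
    then obtain S0 T0 where ST: "ST = (S0, T0)" and S0[measurable]: "S0 \<in> sets (?bm \<Otimes>\<^sub>M M)" and T0[measurable]: "T0 \<in> sets (?bm \<Otimes>\<^sub>M M)"
      by auto
    define S' where "S' = T -` S0 \<inter> space P"
    define T'' where "T'' = T -` T0 \<inter> space P"
    have mS[measurable]: "S' \<in> sets P" "T'' \<in> sets P" unfolding S'_def T''_def by measurable
    let ?F = "\<lambda>u v. V (\<pi> u) (\<pi> v) - H u v"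
    let ?ind = "\<lambda>z. indicator S' (fst z) * indicator T'' (snd z) :: real"
    let ?g = "\<lambda>((x,x'),(y,y')). V x y - W x' y'"
    have iHW: "integrable (P \<Otimes>\<^sub>M P) (\<lambda>z. H (f (fst z)) (f (snd z)) - W (y (fst z)) (y (snd z)))"
      by (intro Bochner_Integration.integrable_diff iF iW)
    have i2: "integrable (P \<Otimes>\<^sub>M P) (\<lambda>z. ?ind z * (H (f (fst z)) (f (snd z)) - W (y (fst z)) (y (snd z))))"
    proof (rule Bochner_Integration.integrable_bound[OF iHW])
      show "(\<lambda>z. ?ind z * (H (f (fst z)) (f (snd z)) - W (y (fst z)) (y (snd z)))) \<in> borel_measurable (P \<Otimes>\<^sub>M P)"
        by (intro borel_measurable_times borel_measurable_integrable[OF iHW]) measurable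
    qed (auto simp: indicator_def)
    have gm: "?g \<in> borel_measurable (\<nu> \<Otimes>\<^sub>M \<nu>)" using coupling_integrable[OF M W nu] by auto
    have "set_lebesgue_integral (\<nu> \<Otimes>\<^sub>M \<nu>) (S0 \<times> T0) ?g
        = (\<integral>z. indicator (S0 \<times> T0) (T (fst z), T (snd z)) * ?g (T (fst z), T (snd z)) \<partial>(P \<Otimes>\<^sub>M P))"
      unfolding set_lebesgue_integral_def
      apply (subst (1) nn, subst integral_distr)
        apply measurable[1]
       apply (intro borel_measurable_scaleR borel_measurable_indicator gm)
       apply (auto simp: \<nu>_def case_prod_unfold)
      done
    also have "\<dots> = (\<integral>z. ?ind z * ?F (f (fst z)) (f (snd z)) + ?ind z * (H (f (fst z)) (f (snd z)) - W (y (fst z)) (y (snd z))) \<partial>(P \<Otimes>\<^sub>M P))"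
      by (intro Bochner_Integration.integral_cong refl)
         (auto simp: space_pair_measure S'_def T''_def T_def indicator_def split: if_splits)
    also have "\<dots> = (\<integral>z. ?ind z * ?F (f (fst z)) (f (snd z)) \<partial>(P \<Otimes>\<^sub>M P)) + (\<integral>z. ?ind z * (H (f (fst z)) (f (snd z)) - W (y (fst z)) (y (snd z))) \<partial>(P \<Otimes>\<^sub>M P))"
      using integral_pair_discrete(1)[OF P f _ _ mS, of "{..<n}" ?F] fn
      by (intro Bochner_Integration.integral_add i2) auto
    finally have e: "set_lebesgue_integral (\<nu> \<Otimes>\<^sub>M \<nu>) (S0 \<times> T0) ?g = \<dots>" .
    have "\<bar>\<integral>z. ?ind z * (H (f (fst z)) (f (snd z)) - W (y (fst z)) (y (snd z))) \<partial>(P \<Otimes>\<^sub>M P)\<bar> \<le> ?I"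
      by (rule order_trans[OF integral_abs_bound]) (intro integral_mono integrable_abs i2 iHW, auto simp: indicator_def)
    moreover have "\<bar>\<integral>z. ?ind z * ?F (f (fst z)) (f (snd z)) \<partial>(P \<Otimes>\<^sub>M P)\<bar> \<le> ?cn"
    proof -
      \<comment> \<open>The conditional probability of the test set given the vertex, hence a number
        in [0, 1].\<close>
      define a where "a u = real n * measure P {z\<in>S'. f z = u}" for u
      define b where "b u = real n * measure P {z\<in>T''. f z = u}" for u
      have le: "measure P {z\<in>U. f z = u} \<le> 1 / real n" if "u < n" "U \<in> sets P" for u U
        using sets.sets_into_space[OF that(2)] unfolding unif[OF that(1), symmetric] by (intro P.finite_measure_mono) auto
      have "(\<integral>z. ?ind z * ?F (f (fst z)) (f (snd z)) \<partial>(P \<Otimes>\<^sub>M P))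
         = (\<Sum>u<n. \<Sum>v<n. a u * b v * ?F u v) / (real n)^2"
        using integral_pair_discrete(2)[OF P f _ _ mS, of "{..<n}" ?F] fn n
        by (simp add: a_def b_def sum_divide_distrib power2_eq_square mult.assoc)
      moreover have "\<bar>\<Sum>u<n. \<Sum>v<n. a u * b v * ?F u v\<bar> / (real n)^2 \<le> ?cn"
        using le mS n by (intro fractional_cut_le) (auto simp: a_def b_def field_simps)
      ultimately show ?thesis by simp
    qed
    ultimately show "\<bar>set_lebesgue_integral (\<nu> \<Otimes>\<^sub>M \<nu>) (fst ST \<times> snd ST) ?g\<bar> \<le> ?cn + ?I"
      using e by (simp add: ST)
  qed auto
  with cut_dist_le_cut_sup[OF M W nu, of V] show ?thesis by linarith
qed

section \<open>Couplings with block models\<close>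

text \<open>A coupling of \<open>M\<close> with a block model is presented by a probability space \<open>N\<close> that carries a point \<open>\<xi>\<close>
  with law \<open>M\<close> and a label; this covers the elements of \<open>couplings\<close> as well as step functions on \<open>M\<close>
  itself.\<close>

locale block_coupling = prob_space N for N :: "'c measure" +
  fixes M :: "'a measure" and W :: "'a \<Rightarrow> 'a \<Rightarrow> real" and \<xi> :: "'c \<Rightarrow> 'a"
    and lab :: "'c \<Rightarrow> nat" and k :: nat and B :: "nat \<Rightarrow> nat \<Rightarrow> real"
  assumes prob_M: "prob_space M" and graphon: "graphon M W"
    and meas_\<xi> [measurable]: "\<xi> \<in> measurable N M" and distr_\<xi>: "distr N M \<xi> = M"
    and meas_lab [measurable]: "lab \<in> measurable N (count_space UNIV)"
    and lab_less: "\<And>z. z \<in> space N \<Longrightarrow> lab z < k"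
    and B_nonneg: "\<And>i j. i < k \<Longrightarrow> j < k \<Longrightarrow> 0 \<le> B i j"
begin

definition q :: "nat \<Rightarrow> real" where "q i = prob {z\<in>space N. lab z = i}"

definition err :: real where
  "err = (\<integral>z. \<bar>B (lab (fst z)) (lab (snd z)) - W (\<xi> (fst z)) (\<xi> (snd z))\<bar> \<partial>(N \<Otimes>\<^sub>M N))"

lemma q_nonneg: "0 \<le> q i"
  by (simp add: q_def)

lemma sum_q: "(\<Sum>i<k. q i) = 1"
proof -
  have "(\<Sum>i<k. q i) = prob (\<Union>i<k. {z\<in>space N. lab z = i})"
    unfolding q_def by (intro finite_measure_finite_Union[symmetric]) (auto simp: disjoint_family_on_def)
  also have "(\<Union>i<k. {z\<in>space N. lab z = i}) = space N" using lab_less by auto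
  finally show ?thesis by (simp add: prob_space)
qed

text \<open>Labels of zero weight must be discarded before a density with \<open>q\<close> in its
  denominator is used.\<close>

lemma AE_q_pos: "AE z in N. 0 < q (lab z)"
proof -
  have "AE z in N. \<forall>i\<in>{i\<in>{..<k}. q i = 0}. lab z \<noteq> i"
  proof (rule AE_finite_allI)
    fix i assume "i \<in> {i\<in>{..<k}. q i = 0}"
    then have "prob {z\<in>space N. lab z = i} = 0" by (simp add: q_def)
    then show "AE z in N. lab z \<noteq> i"
      by (intro AE_I[where N = "{z\<in>space N. lab z = i}"]) (auto simp: emeasure_eq_measure)
  qed simp
  then show ?thesis using AE_space
  proof eventually_elim
    case (elim z)
    then have "q (lab z) \<noteq> 0" using lab_less[of z] by auto
    then show ?case using q_nonneg[of "lab z"] by simp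
  qed
qed

lemma integrable_lab:
  fixes F :: "nat \<Rightarrow> nat \<Rightarrow> real"
  shows "integrable (N \<Otimes>\<^sub>M N) (\<lambda>z. F (lab (fst z)) (lab (snd z)))"
    and "(\<integral>z. F (lab (fst z)) (lab (snd z)) \<partial>(N \<Otimes>\<^sub>M N)) = (\<Sum>i<k. \<Sum>j<k. q i * q j * F i j)"
  using integral_pair_finite[OF meas_lab, of "{..<k}" F] lab_less by (auto simp: q_def)

lemma integrable_W:
  "integrable (N \<Otimes>\<^sub>M N) (\<lambda>z. W (\<xi> (fst z)) (\<xi> (snd z)))"
  "(\<integral>z. W (\<xi> (fst z)) (\<xi> (snd z)) \<partial>(N \<Otimes>\<^sub>M N)) = (\<integral>z. W (fst z) (snd z) \<partial>(M \<Otimes>\<^sub>M M))"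
  using graphon integrable_pair_comp[OF prob_space_axioms meas_\<xi> distr_\<xi>] by (auto simp: graphon_def)

lemma integrable_diff:
  "integrable (N \<Otimes>\<^sub>M N) (\<lambda>z. \<bar>B (lab (fst z)) (lab (snd z)) - W (\<xi> (fst z)) (\<xi> (snd z))\<bar>)"
  by (intro integrable_abs Bochner_Integration.integrable_diff integrable_lab integrable_W)

text \<open>A uniform vertex and a point of \<open>N\<close> are realized jointly so that the vertex
  has its class as label and the point its own label, and the two labels mostly agree. The three
  summands are the distance of \<open>H\<close> to the block matrix, the disagreement of the labels,
  and the error of the block model.\<close>

lemma vertex_coupling_exists:
  fixes H :: "nat \<Rightarrow> nat \<Rightarrow> real"
  assumes \<pi>: "\<pi> ` {..<n} \<subseteq> {..<k}" and n: "n > 0"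
  defines "a \<equiv> \<lambda>i. real (card (cls n \<pi> i)) / real n"
  obtains P :: "(nat \<times> 'c) measure" and f y where "prob_space P" "f \<in> measurable P (count_space UNIV)" "\<And>z. z \<in> space P \<Longrightarrow> f z < n"
    "\<And>u. u < n \<Longrightarrow> measure P {z\<in>space P. f z = u} = 1 / real n"
    "y \<in> measurable P M" "distr P M y = M"
    "(\<integral>z. \<bar>H (f (fst z)) (f (snd z)) - W (y (fst z)) (y (snd z))\<bar> \<partial>(P \<Otimes>\<^sub>M P))
      \<le> l1_norm n (\<lambda>u v. H u v - B (\<pi> u) (\<pi> v))
         + (\<Sum>i<k. \<Sum>j<k. B i j * (\<bar>a i - q i\<bar> * a j + q i * \<bar>a j - q j\<bar>)) + err"
proof -
  obtain g where g0: "\<And>u i. u < n \<Longrightarrow> i < k \<Longrightarrow> 0 \<le> g u i"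
    and g1: "\<And>u. u < n \<Longrightarrow> (\<Sum>i<k. g u i) = 1"
    and g2: "\<And>i. i < k \<Longrightarrow> (\<Sum>u<n. g u i) = real n * q i"
    and g3: "(\<Sum>x\<in>{..<n} \<times> {..<k}. \<Sum>y\<in>{..<n} \<times> {..<k}.
          (g (fst x) (snd x) / real n) * (g (fst y) (snd y) / real n) * \<bar>B (\<pi> (fst x)) (\<pi> (fst y)) - B (snd x) (snd y)\<bar>)
      \<le> (\<Sum>i<k. \<Sum>j<k. B i j * (\<bar>a i - q i\<bar> * a j + q i * \<bar>a j - q j\<bar>))"
  proof (rule fractional_labels[OF \<pi> n q_nonneg sum_q])
    fix g
    assume *: "\<And>u i. u < n \<Longrightarrow> i < k \<Longrightarrow> 0 \<le> g u i" "\<And>u. u < n \<Longrightarrow> (\<Sum>i<k. g u i) = 1"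
      "\<And>i. i < k \<Longrightarrow> (\<Sum>u<n. g u i) = real n * q i"
    assume **: "\<And>B. (\<And>i j. i < k \<Longrightarrow> j < k \<Longrightarrow> 0 \<le> B i j) \<Longrightarrow>
      (\<Sum>x\<in>{..<n} \<times> {..<k}. \<Sum>y\<in>{..<n} \<times> {..<k}.
          (g (fst x) (snd x) / real n) * (g (fst y) (snd y) / real n) * \<bar>B (\<pi> (fst x)) (\<pi> (fst y)) - B (snd x) (snd y)\<bar>)
      \<le> (\<Sum>i<k. \<Sum>j<k. B i j * (\<bar>real (card (cls n \<pi> i)) / real n - q i\<bar> * (real (card (cls n \<pi> j)) / real n)
             + q i * \<bar>real (card (cls n \<pi> j)) / real n - q j\<bar>))"
    show thesis by (rule that[of g]) (use * **[of B] B_nonneg in \<open>simp_all add: a_def\<close>)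
  qed
  have g_zero: "g u i = 0" if "u < n" "i < k" "q i = 0" for u i
    using g2[OF that(2)] that sum_nonneg_eq_0_iff[of "{..<n}" "\<lambda>u. g u i"] g0 by auto
  \<comment> \<open>Given a point with label i, vertex u is chosen with probability g u i / (n q i).
    These sum to 1 over u, so the second marginal is \<open>N\<close>, while the pair of vertex and
    label has weight g u i / n.\<close>
  define dens where "dens u i = ennreal (g u i / (real n * q i))" for u i
  let ?C = "count_space {..<n}"
  have [measurable]: "(\<lambda>x. dens (fst x) (lab (snd x))) \<in> borel_measurable (?C \<Otimes>\<^sub>M N)"
    by (rule measurable_pair_measure_countable1) auto
  define P where "P = density (?C \<Otimes>\<^sub>M N) (\<lambda>x. dens (fst x) (lab (snd x)))"
  have sp: "space P = {..<n} \<times> space N" by (simp add: P_def space_pair_measure)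
  have sets_P: "sets P = sets (?C \<Otimes>\<^sub>M N)" by (simp add: P_def)
  have nnP: "(\<integral>\<^sup>+x. h x \<partial>P) = (\<Sum>u<n. \<integral>\<^sup>+z. dens u (lab z) * h (u, z) \<partial>N)"
    if [measurable]: "h \<in> borel_measurable (?C \<Otimes>\<^sub>M N)" for h
  proof -
    have "(\<integral>\<^sup>+x. h x \<partial>P) = (\<integral>\<^sup>+x. dens (fst x) (lab (snd x)) * h x \<partial>(?C \<Otimes>\<^sub>M N))"
      unfolding P_def by (rule nn_integral_density) auto
    also have "\<dots> = (\<integral>\<^sup>+u. (\<integral>\<^sup>+z. dens u (lab z) * h (u, z) \<partial>N) \<partial>?C)"
      by (subst nn_integral_fst[symmetric]) auto
    also have "\<dots> = (\<Sum>u<n. \<integral>\<^sup>+z. dens u (lab z) * h (u, z) \<partial>N)"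
      by (rule nn_integral_count_space_finite) simp
    finally show ?thesis .
  qed
  have fm[measurable]: "fst \<in> measurable P (count_space UNIV)"
    by (subst measurable_cong_sets[OF sets_P refl], rule measurable_compose[OF measurable_fst]) simp
  have sm[measurable]: "snd \<in> measurable P N"
    by (subst measurable_cong_sets[OF sets_P refl]) simp
  have dN: "distr P N snd = N"
  proof (rule measure_eqI)
    fix A assume "A \<in> sets (distr P N snd)"
    then have [measurable]: "A \<in> sets N" by simp
    have "emeasure (distr P N snd) A = (\<integral>\<^sup>+x. indicator A (snd x) \<partial>P)"
      by (subst nn_integral_distr[symmetric, of snd P N]) auto
    also have "\<dots> = (\<Sum>u<n. \<integral>\<^sup>+z. dens u (lab z) * indicator A z \<partial>N)"
      by (subst nnP) auto
    also have "\<dots> = (\<integral>\<^sup>+z. (\<Sum>u<n. dens u (lab z)) * indicator A z \<partial>N)"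
      by (subst nn_integral_sum[symmetric]) (auto simp: sum_distrib_right)
    also have "\<dots> = (\<integral>\<^sup>+z. indicator A z \<partial>N)"
    proof (rule nn_integral_cong_AE, use AE_q_pos in eventually_elim)
      fix z assume "0 < q (lab z)"
      show "(\<Sum>u<n. dens u (lab z)) * indicator A z = indicator A z"
      proof (cases "z \<in> A")
        case True
        then have z: "lab z < k" using lab_less sets.sets_into_space[of A N] by auto
        have "(\<Sum>u<n. dens u (lab z)) = ennreal (\<Sum>u<n. g u (lab z) / (real n * q (lab z)))"
          unfolding dens_def using g0 z q_nonneg by (intro sum_ennreal) auto
        also have "(\<Sum>u<n. g u (lab z) / (real n * q (lab z))) = 1"
          using g2[OF z] n \<open>0 < q (lab z)\<close> by (simp add: sum_divide_distrib[symmetric])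
        finally show ?thesis by simp
      qed simp
    qed
    finally show "emeasure (distr P N snd) A = emeasure N A" by simp
  qed simp
  have pP: "prob_space P"
  proof (rule prob_spaceI)
    have "emeasure P (space P) = emeasure (distr P N snd) (space N)"
      by (subst emeasure_distr) (auto simp: sp intro!: arg_cong2[where f = emeasure])
    then show "emeasure P (space P) = 1" by (simp add: dN emeasure_space_1)
  qed
  interpret P: prob_space P by (rule pP)
  let ?X = "{..<n} \<times> {..<k}"
  define Y where "Y x = (fst x, lab (snd x))" for x :: "nat \<times> 'c"
  have Ym: "Y \<in> measurable P (count_space UNIV)"
  proof -
    have "Y \<in> measurable P (count_space UNIV \<Otimes>\<^sub>M count_space UNIV)" unfolding Y_def by measurable
    then show ?thesis by (simp add: pair_measure_countable)
  qed
  have YX: "Y x \<in> ?X" if "x \<in> space P" for x using that lab_less by (auto simp: sp Y_def)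
  have law: "measure P {x\<in>space P. Y x = (u, i)} = g u i / real n" if "u < n" "i < k" for u i
  proof -
    have m: "{x\<in>space P. Y x = (u, i)} \<in> sets P" using Ym by measurable
    have "emeasure P {x\<in>space P. Y x = (u, i)} = (\<integral>\<^sup>+x. (if fst x = u \<and> lab (snd x) = i then 1 else 0) \<partial>P)"
      by (subst nn_integral_indicator[OF m, symmetric], intro nn_integral_cong) (auto simp: Y_def indicator_def)
    also have "\<dots> = (\<Sum>u'<n. \<integral>\<^sup>+z. dens u' (lab z) * (if u' = u \<and> lab z = i then 1 else 0) \<partial>N)"
      by (subst nnP) auto
    also have "\<dots> = (\<Sum>u'<n. if u' = u then (\<integral>\<^sup>+z. dens u i * indicator {z\<in>space N. lab z = i} z \<partial>N) else 0)"
      by (intro sum.cong refl) (auto intro!: nn_integral_cong simp: indicator_def)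
    also have "\<dots> = dens u i * emeasure N {z\<in>space N. lab z = i}"
      using that by (simp add: nn_integral_cmult_indicator)
    also have "\<dots> = ennreal (g u i / (real n * q i) * q i)"
      unfolding dens_def q_def emeasure_eq_measure using that g0 by (subst ennreal_mult) (auto)
    also have "g u i / (real n * q i) * q i = g u i / real n"
      using g_zero[OF that] by (cases "q i = 0") auto
    finally show ?thesis using g0[OF that] by (simp add: measure_def)
  qed
  have unif: "measure P {x\<in>space P. fst x = u} = 1 / real n" if "u < n" for u
  proof -
    have "{x\<in>space P. fst x = u} = (\<Union>i<k. {x\<in>space P. Y x = (u, i)})"
      using lab_less by (auto simp: Y_def sp)
    also have "measure P \<dots> = (\<Sum>i<k. measure P {x\<in>space P. Y x = (u, i)})"
      using Ym by (intro P.finite_measure_finite_Union) (auto simp: disjoint_family_on_def)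
    also have "\<dots> = (\<Sum>i<k. g u i) / real n" using law that by (simp add: sum_divide_distrib)
    finally show ?thesis using g1[OF that] by simp
  qed
  have I: "integrable (P \<Otimes>\<^sub>M P) (\<lambda>z. F (Y (fst z)) (Y (snd z)))"
    and E: "(\<integral>z. F (Y (fst z)) (Y (snd z)) \<partial>(P \<Otimes>\<^sub>M P))
      = (\<Sum>x\<in>?X. \<Sum>y\<in>?X. (g (fst x) (snd x) / real n) * (g (fst y) (snd y) / real n) * F x y)"
    for F :: "nat \<times> nat \<Rightarrow> nat \<times> nat \<Rightarrow> real"
  proof -
    show "integrable (P \<Otimes>\<^sub>M P) (\<lambda>z. F (Y (fst z)) (Y (snd z)))"
      by (rule P.integral_pair_finite(1)[OF Ym YX]) auto
    have "(\<integral>z. F (Y (fst z)) (Y (snd z)) \<partial>(P \<Otimes>\<^sub>M P))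
        = (\<Sum>x\<in>?X. \<Sum>y\<in>?X. measure P {z\<in>space P. Y z = x} * measure P {z\<in>space P. Y z = y} * F x y)"
      by (rule P.integral_pair_finite(2)[OF Ym YX]) auto
    also have "\<dots> = (\<Sum>x\<in>?X. \<Sum>y\<in>?X. (g (fst x) (snd x) / real n) * (g (fst y) (snd y) / real n) * F x y)"
      by (intro sum.cong refl) (auto simp: law)
    finally show "(\<integral>z. F (Y (fst z)) (Y (snd z)) \<partial>(P \<Otimes>\<^sub>M P)) = \<dots>" .
  qed
  \<comment> \<open>The path from \<open>H\<close> to \<open>W\<close> passes through
    \<open>B\<close> on the classes of the vertices (\<open>F1\<close>) and then \<open>B\<close> on
    the labels of the points (\<open>F2\<close>); the rest, \<open>?G\<close>, integrates to
    \<open>err\<close>.\<close>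
  define F1 where "F1 x y = \<bar>H (fst x) (fst y) - B (\<pi> (fst x)) (\<pi> (fst y))\<bar>" for x y :: "nat \<times> nat"
  define F2 where "F2 x y = \<bar>B (\<pi> (fst x)) (\<pi> (fst y)) - B (snd x) (snd y)\<bar>" for x y :: "nat \<times> nat"
  let ?G = "\<lambda>a b. \<bar>B (lab a) (lab b) - W (\<xi> a) (\<xi> b)\<bar>"
  have iG: "integrable (P \<Otimes>\<^sub>M P) (\<lambda>z. ?G (snd (fst z)) (snd (snd z)))"
    and eG: "(\<integral>z. ?G (snd (fst z)) (snd (snd z)) \<partial>(P \<Otimes>\<^sub>M P)) = err"
    using integrable_pair_comp[OF pP sm dN, of ?G] integrable_diff by (auto simp: err_def case_prod_unfold)
  have dM: "distr P M (\<lambda>x. \<xi> (snd x)) = M"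
    using distr_distr[OF meas_\<xi> sm] by (simp add: dN distr_\<xi> comp_def)
  have iW: "integrable (P \<Otimes>\<^sub>M P) (\<lambda>z. W (\<xi> (snd (fst z))) (\<xi> (snd (snd z))))"
    using graphon integrable_pair_comp(1)[OF pP _ dM, of W] by (auto simp: graphon_def)
  have "(\<integral>z. \<bar>H (fst (fst z)) (fst (snd z)) - W (\<xi> (snd (fst z))) (\<xi> (snd (snd z)))\<bar> \<partial>(P \<Otimes>\<^sub>M P))
      \<le> (\<integral>z. F1 (Y (fst z)) (Y (snd z)) + F2 (Y (fst z)) (Y (snd z)) + ?G (snd (fst z)) (snd (snd z)) \<partial>(P \<Otimes>\<^sub>M P))"
  proof (intro integral_mono integrable_abs Bochner_Integration.integrable_add Bochner_Integration.integrable_diff I iG iW)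
    show "integrable (P \<Otimes>\<^sub>M P) (\<lambda>z. H (fst (fst z)) (fst (snd z)))"
      using I[of "\<lambda>x y. H (fst x) (fst y)"] by (simp add: Y_def)
    show "integrable (P \<Otimes>\<^sub>M P) (\<lambda>z. B (lab (snd (fst z))) (lab (snd (snd z))))"
      using I[of "\<lambda>x y. B (snd x) (snd y)"] by (simp add: Y_def)
  qed (auto simp: F1_def F2_def Y_def)
  also have "\<dots> = (\<integral>z. F1 (Y (fst z)) (Y (snd z)) \<partial>(P \<Otimes>\<^sub>M P)) + (\<integral>z. F2 (Y (fst z)) (Y (snd z)) \<partial>(P \<Otimes>\<^sub>M P)) + err"
    by (simp only: Bochner_Integration.integral_add Bochner_Integration.integrable_add I iG eG)
  also have "(\<integral>z. F2 (Y (fst z)) (Y (snd z)) \<partial>(P \<Otimes>\<^sub>M P)) \<le> (\<Sum>i<k. \<Sum>j<k. B i j * (\<bar>a i - q i\<bar> * a j + q i * \<bar>a j - q j\<bar>))"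
    unfolding E unfolding F2_def by (rule g3)
  also have "(\<integral>z. F1 (Y (fst z)) (Y (snd z)) \<partial>(P \<Otimes>\<^sub>M P)) = l1_norm n (\<lambda>u v. H u v - B (\<pi> u) (\<pi> v))"
  proof -
    have "(\<integral>z. F1 (Y (fst z)) (Y (snd z)) \<partial>(P \<Otimes>\<^sub>M P))
       = (\<Sum>u<n. \<Sum>i<k. \<Sum>v<n. \<Sum>j<k. (g u i / real n) * (g v j / real n) * \<bar>H u v - B (\<pi> u) (\<pi> v)\<bar>)"
      unfolding E by (simp add: sum.cartesian_product' F1_def)
    also have "\<dots> = (\<Sum>u<n. \<Sum>v<n. \<Sum>i<k. \<Sum>j<k. (g u i / real n) * (g v j / real n) * \<bar>H u v - B (\<pi> u) (\<pi> v)\<bar>)"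
      by (intro sum.cong refl sum.swap)
    also have "\<dots> = (\<Sum>u<n. \<Sum>v<n. (\<Sum>i<k. g u i / real n) * (\<Sum>j<k. g v j / real n) * \<bar>H u v - B (\<pi> u) (\<pi> v)\<bar>)"
      by (simp only: sum_product_const)
    also have "\<dots> = (\<Sum>u<n. \<Sum>v<n. (1 / real n) * (1 / real n) * \<bar>H u v - B (\<pi> u) (\<pi> v)\<bar>)"
      by (intro sum.cong refl) (simp add: sum_divide_distrib[symmetric] g1)
    finally show ?thesis by (simp add: l1_norm_def sum_divide_distrib power2_eq_square)
  qed
  finally show ?thesis
    using fm unif dM sp pP by (intro that[of P fst "\<lambda>x. \<xi> (snd x)"]) auto
qed

end

section \<open>The deterministic error bound\<close>

lemma cut_norm_scale_le:
  assumes "0 \<le> c"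
  shows "cut_norm n (\<lambda>u v. c * A u v) \<le> c * cut_norm n A"
proof (rule cut_norm_leI)
  fix S T assume *: "S \<subseteq> {..<n}" "T \<subseteq> {..<n}"
  have "\<bar>\<Sum>u\<in>S. \<Sum>v\<in>T. c * A u v\<bar> / (real n)^2 = c * (\<bar>\<Sum>u\<in>S. \<Sum>v\<in>T. A u v\<bar> / (real n)^2)"
    using assms by (simp add: sum_distrib_left[symmetric] abs_mult)
  also have "\<dots> \<le> c * cut_norm n A"
    using cut_norm_ge[OF *] assms by (rule mult_left_mono)
  finally show "\<bar>\<Sum>u\<in>S. \<Sum>v\<in>T. c * A u v\<bar> / (real n)^2 \<le> c * cut_norm n A" .
qed

lemma cut_norm_scale:
  assumes "0 < c"
  shows "cut_norm n (\<lambda>u v. c * A u v) = c * cut_norm n A"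
proof (rule antisym)
  show "c * cut_norm n A \<le> cut_norm n (\<lambda>u v. c * A u v)"
    using cut_norm_scale_le[of "1 / c" n "\<lambda>u v. c * A u v"] assms by (simp add: field_simps)
qed (use assms cut_norm_scale_le in auto)

lemma l1_norm_scale:
  assumes "0 \<le> c"
  shows "l1_norm n (\<lambda>u v. c * A u v) = c * l1_norm n A"
  using assms by (simp add: l1_norm_def abs_mult sum_distrib_left)

text \<open>The edge probabilities min(1, \<rho> W) divided by \<rho>, with zero diagonal because
  the graph has no loops.\<close>

definition trunc_sample :: "('a \<Rightarrow> 'a \<Rightarrow> real) \<Rightarrow> real \<Rightarrow> (nat \<Rightarrow> 'a) \<Rightarrow> nat \<Rightarrow> nat \<Rightarrow> real" where
  "trunc_sample W \<rho> x u v = (if u = v then 0 else min (W (x u) (x v)) (1 / \<rho>))"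

text \<open>The number of classes is at least n / \<lfloor>n \<kappa>\<rfloor> \<ge> 1 / \<kappa>,
  so a model whose blocks all weigh at least \<kappa> has few enough blocks to compete in the
  minimization.\<close>

lemma lcn_k_ge:
  assumes "1 \<le> nat \<lfloor>\<kappa> * real n\<rfloor>" "0 < \<kappa>" "real k * \<kappa> \<le> 1"
  shows "k \<le> lcn_k n \<kappa>"
proof -
  define m where "m = nat \<lfloor>real n * \<kappa>\<rfloor>"
  have m: "1 \<le> m" using assms(1) by (simp add: m_def mult.commute)
  have "real m \<le> real n * \<kappa>" unfolding m_def using m m_def by linarith
  then have "real k * real m \<le> real k * (real n * \<kappa>)" by (intro mult_left_mono) auto
  also have "\<dots> = real n * (real k * \<kappa>)" by simp
  also have "\<dots> \<le> real n * 1" using assms(3) by (intro mult_left_mono) auto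
  finally have "real k \<le> real n / real m" using m by (simp add: field_simps)
  then show ?thesis unfolding lcn_k_def m_def[symmetric] by linarith
qed

context block_coupling
begin

text \<open>Deterministic class sizes, within rounding of \<open>n\<close> times the weights. The
  set depends on the law of the labels and not on the sampled points.\<close>

definition good_labels :: "nat \<Rightarrow> (nat \<Rightarrow> nat) set" where
  "good_labels n = {\<pi> \<in> {..<n} \<rightarrow>\<^sub>E {..<k}. \<forall>i<k. \<lfloor>real n * q i\<rfloor> \<le> int (card (cls n \<pi> i))
      \<and> int (card (cls n \<pi> i)) \<le> \<lceil>real n * q i\<rceil>}"

lemma finite_good_labels: "finite (good_labels n)"
  unfolding good_labels_def by (rule finite_subset[OF _ finite_PiE[of "{..<n}" "\<lambda>_. {..<k}"]]) auto

lemma good_labels_image: "\<pi> \<in> good_labels n \<Longrightarrow> \<pi> ` {..<n} \<subseteq> {..<k}"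
  by (auto simp: good_labels_def)

lemma good_labels_close:
  assumes "\<pi> \<in> good_labels n" "i < k"
  shows "\<bar>real (card (cls n \<pi> i)) - real n * q i\<bar> \<le> 1"
proof -
  have "\<lfloor>real n * q i\<rfloor> \<le> int (card (cls n \<pi> i))" "int (card (cls n \<pi> i)) \<le> \<lceil>real n * q i\<rceil>"
    using assms by (auto simp: good_labels_def)
  then show ?thesis by linarith
qed

text \<open>The floor is monotone, so weight at least \<kappa> gives size at least \<lfloor>\<kappa>
  n\<rfloor>; weight 0 gives an empty class through the ceiling. The second alternative covers step
  functions with null classes.\<close>

lemma good_labels_admissible:
  assumes \<pi>: "\<pi> \<in> good_labels n" and k: "k \<le> lcn_k n \<kappa>" and q: "\<And>i. i < k \<Longrightarrow> q i = 0 \<or> \<kappa> \<le> q i"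
  shows "\<pi> \<in> admissible n \<kappa>"
proof -
  have "nat \<lfloor>\<kappa> * real n\<rfloor> \<le> card (cls n \<pi> i)" if "cls n \<pi> i \<noteq> {}" for i
  proof -
    have i: "i < k" using that good_labels_image[OF \<pi>] by (auto simp: cls_def)
    have c: "\<lfloor>real n * q i\<rfloor> \<le> int (card (cls n \<pi> i))" "int (card (cls n \<pi> i)) \<le> \<lceil>real n * q i\<rceil>"
      using \<pi> i by (auto simp: good_labels_def)
    have "card (cls n \<pi> i) \<noteq> 0" using that by simp
    then have "q i \<noteq> 0" using c by auto
    then have "\<kappa> * real n \<le> real n * q i" using q[OF i] by (subst mult.commute) (auto intro: mult_left_mono)
    then have "\<lfloor>\<kappa> * real n\<rfloor> \<le> int (card (cls n \<pi> i))" using c(1) floor_mono by (meson order_trans)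
    then show ?thesis by linarith
  qed
  moreover have "\<pi> \<in> {..<n} \<rightarrow>\<^sub>E {..<lcn_k n \<kappa>}"
    using \<pi> k by (auto simp: good_labels_def PiE_iff intro: less_le_trans)
  ultimately show ?thesis by (auto simp: admissible_def)
qed

text \<open>Together with \<open>B_tot\<close>, the coefficients of 1/n and 1/n^2 in the price of
  rounding the class sizes.\<close>

definition B_col :: real where
  "B_col = (\<Sum>i<k. \<Sum>j<k. B i j * (q i + q j))"

definition B_tot :: real where
  "B_tot = (\<Sum>i<k. \<Sum>j<k. B i j)"

lemma cut_dist_le_good_labels:
  assumes \<pi>: "\<pi> \<in> good_labels n" and n: "n > 0" and \<pi>h: "\<pi>h ` {..<n} \<subseteq> {..<m}"
  shows "cut_dist (bm_measure m (\<lambda>i. real (card (cls n \<pi>h i)) / real n)) V M W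
    \<le> cut_norm n (\<lambda>u v. V (\<pi>h u) (\<pi>h v) - H u v) + l1_norm n (\<lambda>u v. H u v - B (\<pi> u) (\<pi> v))
       + (B_col / real n + B_tot / (real n)^2) + err"
proof -
  let ?a = "\<lambda>i. real (card (cls n \<pi> i)) / real n"
  have d: "\<bar>?a i - q i\<bar> \<le> 1 / real n" if "i < k" for i
  proof -
    have "?a i - q i = (real (card (cls n \<pi> i)) - real n * q i) / real n" using n by (simp add: field_simps)
    then have "\<bar>?a i - q i\<bar> = \<bar>real (card (cls n \<pi> i)) - real n * q i\<bar> / real n" by simp
    then show ?thesis using good_labels_close[OF \<pi> that] by (simp add: divide_right_mono)
  qed
  obtain P :: "(nat \<times> 'c) measure" and f y where P: "prob_space P" "f \<in> measurable P (count_space UNIV)" "\<And>z. z \<in> space P \<Longrightarrow> f z < n"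
    "\<And>u. u < n \<Longrightarrow> measure P {z\<in>space P. f z = u} = 1 / real n"
    "y \<in> measurable P M" "distr P M y = M"
    and I: "(\<integral>z. \<bar>H (f (fst z)) (f (snd z)) - W (y (fst z)) (y (snd z))\<bar> \<partial>(P \<Otimes>\<^sub>M P))
      \<le> l1_norm n (\<lambda>u v. H u v - B (\<pi> u) (\<pi> v))
         + (\<Sum>i<k. \<Sum>j<k. B i j * (\<bar>?a i - q i\<bar> * ?a j + q i * \<bar>?a j - q j\<bar>)) + err"
    by (rule vertex_coupling_exists[OF good_labels_image[OF \<pi>] n, where H = H]) (rule that; assumption)
  have "(\<Sum>i<k. \<Sum>j<k. B i j * (\<bar>?a i - q i\<bar> * ?a j + q i * \<bar>?a j - q j\<bar>))
      \<le> (\<Sum>i<k. \<Sum>j<k. B i j * (1 / real n * (q j + 1 / real n) + q i * (1 / real n)))"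
  proof (intro sum_mono mult_left_mono add_mono mult_mono)
    fix j assume "j \<in> {..<k}"
    then show "?a j \<le> q j + 1 / real n" using d[of j] by auto
  qed (auto intro: d B_nonneg q_nonneg)
  also have "\<dots> = B_col / real n + B_tot / (real n)^2"
    unfolding B_col_def B_tot_def sum_divide_distrib sum.distrib[symmetric]
    by (intro sum.cong refl) (use n in \<open>simp add: field_simps power2_eq_square\<close>)
  finally show ?thesis
    using cut_dist_le_vertex_coupling[OF P(1) prob_M graphon n P(2-6) \<pi>h, of V H] I by linarith
qed

text \<open>Class sizes are corrected to rounded ones; a class moves at most its deviation plus the
  rounding 1/n. The new labelling is chosen before \<open>H\<close>, so one choice serves every
  matrix.\<close>

lemma good_labels_near:
  assumes \<pi>: "\<pi> \<in> {..<n} \<rightarrow>\<^sub>E {..<k}" and n: "n > 0"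
  defines "D \<equiv> \<lambda>i. \<bar>real (card (cls n \<pi> i)) / real n - q i\<bar>"
  obtains \<pi>' where "\<pi>' \<in> good_labels n"
    "\<And>H. l1_norm n (\<lambda>u v. H u v - B (\<pi>' u) (\<pi>' v)) \<le> l1_norm n (\<lambda>u v. H u v - B (\<pi> u) (\<pi> v))
       + (\<Sum>i<k. \<Sum>j<k. B i j * ((D i + 1 / real n) * (q j + D j) + (q i + 1 / real n) * (D j + 1 / real n)))"
proof -
  obtain t where t: "(\<Sum>i<k. t i) = n" "\<And>i. i < k \<Longrightarrow> \<lfloor>real n * q i\<rfloor> \<le> int (t i)" "\<And>i. i < k \<Longrightarrow> int (t i) \<le> \<lceil>real n * q i\<rceil>"
    using round_weights[OF q_nonneg sum_q] by metis
  obtain \<pi>' where p': "\<pi>' \<in> {..<n} \<rightarrow>\<^sub>E {..<k}" "\<And>i. i < k \<Longrightarrow> card (cls n \<pi>' i) = t i"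
     "\<And>i. i < k \<Longrightarrow> int (card (touched n \<pi> \<pi>' i)) \<le> \<bar>int (card (cls n \<pi> i)) - int (t i)\<bar>"
    using relabel_sizes[OF \<pi> t(1)] by blast
  have g: "\<pi>' \<in> good_labels n" using p' t by (auto simp: good_labels_def)
  have tc: "\<bar>real (t i) / real n - q i\<bar> \<le> 1 / real n" if "i < k" for i
  proof -
    have "real (t i) / real n - q i = (real (t i) - real n * q i) / real n" using n by (simp add: field_simps)
    then have "\<bar>real (t i) / real n - q i\<bar> = \<bar>real (t i) - real n * q i\<bar> / real n" by simp
    then show ?thesis using good_labels_close[OF g that] p'(2)[OF that] by (simp add: divide_right_mono)
  qed
  have d: "real (card (touched n \<pi> \<pi>' i)) / real n \<le> D i + 1 / real n" if "i < k" for i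
  proof -
    have "real (card (touched n \<pi> \<pi>' i)) \<le> \<bar>real (card (cls n \<pi> i)) - real (t i)\<bar>"
      using p'(3)[OF that] by linarith
    then have "real (card (touched n \<pi> \<pi>' i)) / real n \<le> \<bar>real (card (cls n \<pi> i)) - real (t i)\<bar> / real n"
      by (rule divide_right_mono) simp
    also have "\<dots> = \<bar>real (card (cls n \<pi> i)) / real n - real (t i) / real n\<bar>"
      by (simp add: diff_divide_distrib[symmetric])
    finally show ?thesis using tc[OF that] by (simp add: D_def)
  qed
  let ?R = "(\<Sum>i<k. \<Sum>j<k. B i j * ((D i + 1 / real n) * (q j + D j) + (q i + 1 / real n) * (D j + 1 / real n)))"
  have "l1_norm n (\<lambda>u v. B (\<pi> u) (\<pi> v) - B (\<pi>' u) (\<pi>' v))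
    \<le> (\<Sum>i<k. \<Sum>j<k. B i j * ((D i + 1 / real n) * (real (card (cls n \<pi> j)) / real n) + real (card (cls n \<pi>' i)) / real n * (D j + 1 / real n)))"
    by (rule l1_norm_relabel) (use \<pi> p' B_nonneg d in auto)
  also have "\<dots> \<le> ?R"
  proof (intro sum_mono mult_left_mono add_mono mult_right_mono)
    fix i j assume ij: "i \<in> {..<k}" "j \<in> {..<k}"
    show "real (card (cls n \<pi> j)) / real n \<le> q j + D j" by (simp add: D_def)
    show "real (card (cls n \<pi>' i)) / real n \<le> q i + 1 / real n" using tc[of i] p'(2)[of i] ij by auto
  qed (auto simp: D_def B_nonneg)
  finally have R: "l1_norm n (\<lambda>u v. B (\<pi> u) (\<pi> v) - B (\<pi>' u) (\<pi>' v)) \<le> ?R" .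
  have "l1_norm n (\<lambda>u v. H u v - B (\<pi>' u) (\<pi>' v)) \<le> l1_norm n (\<lambda>u v. H u v - B (\<pi> u) (\<pi> v)) + ?R" for H
    using l1_norm_triangle[of n "\<lambda>u v. H u v - B (\<pi> u) (\<pi> v)" "\<lambda>u v. B (\<pi> u) (\<pi> v) - B (\<pi>' u) (\<pi>' v)"] R by simp
  then show ?thesis using that g by blast
qed

end

text \<open>The two block couplings have different tasks. The first competes with the minimizer, so
  it must be admissible, and its fit counts twice. The second only transports the sample matrix to
  \<open>W\<close> and may be arbitrarily fine. The noise counts 2 + 1 times.\<close>

lemma scaled_err_le:
  fixes H :: "nat \<Rightarrow> nat \<Rightarrow> real"
  assumes b: "block_coupling N M W \<xi> lab k B" and b': "block_coupling N' M W \<xi>' lab' k' B'"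
    and \<pi>: "\<pi> \<in> block_coupling.good_labels N lab k n" and \<pi>': "\<pi>' \<in> block_coupling.good_labels N' lab' k' n"
    and n: "n > 0" and \<rho>: "\<rho> > 0"
    and k: "k \<le> lcn_k n \<kappa>" and q: "\<And>i. i < k \<Longrightarrow> block_coupling.q N lab i = 0 \<or> \<kappa> \<le> block_coupling.q N lab i"
    and out: "out \<in> lcn_outputs n \<kappa> E"
  shows "scaled_err M W \<rho> out \<le> 3 * cut_norm n (\<lambda>u v. adj E u v / \<rho> - H u v)
     + 2 * l1_norm n (\<lambda>u v. H u v - B (\<pi> u) (\<pi> v)) + l1_norm n (\<lambda>u v. H u v - B' (\<pi>' u) (\<pi>' v))
     + (block_coupling.B_col N' lab' k' B' / real n + block_coupling.B_tot k' B' / (real n)^2)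
     + block_coupling.err N' W \<xi>' lab' B'"
proof -
  interpret b: block_coupling N M W \<xi> lab k B by fact
  interpret b': block_coupling N' M W \<xi>' lab' k' B' by fact
  obtain \<pi>h where h: "\<pi>h \<in> lcn_argmin n \<kappa> E"
    and o: "out = (lcn_k n \<kappa>, \<lambda>i. real (card (cls n \<pi>h i)) / real n, quot n \<pi>h (adj E))"
    using out by (auto simp: lcn_outputs_def)
  let ?A = "adj E"
  have im: "\<pi>h ` {..<n} \<subseteq> {..<lcn_k n \<kappa>}" using h by (auto simp: lcn_argmin_def admissible_def)
  have "\<pi> \<in> admissible n \<kappa>" by (rule b.good_labels_admissible[OF \<pi> k q])
  then have "cut_norm n (\<lambda>u v. ?A u v - blowup n \<pi>h ?A u v) \<le> cut_norm n (\<lambda>u v. ?A u v - blowup n \<pi> ?A u v)"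
    using h by (auto simp: lcn_argmin_def)
  also have "\<dots> \<le> 2 * cut_norm n (\<lambda>u v. ?A u v - \<rho> * H u v) + 2 * l1_norm n (\<lambda>u v. \<rho> * H u v - \<rho> * B (\<pi> u) (\<pi> v))"
    by (rule cut_norm_sub_blowup_le)
  also have "cut_norm n (\<lambda>u v. ?A u v - \<rho> * H u v) = \<rho> * cut_norm n (\<lambda>u v. ?A u v / \<rho> - H u v)"
    using \<rho> by (subst cut_norm_scale[symmetric]) (auto simp: algebra_simps)
  also have "l1_norm n (\<lambda>u v. \<rho> * H u v - \<rho> * B (\<pi> u) (\<pi> v)) = \<rho> * l1_norm n (\<lambda>u v. H u v - B (\<pi> u) (\<pi> v))"
    using \<rho> by (subst l1_norm_scale[symmetric]) (auto simp: algebra_simps)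
  finally have 1: "1 / \<rho> * cut_norm n (\<lambda>u v. ?A u v - blowup n \<pi>h ?A u v)
      \<le> 2 * cut_norm n (\<lambda>u v. ?A u v / \<rho> - H u v) + 2 * l1_norm n (\<lambda>u v. H u v - B (\<pi> u) (\<pi> v))"
    using \<rho> by (simp add: field_simps)
  have "scaled_err M W \<rho> out = cut_dist (bm_measure (lcn_k n \<kappa>) (\<lambda>i. real (card (cls n \<pi>h i)) / real n)) (\<lambda>i j. quot n \<pi>h ?A i j / \<rho>) M W"
    by (simp add: scaled_err_def o)
  also have "\<dots> \<le> cut_norm n (\<lambda>u v. quot n \<pi>h ?A (\<pi>h u) (\<pi>h v) / \<rho> - H u v) + l1_norm n (\<lambda>u v. H u v - B' (\<pi>' u) (\<pi>' v))
       + (b'.B_col / real n + b'.B_tot / (real n)^2) + b'.err"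
    by (rule b'.cut_dist_le_good_labels[OF \<pi>' n im])
  \<comment> \<open>The estimate minus \<open>H\<close> is the negative of the minimized residual
    over \<rho>, plus the noise over \<rho>.\<close>
  also have "cut_norm n (\<lambda>u v. quot n \<pi>h ?A (\<pi>h u) (\<pi>h v) / \<rho> - H u v)
      = cut_norm n (\<lambda>u v. - (1 / \<rho> * (?A u v - blowup n \<pi>h ?A u v)) + (?A u v / \<rho> - H u v))"
    by (simp add: blowup_def diff_divide_distrib)
  also have "\<dots> \<le> cut_norm n (\<lambda>u v. - (1 / \<rho> * (?A u v - blowup n \<pi>h ?A u v))) + cut_norm n (\<lambda>u v. ?A u v / \<rho> - H u v)"
    by (rule cut_norm_triangle)
  also have "cut_norm n (\<lambda>u v. - (1 / \<rho> * (?A u v - blowup n \<pi>h ?A u v))) = 1 / \<rho> * cut_norm n (\<lambda>u v. ?A u v - blowup n \<pi>h ?A u v)"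
    unfolding cut_norm_uminus using \<rho> by (intro cut_norm_scale) auto
  finally show ?thesis using 1 by simp
qed

text \<open>\<open>lcn_selection\<close> constrains the algorithm only where a minimizer exists. The
  one-class labelling is admissible, and finitely many candidates have a minimum.\<close>

lemma lcn_outputs_nonempty:
  assumes "1 \<le> nat \<lfloor>\<kappa> * real n\<rfloor>" "0 < \<kappa>" "\<kappa> \<le> 1"
  shows "lcn_outputs n \<kappa> E \<noteq> {}"
proof -
  have k: "1 \<le> lcn_k n \<kappa>" by (rule lcn_k_ge) (use assms in auto)
  have n: "\<kappa> * real n \<le> real n" using assms by (simp add: mult_left_le_one_le)
  have "restrict (\<lambda>_. 0) {..<n} \<in> admissible n \<kappa>"
  proof -
    have "nat \<lfloor>\<kappa> * real n\<rfloor> \<le> card (cls n (restrict (\<lambda>_. 0) {..<n}) i)" if "cls n (restrict (\<lambda>_. 0) {..<n}) i \<noteq> {}" for i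
    proof -
      have "cls n (restrict (\<lambda>_. 0) {..<n}) i = {..<n}" using that by (auto simp: cls_def)
      then show ?thesis using n by simp linarith
    qed
    then show ?thesis using k by (auto simp: admissible_def)
  qed
  moreover have "finite (admissible n \<kappa>)"
    unfolding admissible_def by (rule finite_subset[OF _ finite_PiE[of "{..<n}" "\<lambda>_. {..<lcn_k n \<kappa>}"]]) auto
  ultimately obtain \<pi> where "is_arg_min (\<lambda>\<pi>. cut_norm n (\<lambda>u v. adj E u v - blowup n \<pi> (adj E) u v)) (\<lambda>\<pi>. \<pi> \<in> admissible n \<kappa>) \<pi>"
    using ex_is_arg_min_if_finite[of "admissible n \<kappa>"] by blast
  then show ?thesis by (auto simp: lcn_outputs_def lcn_argmin_def is_arg_min_linorder)
qed

text \<open>An infimum over the empty set would carry no information; the product of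
  \<open>M\<close> with the uniform measure on vertices provides a coupling.\<close>

lemma scaled_err_nonneg:
  assumes M: "prob_space M" and W: "graphon M W" and n: "n > 0" and out: "out \<in> lcn_outputs n \<kappa> E"
  shows "0 \<le> scaled_err M W \<rho> out"
proof -
  obtain \<pi> where h: "\<pi> \<in> lcn_argmin n \<kappa> E"
    and o: "out = (lcn_k n \<kappa>, \<lambda>i. real (card (cls n \<pi> i)) / real n, quot n \<pi> (adj E))"
    using out by (auto simp: lcn_outputs_def)
  have im: "\<pi> ` {..<n} \<subseteq> {..<lcn_k n \<kappa>}" using h by (auto simp: lcn_argmin_def admissible_def)
  interpret M: prob_space M by fact
  interpret U: prob_space "uniform_count_measure {..<n}"
    using n by (intro prob_space_uniform_count_measure) auto
  let ?P = "M \<Otimes>\<^sub>M uniform_count_measure {..<n}"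
  interpret P: pair_prob_space M "uniform_count_measure {..<n}" ..
  have f: "snd \<in> measurable ?P (count_space UNIV)"
    by (rule measurable_compose[OF measurable_snd]) (simp add: measurable_def sets_uniform_count_measure space_uniform_count_measure)
  have unif: "measure ?P {z\<in>space ?P. snd z = u} = 1 / real n" if "u < n" for u
  proof -
    have "{z\<in>space ?P. snd z = u} = space M \<times> {u}"
      using that by (auto simp: space_pair_measure space_uniform_count_measure)
    moreover have "emeasure ?P (space M \<times> {u}) = emeasure (uniform_count_measure {..<n}) {u}"
      using that by (subst U.emeasure_pair_measure_Times) (auto simp: sets_uniform_count_measure M.emeasure_space_1)
    ultimately show ?thesis using that by (simp add: measure_def emeasure_uniform_count_measure)
  qed
  have "distr ?P M fst = M" by (rule U.distr_pair_fst)
  note vertex_coupling(2)[OF P.prob_space_axioms M f _ unif _ this im]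
  then have "couplings (bm_measure (lcn_k n \<kappa>) (\<lambda>i. real (card (cls n \<pi> i)) / real n)) M \<noteq> {}"
    by (auto simp: space_pair_measure space_uniform_count_measure)
  then show ?thesis using cut_dist_nonneg[OF M W] by (simp add: scaled_err_def o)
qed

section \<open>Concentration of random edges\<close>

text \<open>The law of a random subset with independent memberships, kept as a finite weight so that
  expectations given the points are sums over \<open>Pow V\<close>.\<close>

definition bern_weight :: "'e set \<Rightarrow> ('e \<Rightarrow> real) \<Rightarrow> 'e set \<Rightarrow> real" where
  "bern_weight V p E = (\<Prod>e\<in>V. if e \<in> E then p e else 1 - p e)"

lemma bern_weight_nonneg:
  assumes "\<And>e. e \<in> V \<Longrightarrow> 0 \<le> p e \<and> p e \<le> 1"
  shows "0 \<le> bern_weight V p E"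
  unfolding bern_weight_def using assms by (intro prod_nonneg) auto

text \<open>The expectation of a product of independent factors is the product of expectations; as
  finite sums this is the expansion of a product of binomials.\<close>

lemma sum_bern_weight_prod:
  assumes "finite V"
  shows "(\<Sum>E\<in>Pow V. bern_weight V p E * (\<Prod>e\<in>V. if e \<in> E then f e else g e)) = (\<Prod>e\<in>V. p e * f e + (1 - p e) * g e)"
proof -
  have "(\<Prod>e\<in>V. p e * f e + (1 - p e) * g e) = (\<Sum>E\<in>Pow V. prod (\<lambda>e. p e * f e) E * prod (\<lambda>e. (1 - p e) * g e) (V - E))"
    by (rule prod_add) fact
  also have "\<dots> = (\<Sum>E\<in>Pow V. bern_weight V p E * (\<Prod>e\<in>V. if e \<in> E then f e else g e))"
  proof (intro sum.cong refl)
    fix E assume "E \<in> Pow V"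
    then have E: "V \<inter> E = E" "V \<inter> - E = V - E" by auto
    have "bern_weight V p E * (\<Prod>e\<in>V. if e \<in> E then f e else g e)
        = (\<Prod>e\<in>V. if e \<in> E then p e * f e else (1 - p e) * g e)"
      unfolding bern_weight_def prod.distrib[symmetric] by (intro prod.cong) auto
    also have "\<dots> = prod (\<lambda>e. p e * f e) E * prod (\<lambda>e. (1 - p e) * g e) (V - E)"
      using assms by (subst prod.If_cases) (auto simp: E)
    finally show "prod (\<lambda>e. p e * f e) E * prod (\<lambda>e. (1 - p e) * g e) (V - E)
       = bern_weight V p E * (\<Prod>e\<in>V. if e \<in> E then f e else g e)" ..
  qed
  finally show ?thesis ..
qed

lemma sum_bern_weight:
  assumes "finite V"
  shows "(\<Sum>E\<in>Pow V. bern_weight V p E) = 1"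
  using sum_bern_weight_prod[OF assms, of p "\<lambda>_. 1" "\<lambda>_. 1"] by simp

lemma sum_bern_weight_mem:
  assumes "finite V" "e \<in> V"
  shows "(\<Sum>E\<in>Pow V. bern_weight V p E * (if e \<in> E then 1 else 0)) = p e"
proof -
  \<comment> \<open>Membership of \<open>e\<close> is written as a product of one factor per
    element, so that the product formula applies.\<close>
  have "(\<Prod>e'\<in>V. if e' \<in> E then 1 else if e' = e then 0 else 1) = (if e \<in> E then 1 else 0 :: real)" for E
    using assms by (auto intro: prod.neutral prod_zero)
  then have "(\<Sum>E\<in>Pow V. bern_weight V p E * (if e \<in> E then 1 else 0))
    = (\<Prod>e'\<in>V. p e' * 1 + (1 - p e') * (if e' = e then 0 else 1))"
    using sum_bern_weight_prod[OF assms(1), of p "\<lambda>_. 1" "\<lambda>e'. if e' = e then 0 else 1"] by simp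
  also have "\<dots> = (\<Prod>e'\<in>V. if e' = e then p e else 1)" by (intro prod.cong) auto
  also have "\<dots> = p e" using assms by simp
  finally show ?thesis .
qed

lemma sum_bern_weight_card:
  assumes "finite V"
  shows "(\<Sum>E\<in>Pow V. bern_weight V p E * real (card E)) = (\<Sum>e\<in>V. p e)"
proof -
  have "(\<Sum>E\<in>Pow V. bern_weight V p E * real (card E))
     = (\<Sum>E\<in>Pow V. \<Sum>e\<in>V. bern_weight V p E * (if e \<in> E then 1 else 0))"
  proof (intro sum.cong refl)
    fix E assume "E \<in> Pow V"
    then have "(\<Sum>e\<in>V. if e \<in> E then 1 else 0) = real (card E)"
      using assms by (subst sum.inter_filter[symmetric]) (auto intro!: arg_cong[where f = card])
    then show "bern_weight V p E * real (card E) = (\<Sum>e\<in>V. bern_weight V p E * (if e \<in> E then 1 else 0))"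
      by (simp only: sum_distrib_left[symmetric])
  qed
  also have "\<dots> = (\<Sum>e\<in>V. \<Sum>E\<in>Pow V. bern_weight V p E * (if e \<in> E then 1 else 0))" by (rule sum.swap)
  also have "\<dots> = (\<Sum>e\<in>V. p e)" by (intro sum.cong refl sum_bern_weight_mem assms)
  finally show ?thesis .
qed

lemma exp_le_quadratic:
  assumes "\<bar>s\<bar> \<le> (1::real)"
  shows "exp s \<le> 1 + s + s\<^sup>2"
proof (cases "0 \<le> s")
  case True
  then show ?thesis using exp_bound[of s] assms by simp
next
  case False
  define y where "y = - s"
  have y: "0 < y" using False by (simp add: y_def)
  have "exp s = 1 / exp y" by (simp add: y_def exp_minus field_simps)
  \<comment> \<open>For negative s = -y the estimate reduces to 1 / (1 + y) \<le> 1 - y + y^2, that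
    is to y^3 \<ge> 0.\<close>
  also have "\<dots> \<le> 1 / (1 + y)" using y exp_ge_add_one_self[of y] by (intro divide_left_mono) auto
  also have "\<dots> \<le> 1 - y + y\<^sup>2"
  proof -
    have "(1 - y + y\<^sup>2) * (1 + y) = 1 + y ^ 3" by (simp add: algebra_simps power2_eq_square power3_eq_cube)
    then show ?thesis using y by (simp add: field_simps)
  qed
  finally show ?thesis by (simp add: y_def)
qed

text \<open>Factoring out exp(-s p) leaves 1 + p (exp s - 1), to which 1 + x \<le> exp x applies.
  The exponent keeps the factor \<open>p\<close>, without which sparse graphs would be out of
  reach.\<close>

lemma bernoulli_mgf_le:
  fixes p s :: real
  assumes "0 \<le> p" "p \<le> 1" "\<bar>s\<bar> \<le> 1"
  shows "p * exp (s * (1 - p)) + (1 - p) * exp (s * (0 - p)) \<le> exp (s\<^sup>2 * p)"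
proof -
  have "s * (1 - p) = - (s * p) + s" by (simp add: algebra_simps)
  then have "exp (s * (1 - p)) = exp (- (s * p)) * exp s" by (simp only: exp_add)
  then have "p * exp (s * (1 - p)) + (1 - p) * exp (s * (0 - p)) = exp (- (s * p)) * (1 + p * (exp s - 1))"
    by (simp add: algebra_simps)
  also have "\<dots> \<le> exp (- (s * p)) * exp (p * (exp s - 1))"
    by (intro mult_left_mono exp_ge_add_one_self) auto
  also have "\<dots> = exp (p * (exp s - 1 - s))" by (simp add: exp_add[symmetric] algebra_simps)
  also have "\<dots> \<le> exp (p * s\<^sup>2)"
    using exp_le_quadratic[OF assms(3)] assms(1) by (auto intro!: mult_left_mono)
  finally show ?thesis by (simp add: mult.commute)
qed

text \<open>Chernoff's bound with free parameter \<open>l\<close>. Coefficients up to 2 occur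
  because an edge can be counted in both directions; hence \<open>l \<le> 1/2\<close>, which keeps
  |l c| \<le> 1, and the factor 4.\<close>

lemma bernoulli_sum_tail:
  assumes V: "finite V" and p: "\<And>e. e \<in> V \<Longrightarrow> 0 \<le> p e \<and> p e \<le> 1"
    and c: "\<And>e. e \<in> V \<Longrightarrow> \<bar>c e\<bar> \<le> 2" and l: "0 \<le> l" "l \<le> 1/2"
  shows "(\<Sum>E\<in>Pow V. bern_weight V p E * (if t \<le> (\<Sum>e\<in>V. c e * ((if e \<in> E then 1 else 0) - p e)) then 1 else 0))
     \<le> exp (4 * l\<^sup>2 * (\<Sum>e\<in>V. p e) - l * t)"
proof -
  let ?Z = "\<lambda>E. \<Sum>e\<in>V. c e * ((if e \<in> E then 1 else 0) - p e)"
  have "(\<Sum>E\<in>Pow V. bern_weight V p E * (if t \<le> ?Z E then 1 else 0)) \<le> (\<Sum>E\<in>Pow V. bern_weight V p E * (exp (l * ?Z E) * exp (- (l * t))))"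
  proof (intro sum_mono mult_left_mono bern_weight_nonneg p)
    fix E
    show "(if t \<le> ?Z E then 1 else 0) \<le> exp (l * ?Z E) * exp (- (l * t))"
      using l by (auto simp: exp_add[symmetric] mult_left_mono)
  qed auto
  also have "\<dots> = (\<Sum>E\<in>Pow V. bern_weight V p E * exp (l * ?Z E)) * exp (- (l * t))"
    by (simp add: sum_distrib_right mult.assoc)
  also have "(\<Sum>E\<in>Pow V. bern_weight V p E * exp (l * ?Z E))
     = (\<Sum>E\<in>Pow V. bern_weight V p E * (\<Prod>e\<in>V. if e \<in> E then exp (l * c e * (1 - p e)) else exp (l * c e * (0 - p e))))"
  proof (intro sum.cong refl arg_cong2[where f = "(*)"])
    fix E
    have "exp (l * ?Z E) = exp (\<Sum>e\<in>V. l * c e * ((if e \<in> E then 1 else 0) - p e))"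
      by (simp add: sum_distrib_left mult.assoc)
    also have "\<dots> = (\<Prod>e\<in>V. exp (l * c e * ((if e \<in> E then 1 else 0) - p e)))" by (rule exp_sum[OF V])
    finally show "exp (l * ?Z E) = (\<Prod>e\<in>V. if e \<in> E then exp (l * c e * (1 - p e)) else exp (l * c e * (0 - p e)))"
      by (simp add: if_distrib cong: if_cong) (auto intro!: prod.cong)
  qed
  also have "\<dots> = (\<Prod>e\<in>V. p e * exp (l * c e * (1 - p e)) + (1 - p e) * exp (l * c e * (0 - p e)))"
    by (rule sum_bern_weight_prod[OF V])
  also have "\<dots> \<le> (\<Prod>e\<in>V. exp (4 * l\<^sup>2 * p e))"
  proof (rule prod_mono, intro conjI)
    fix e assume e: "e \<in> V"
    have "\<bar>l * c e\<bar> \<le> 1/2 * 2" unfolding abs_mult using c[OF e] l by (intro mult_mono) auto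
    then have "p e * exp (l * c e * (1 - p e)) + (1 - p e) * exp (l * c e * (0 - p e)) \<le> exp ((l * c e)\<^sup>2 * p e)"
      using p[OF e] by (intro bernoulli_mgf_le) auto
    also have "(l * c e)\<^sup>2 \<le> l\<^sup>2 * 2\<^sup>2"
      unfolding power_mult_distrib using c[OF e] abs_le_square_iff[of "c e" 2] by (intro mult_left_mono) auto
    then have "exp ((l * c e)\<^sup>2 * p e) \<le> exp (4 * l\<^sup>2 * p e)"
      using p[OF e] by (simp add: mult_right_mono)
    finally show "p e * exp (l * c e * (1 - p e)) + (1 - p e) * exp (l * c e * (0 - p e)) \<le> exp (4 * l\<^sup>2 * p e)" .
    show "0 \<le> p e * exp (l * c e * (1 - p e)) + (1 - p e) * exp (l * c e * (0 - p e))"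
      using p[OF e] by auto
  qed
  also have "\<dots> = exp (4 * l\<^sup>2 * (\<Sum>e\<in>V. p e))" by (simp add: exp_sum[OF V, symmetric] sum_distrib_left)
  finally show ?thesis by (simp add: exp_diff exp_minus divide_inverse)
qed

lemma finite_vpairs [simp]: "finite (vpairs n)"
  by (rule finite_subset[of _ "{..<n} \<times> {..<n}"]) (auto simp: vpairs_def)

definition edge_prob :: "('a \<Rightarrow> 'a \<Rightarrow> real) \<Rightarrow> real \<Rightarrow> (nat \<Rightarrow> 'a) \<Rightarrow> nat \<times> nat \<Rightarrow> real" where
  "edge_prob W \<rho> x e = min 1 (\<rho> * W (x (fst e)) (x (snd e)))"

lemma wrg_prob_eq_bern_weight:
  "E \<subseteq> vpairs n \<Longrightarrow> wrg_prob W \<rho> n x E = bern_weight (vpairs n) (edge_prob W \<rho> x) E"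
  by (simp add: wrg_prob_def bern_weight_def edge_prob_def Let_def cong: if_cong)

definition noise :: "('a \<Rightarrow> 'a \<Rightarrow> real) \<Rightarrow> real \<Rightarrow> (nat \<Rightarrow> 'a) \<Rightarrow> (nat \<times> nat) set \<Rightarrow> nat \<Rightarrow> nat \<Rightarrow> real" where
  "noise W \<rho> x E u v = adj E u v - \<rho> * trunc_sample W \<rho> x u v"

text \<open>The entries of the symmetric matrix are not independent, the edges are. Exactly one of
  (u,v) and (v,u) is an edge slot off the diagonal, and none is on it, where the noise
  vanishes.\<close>

lemma noise_eq_edge_sum:
  assumes \<rho>: "0 < \<rho>" and sym: "\<And>u v. u < n \<Longrightarrow> v < n \<Longrightarrow> W (x u) (x v) = W (x v) (x u)"
    and E: "E \<subseteq> vpairs n" and uv: "u < n" "v < n"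
  shows "noise W \<rho> x E u v = (\<Sum>e\<in>vpairs n. ((if e \<in> E then 1 else 0) - edge_prob W \<rho> x e) * ((if e = (u,v) then 1 else 0) + (if e = (v,u) then 1 else 0)))"
proof -
  define F where "F e = (if e \<in> E then 1 else 0) - edge_prob W \<rho> x e" for e
  have h: "(\<Sum>e\<in>vpairs n. F e * (if e = a then 1 else 0)) = (if a \<in> vpairs n then F a else 0)" for a
    by (simp add: mult_delta_right)
  have "(\<Sum>e\<in>vpairs n. F e * ((if e = (u,v) then 1 else 0) + (if e = (v,u) then 1 else 0)))
      = (if (u,v) \<in> vpairs n then F (u,v) else 0) + (if (v,u) \<in> vpairs n then F (v,u) else 0)"
    by (simp only: distrib_left sum.distrib h)
  also have "\<dots> = noise W \<rho> x E u v"
  proof (cases u v rule: linorder_cases)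
    case less
    then show ?thesis using uv \<rho> by (auto simp: vpairs_def noise_def F_def adj_def trunc_sample_def edge_prob_def min_def max_def field_simps)
  next
    case equal
    then show ?thesis using E by (auto simp: vpairs_def noise_def F_def adj_def trunc_sample_def)
  next
    case greater
    then show ?thesis using uv \<rho> sym[OF uv] by (auto simp: vpairs_def noise_def F_def adj_def trunc_sample_def edge_prob_def min_def max_def field_simps)
  qed
  finally show ?thesis by (simp add: F_def)
qed

text \<open>How often an edge is counted in the rectangle: 0, 1 or 2 times.\<close>

definition edge_mult :: "nat set \<Rightarrow> nat set \<Rightarrow> nat \<times> nat \<Rightarrow> real" where
  "edge_mult S T e = (if fst e \<in> S \<and> snd e \<in> T then 1 else 0) + (if snd e \<in> S \<and> fst e \<in> T then 1 else 0)"

lemma noise_sum: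
  assumes \<rho>: "0 < \<rho>" and sym: "\<And>u v. u < n \<Longrightarrow> v < n \<Longrightarrow> W (x u) (x v) = W (x v) (x u)"
    and E: "E \<subseteq> vpairs n" and ST: "S \<subseteq> {..<n}" "T \<subseteq> {..<n}"
  shows "(\<Sum>u\<in>S. \<Sum>v\<in>T. noise W \<rho> x E u v) = (\<Sum>e\<in>vpairs n. edge_mult S T e * ((if e \<in> E then 1 else 0) - edge_prob W \<rho> x e))"
proof -
  have fin: "finite S" "finite T" using ST finite_subset by auto
  define F where "F e = (if e \<in> E then 1 else 0) - edge_prob W \<rho> x e" for e
  have "(\<Sum>u\<in>S. \<Sum>v\<in>T. noise W \<rho> x E u v)
     = (\<Sum>u\<in>S. \<Sum>v\<in>T. \<Sum>e\<in>vpairs n. F e * ((if e = (u,v) then 1 else 0) + (if e = (v,u) then 1 else 0)))"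
    unfolding F_def using ST by (intro sum.cong refl noise_eq_edge_sum \<rho> sym E) auto
  also have "\<dots> = (\<Sum>u\<in>S. \<Sum>e\<in>vpairs n. \<Sum>v\<in>T. F e * ((if e = (u,v) then 1 else 0) + (if e = (v,u) then 1 else 0)))"
    by (intro sum.cong refl sum.swap)
  also have "\<dots> = (\<Sum>e\<in>vpairs n. \<Sum>u\<in>S. \<Sum>v\<in>T. F e * ((if e = (u,v) then 1 else 0) + (if e = (v,u) then 1 else 0)))"
    by (rule sum.swap)
  also have "\<dots> = (\<Sum>e\<in>vpairs n. edge_mult S T e * F e)"
  proof (intro sum.cong refl)
    fix e
    have "(\<Sum>u\<in>S. \<Sum>v\<in>T. (if e = (u,v) then 1 else 0) + (if e = (v,u) then 1 else 0)) = edge_mult S T e"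
    proof -
      have h: "(\<Sum>u\<in>S. \<Sum>v\<in>T. if a = u \<and> b = v then 1 else 0) = (if a \<in> S \<and> b \<in> T then 1 else 0 :: real)" for a b
      proof -
        have "(\<Sum>v\<in>T. if a = u \<and> b = v then 1 else 0) = (if a = u then (if b \<in> T then 1 else 0) else 0 :: real)" for u
          using fin by (cases "a = u") auto
        then show ?thesis using fin by simp
      qed
      obtain a b where e: "e = (a, b)" by (cases e)
      have "(\<Sum>u\<in>S. \<Sum>v\<in>T. (if e = (u,v) then 1 else 0) + (if e = (v,u) then 1 else (0::real)))
        = (\<Sum>u\<in>S. \<Sum>v\<in>T. if a = u \<and> b = v then 1 else 0) + (\<Sum>u\<in>S. \<Sum>v\<in>T. if b = u \<and> a = v then 1 else 0)"
        unfolding e by (simp only: sum.distrib prod.inject conj_commute)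
      then show ?thesis unfolding h by (simp add: edge_mult_def e)
    qed
    then show "(\<Sum>u\<in>S. \<Sum>v\<in>T. F e * ((if e = (u,v) then 1 else 0) + (if e = (v,u) then 1 else 0))) = edge_mult S T e * F e"
      by (simp only: sum_distrib_left[symmetric] mult.commute)
  qed
  finally show ?thesis by (simp add: F_def)
qed

lemma edge_prob_bounds:
  assumes "0 < \<rho>" "\<And>u v. u < n \<Longrightarrow> v < n \<Longrightarrow> 0 \<le> W (x u) (x v)" "e \<in> vpairs n"
  shows "0 \<le> edge_prob W \<rho> x e \<and> edge_prob W \<rho> x e \<le> 1"
  using assms by (auto simp: edge_prob_def vpairs_def)

text \<open>Union bound over 2^n choices of each side of the cut and over two signs, with the same
  exponential bound for each.\<close>

lemma cut_norm_noise_tail: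
  assumes \<rho>: "0 < \<rho>" and sym: "\<And>u v. u < n \<Longrightarrow> v < n \<Longrightarrow> W (x u) (x v) = W (x v) (x u)"
    and nn: "\<And>u v. u < n \<Longrightarrow> v < n \<Longrightarrow> 0 \<le> W (x u) (x v)" and n: "0 < n"
    and l: "0 \<le> l" "l \<le> 1/2"
  shows "(\<Sum>E\<in>Pow (vpairs n). wrg_prob W \<rho> n x E * (if s < cut_norm n (noise W \<rho> x E) then 1 else 0))
     \<le> 2 * 4 ^ n * exp (4 * l\<^sup>2 * (\<Sum>e\<in>vpairs n. edge_prob W \<rho> x e) - l * (s * (real n)\<^sup>2))"
proof -
  \<comment> \<open>The third component is a sign: an absolute value exceeds a level if one of the
    two signed sums does.\<close>
  let ?V = "vpairs n" and ?p = "edge_prob W \<rho> x" and ?P = "Pow {..<n} \<times> Pow {..<n} \<times> {1, -1 :: real}"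
  let ?t = "s * (real n)\<^sup>2"
  define Z where "Z y E = (\<Sum>e\<in>?V. snd (snd y) * edge_mult (fst y) (fst (snd y)) e * ((if e \<in> E then 1 else 0) - ?p e))"
    for y :: "nat set \<times> nat set \<times> real" and E
  have p: "0 \<le> ?p e \<and> ?p e \<le> 1" if "e \<in> ?V" for e using edge_prob_bounds[where W = W and x = x and n = n, OF \<rho> nn that] by blast
  have fin: "finite ?P" by simp
  have "(\<Sum>E\<in>Pow ?V. wrg_prob W \<rho> n x E * (if s < cut_norm n (noise W \<rho> x E) then 1 else 0))
      \<le> (\<Sum>E\<in>Pow ?V. bern_weight ?V ?p E * (\<Sum>y\<in>?P. if ?t \<le> Z y E then 1 else 0))"
  proof (rule sum_mono)
    fix E assume E: "E \<in> Pow ?V"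
    have "(if s < cut_norm n (noise W \<rho> x E) then 1 else 0) \<le> (\<Sum>y\<in>?P. if ?t \<le> Z y E then 1 else 0 :: real)"
    proof (cases "s < cut_norm n (noise W \<rho> x E)")
      case True
      obtain S T where ST: "S \<subseteq> {..<n}" "T \<subseteq> {..<n}"
        and c: "cut_norm n (noise W \<rho> x E) = \<bar>\<Sum>u\<in>S. \<Sum>v\<in>T. noise W \<rho> x E u v\<bar> / (real n)^2"
        by (rule cut_norm_attained)
      let ?z = "\<Sum>u\<in>S. \<Sum>v\<in>T. noise W \<rho> x E u v"
      define sg where "sg = (if 0 \<le> ?z then 1 else -1 :: real)"
      have "?t \<le> \<bar>?z\<bar>" using True n unfolding c by (simp add: field_simps)
      also have "\<bar>?z\<bar> = sg * ?z" by (simp add: sg_def)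
      also have "\<dots> = Z (S,T,sg) E"
        using E by (subst noise_sum[where W = W and x = x and n = n, OF \<rho> sym _ ST]) (auto simp: Z_def sum_distrib_left mult.assoc)
      finally have z: "?t \<le> Z (S,T,sg) E" .
      have m: "(S,T,sg) \<in> ?P" using ST by (auto simp: sg_def)
      have "(\<Sum>y\<in>{(S,T,sg)}. if ?t \<le> Z y E then 1 else 0 :: real) \<le> (\<Sum>y\<in>?P. if ?t \<le> Z y E then 1 else 0)"
        by (rule sum_mono2[OF fin]) (use m in auto)
      then show ?thesis using z True by simp
    qed (auto intro: sum_nonneg)
    then show "wrg_prob W \<rho> n x E * (if s < cut_norm n (noise W \<rho> x E) then 1 else 0)
       \<le> bern_weight ?V ?p E * (\<Sum>y\<in>?P. if ?t \<le> Z y E then 1 else 0)"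
      using E p by (simp add: wrg_prob_eq_bern_weight bern_weight_nonneg mult_left_mono del: sum.If_cases)
  qed
  also have "\<dots> = (\<Sum>y\<in>?P. \<Sum>E\<in>Pow ?V. bern_weight ?V ?p E * (if ?t \<le> Z y E then 1 else 0))"
    unfolding sum_distrib_left by (rule sum.swap)
  also have "\<dots> \<le> (\<Sum>y\<in>?P. exp (4 * l\<^sup>2 * (\<Sum>e\<in>?V. ?p e) - l * ?t))"
    unfolding Z_def
    by (intro sum_mono bernoulli_sum_tail p l) (auto simp: edge_mult_def)
  also have "\<dots> = real (card ?P) * exp (4 * l\<^sup>2 * (\<Sum>e\<in>?V. ?p e) - l * ?t)" by simp
  also have "real (card ?P) = 2 * 4 ^ n"
    by (simp add: card_cartesian_product card_Pow power_mult_distrib[symmetric])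
  finally show ?thesis .
qed

text \<open>A crude bound without cancellation, at most 2 per edge slot. It is meant for very sparse
  graphs, where a first moment of the edge count is enough.\<close>

lemma cut_norm_noise_le_card:
  assumes \<rho>: "0 < \<rho>" and sym: "\<And>u v. u < n \<Longrightarrow> v < n \<Longrightarrow> W (x u) (x v) = W (x v) (x u)"
    and nn: "\<And>u v. u < n \<Longrightarrow> v < n \<Longrightarrow> 0 \<le> W (x u) (x v)" and E: "E \<subseteq> vpairs n"
  shows "cut_norm n (noise W \<rho> x E) \<le> 2 * (real (card E) + (\<Sum>e\<in>vpairs n. edge_prob W \<rho> x e)) / (real n)\<^sup>2"
proof (rule cut_norm_leI)
  fix S T assume ST: "S \<subseteq> {..<n}" "T \<subseteq> {..<n}"
  have "\<bar>\<Sum>u\<in>S. \<Sum>v\<in>T. noise W \<rho> x E u v\<bar> \<le> (\<Sum>e\<in>vpairs n. \<bar>edge_mult S T e * ((if e \<in> E then 1 else 0) - edge_prob W \<rho> x e)\<bar>)"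
    by (subst noise_sum[where W = W and x = x and n = n, OF \<rho> sym E ST]) (auto intro: sum_abs)
  also have "\<dots> \<le> (\<Sum>e\<in>vpairs n. 2 * ((if e \<in> E then 1 else 0) + edge_prob W \<rho> x e))"
  proof (rule sum_mono)
    fix e assume "e \<in> vpairs n"
    then have "0 \<le> edge_prob W \<rho> x e" using edge_prob_bounds[where W = W and x = x and n = n, OF \<rho> nn] by blast
    then show "\<bar>edge_mult S T e * ((if e \<in> E then 1 else 0) - edge_prob W \<rho> x e)\<bar> \<le> 2 * ((if e \<in> E then 1 else 0) + edge_prob W \<rho> x e)"
      unfolding abs_mult by (intro mult_mono) (auto simp: edge_mult_def)
  qed
  also have "\<dots> = 2 * ((\<Sum>e\<in>vpairs n. if e \<in> E then 1 else 0) + (\<Sum>e\<in>vpairs n. edge_prob W \<rho> x e))"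
    by (simp only: sum_distrib_left[symmetric] sum.distrib)
  also have "(\<Sum>e\<in>vpairs n. if e \<in> E then 1 else 0) = real (card E)"
    using E by (subst sum.inter_filter[symmetric]) (auto intro!: arg_cong[where f = card])
  finally show "\<bar>\<Sum>u\<in>S. \<Sum>v\<in>T. noise W \<rho> x E u v\<bar> / (real n)^2 \<le> 2 * (real (card E) + (\<Sum>e\<in>vpairs n. edge_prob W \<rho> x e)) / (real n)\<^sup>2"
    by (intro divide_right_mono) auto
qed

section \<open>Pair averages of independent samples\<close>

context prob_space
begin

abbreviation iid :: "(nat \<Rightarrow> 'a) measure" where
  "iid \<equiv> \<Pi>\<^sub>M _\<in>(UNIV::nat set). M"

lemma product_prob_space_iid: "product_prob_space (\<lambda>_::nat. M)"
  by (rule product_prob_spaceI) (rule prob_space_axioms)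

lemma prob_space_iid: "prob_space iid"
  by (intro prob_space_PiM prob_space_axioms)

lemma distr_iid_permute:
  assumes "inj \<tau>"
  shows "distr iid iid (\<lambda>z i. z (\<tau> i)) = iid"
  using distr_PiM_reindex[of UNIV "\<lambda>_. M" \<tau> UNIV] assms prob_space_axioms by (simp add: restrict_def)

lemma distr_iid_component: "distr iid M (\<lambda>z. z i) = M"
  by (intro distr_PiM_component prob_space_axioms) auto

lemma distr_iid_pair:
  assumes "u \<noteq> v"
  shows "distr iid (M \<Otimes>\<^sub>M M) (\<lambda>z. (z u, z v)) = M \<Otimes>\<^sub>M M"
proof (rule pair_measure_eqI[symmetric])
  interpret P: product_prob_space "\<lambda>_::nat. M" "UNIV :: nat set" by (rule product_prob_space_iid)
  fix A B assume AB[measurable]: "A \<in> sets M" "B \<in> sets M"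
  define X where "X i = (if i = u then A else B)" for i
  have "emeasure (distr iid (M \<Otimes>\<^sub>M M) (\<lambda>z. (z u, z v))) (A \<times> B) = emeasure iid {z\<in>space iid. \<forall>i\<in>{u,v}. z i \<in> X i}"
    using assms by (subst emeasure_distr) (auto simp: X_def intro!: arg_cong2[where f = emeasure])
  also have "\<dots> = (\<Prod>i\<in>{u,v}. emeasure M (X i))"
    by (rule P.emeasure_PiM_Collect) (use AB in \<open>auto simp: X_def\<close>)
  also have "\<dots> = emeasure M A * emeasure M B" using assms by (simp add: X_def)
  finally show "emeasure M A * emeasure M B = emeasure (distr iid (M \<Otimes>\<^sub>M M) (\<lambda>z. (z u, z v))) (A \<times> B)" ..
qed (auto intro: sigma_finite_measure_axioms)

lemma iid_pair_integral:
  fixes F :: "'a \<times> 'a \<Rightarrow> real"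
  assumes F: "integrable (M \<Otimes>\<^sub>M M) F" and uv: "u \<noteq> v"
  shows "integrable iid (\<lambda>z. F (z u, z v))" "(\<integral>z. F (z u, z v) \<partial>iid) = (\<integral>x. F x \<partial>(M \<Otimes>\<^sub>M M))"
proof -
  have [measurable]: "F \<in> borel_measurable (M \<Otimes>\<^sub>M M)" using F by auto
  have d: "M \<Otimes>\<^sub>M M = distr iid (M \<Otimes>\<^sub>M M) (\<lambda>z. (z u, z v))" by (rule distr_iid_pair[OF uv, symmetric])
  show "integrable iid (\<lambda>z. F (z u, z v))"
    using F by (subst (asm) d, subst (asm) integrable_distr_eq) auto
  have "(\<integral>x. F x \<partial>(M \<Otimes>\<^sub>M M)) = (\<integral>x. F x \<partial>distr iid (M \<Otimes>\<^sub>M M) (\<lambda>z. (z u, z v)))"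
    by (simp add: distr_iid_pair[OF uv])
  also have "\<dots> = (\<integral>z. F (z u, z v) \<partial>iid)" by (subst integral_distr) auto
  finally show "(\<integral>z. F (z u, z v) \<partial>iid) = (\<integral>x. F x \<partial>(M \<Otimes>\<^sub>M M))" ..
qed

end

text \<open>The U-statistic with kernel \<open>F\<close>, not divided by n (n - 1).\<close>

definition offdiag_sum :: "('a \<times> 'a \<Rightarrow> real) \<Rightarrow> nat \<Rightarrow> (nat \<Rightarrow> 'a) \<Rightarrow> real" where
  "offdiag_sum F n z = (\<Sum>u<n. \<Sum>v<n. if u \<noteq> v then F (z u, z v) else 0)"

lemma offdiag_sum_permute:
  assumes "\<tau> permutes {..<n}"
  shows "offdiag_sum F n (\<lambda>i. z (\<tau> i)) = offdiag_sum F n z"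
proof -
  have inj: "inj \<tau>" using assms by (rule permutes_inj)
  have "offdiag_sum F n (\<lambda>i. z (\<tau> i)) = (\<Sum>u<n. \<Sum>v<n. if \<tau> u \<noteq> \<tau> v then F (z (\<tau> u), z (\<tau> v)) else 0)"
    unfolding offdiag_sum_def by (intro sum.cong refl if_cong) (auto dest: injD[OF inj])
  also have "\<dots> = (\<Sum>u<n. \<Sum>v<n. if \<tau> u \<noteq> v then F (z (\<tau> u), z v) else 0)"
  proof (rule sum.cong[OF refl])
    fix u
    show "(\<Sum>v<n. if \<tau> u \<noteq> \<tau> v then F (z (\<tau> u), z (\<tau> v)) else 0) = (\<Sum>v<n. if \<tau> u \<noteq> v then F (z (\<tau> u), z v) else 0)"
      using sum.permute[OF assms, of "\<lambda>v. if \<tau> u \<noteq> v then F (z (\<tau> u), z v) else 0"] by (simp add: comp_def)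
  qed
  also have "\<dots> = offdiag_sum F n z"
    using sum.permute[OF assms, of "\<lambda>u. \<Sum>v<n. if u \<noteq> v then F (z u, z v) else 0"]
    by (simp add: comp_def offdiag_sum_def)
  finally show ?thesis .
qed

lemma ex_permutes_pair:
  assumes "u < n" "v < n" "u \<noteq> v"
  obtains \<tau> :: "nat \<Rightarrow> nat" where "\<tau> permutes {..<n}" "\<tau> 0 = u" "\<tau> 1 = v"
proof -
  \<comment> \<open>The second transposition is applied first, so it must send 1 to the preimage of
    \<open>v\<close> under the first; this also covers v = 0.\<close>
  define w where "w = Transposition.transpose 0 u v"
  have w: "w < n" "w \<noteq> 0" using assms by (auto simp: w_def Transposition.transpose_def)
  define \<tau> where "\<tau> = Transposition.transpose 0 u \<circ> Transposition.transpose 1 w"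
  have "\<tau> permutes {..<n}"
    unfolding \<tau>_def using assms w by (intro permutes_compose permutes_swap_id) auto
  moreover have "\<tau> 0 = u" using w by (auto simp: \<tau>_def Transposition.transpose_def)
  moreover have "\<tau> 1 = v" by (simp add: \<tau>_def w_def)
  ultimately show ?thesis by (rule that)
qed

lemma offdiag_sum_nonneg: "(\<And>x. 0 \<le> F x) \<Longrightarrow> 0 \<le> offdiag_sum F n z"
  unfolding offdiag_sum_def by (intro sum_nonneg) auto

context prob_space
begin

lemma measurable_offdiag_sum [measurable]:
  "F \<in> borel_measurable (M \<Otimes>\<^sub>M M) \<Longrightarrow> (\<lambda>z. offdiag_sum F n z) \<in> borel_measurable iid"
  unfolding offdiag_sum_def
proof (intro borel_measurable_sum)
  fix u v assume [measurable]: "F \<in> borel_measurable (M \<Otimes>\<^sub>M M)"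
  show "(\<lambda>z. if u \<noteq> v then F (z u, z v) else 0) \<in> borel_measurable iid"
    by (cases "u = v") simp_all
qed

text \<open>The averages form a reversed martingale for the symmetric sigma-fields; the last time they
  exceed the level is symmetric in the first \<open>n\<close> coordinates, which is all Doob's argument needs.\<close>
lemma offdiag_sum_maximal_finite:
  assumes F: "integrable (M \<Otimes>\<^sub>M M) F" and F0: "\<And>x. 0 \<le> F x" and c: "0 < c"
  shows "measure iid {z\<in>space iid. \<exists>n\<in>{2..L}. c * (real n * (real n - 1)) < offdiag_sum F n z} \<le> (\<integral>x. F x \<partial>(M \<Otimes>\<^sub>M M)) / c"
proof -
  interpret P: prob_space iid by (rule prob_space_iid)
  have [measurable]: "F \<in> borel_measurable (M \<Otimes>\<^sub>M M)" using F by auto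
  define ex where "ex n z \<longleftrightarrow> c * (real n * (real n - 1)) < offdiag_sum F n z" for n z
  have [measurable]: "Measurable.pred iid (ex n)" for n unfolding ex_def by measurable
  define D where "D n = {z\<in>space iid. ex n z \<and> (\<forall>m\<in>{n<..L}. \<not> ex m z)}" for n
  have Dm[measurable]: "D n \<in> sets iid" for n unfolding D_def by measurable
  have un: "{z\<in>space iid. \<exists>n\<in>{2..L}. ex n z} = (\<Union>n\<in>{2..L}. D n)"
  proof (intro equalityI subsetI)
    fix z assume z: "z \<in> {z\<in>space iid. \<exists>n\<in>{2..L}. ex n z}"
    define m where "m = Max {n\<in>{2..L}. ex n z}"
    have ne: "{n\<in>{2..L}. ex n z} \<noteq> {}" using z by auto
    have m: "m \<in> {n\<in>{2..L}. ex n z}" unfolding m_def by (rule Max_in) (use ne in auto)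
    have "\<not> ex m' z" if "m' \<in> {m<..L}" for m'
    proof
      assume "ex m' z"
      then have "m' \<le> m" unfolding m_def using that m by (intro Max_ge) auto
      then show False using that by simp
    qed
    then show "z \<in> (\<Union>n\<in>{2..L}. D n)" using m z by (auto simp: D_def)
  qed (auto simp: D_def)
  have disj: "disjoint_family_on D {2..L}"
    unfolding disjoint_family_on_def
  proof (intro ballI impI)
    fix m n assume *: "m \<in> {2..L}" "n \<in> {2..L}" "m \<noteq> n"
    show "D m \<inter> D n = {}"
      using * by (cases "m < n") (auto simp: D_def)
  qed
  have iF: "integrable iid (\<lambda>z. F (z u, z v) * indicator A z)" if "u \<noteq> v" "A \<in> sets iid" for u v A
    using iid_pair_integral(1)[OF F that(1)] that(2) by (rule integrable_real_mult_indicator[rotated])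
  have sym: "(\<integral>z. F (z u, z v) * indicator (D n) z \<partial>iid) = (\<integral>z. F (z 0, z 1) * indicator (D n) z \<partial>iid)"
    if uv: "u < n" "v < n" "u \<noteq> v" for u v n
  proof -
    obtain \<tau> where \<tau>: "\<tau> permutes {..<n}" "\<tau> 0 = u" "\<tau> 1 = v" by (rule ex_permutes_pair[OF uv])
    have [measurable]: "(\<lambda>z i. z (\<tau> i)) \<in> measurable iid iid"
      by (rule measurable_PiM_single') (auto simp: space_PiM)
    have ex': "ex m (\<lambda>i. z (\<tau> i)) = ex m z" if "n \<le> m" for m z
    proof -
      have "\<tau> permutes {..<m}" by (rule permutes_subset[OF \<tau>(1)]) (use that in auto)
      then show ?thesis by (simp add: ex_def offdiag_sum_permute)
    qed
    have D': "(\<lambda>i. z (\<tau> i)) \<in> D n \<longleftrightarrow> z \<in> D n" if "z \<in> space iid" for z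
      using ex' that by (auto simp: D_def space_PiM)
    have "(\<integral>z. F (z 0, z 1) * indicator (D n) z \<partial>iid)
       = (\<integral>z. F (z 0, z 1) * indicator (D n) z \<partial>distr iid iid (\<lambda>z i. z (\<tau> i)))"
      by (simp add: distr_iid_permute permutes_inj[OF \<tau>(1)])
    also have "\<dots> = (\<integral>z. F (z (\<tau> 0), z (\<tau> 1)) * indicator (D n) (\<lambda>i. z (\<tau> i)) \<partial>iid)"
      by (subst integral_distr) auto
    also have "\<dots> = (\<integral>z. F (z u, z v) * indicator (D n) z \<partial>iid)"
      by (intro Bochner_Integration.integral_cong refl) (auto simp: \<tau> D' indicator_def simp del: One_nat_def)
    finally show ?thesis ..
  qed
  \<comment> \<open>By symmetry every pair contributes the same integral over \<open>D n\<close>, so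
    the average over pairs may be replaced by the single term \<open>F (z 0, z 1)\<close>, whose
    integrals over the disjoint events add up to at most that of \<open>F\<close>.\<close>
  have key: "c * measure iid (D n) \<le> (\<integral>z. F (z 0, z 1) * indicator (D n) z \<partial>iid)" if n: "n \<in> {2..L}" for n
  proof -
    let ?I = "\<integral>z. F (z 0, z 1) * indicator (D n) z \<partial>iid"
    have io: "integrable iid (\<lambda>z. (if u \<noteq> v then F (z u, z v) else 0) * indicator (D n) z)" for u v
      using iF[of u v "D n"] by (cases "u = v") auto
    have eq: "offdiag_sum F n z * indicator (D n) z = (\<Sum>u<n. \<Sum>v<n. (if u \<noteq> v then F (z u, z v) else 0) * indicator (D n) z)" for z
      by (simp add: offdiag_sum_def sum_distrib_right)
    have i: "integrable iid (\<lambda>z. offdiag_sum F n z * indicator (D n) z)"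
      unfolding eq by (intro Bochner_Integration.integrable_sum io)
    have "(\<integral>z. offdiag_sum F n z * indicator (D n) z \<partial>iid) = (\<Sum>u<n. \<Sum>v<n. \<integral>z. (if u \<noteq> v then F (z u, z v) else 0) * indicator (D n) z \<partial>iid)"
      unfolding eq
      by (subst Bochner_Integration.integral_sum, intro Bochner_Integration.integrable_sum io,
          intro sum.cong refl Bochner_Integration.integral_sum io)
    also have "\<dots> = (\<Sum>u<n. \<Sum>v<n. if u \<noteq> v then ?I else 0)"
    proof (intro sum.cong refl)
      fix u v assume "u \<in> {..<n}" "v \<in> {..<n}"
      then show "(\<integral>z. (if u \<noteq> v then F (z u, z v) else 0) * indicator (D n) z \<partial>iid) = (if u \<noteq> v then ?I else 0)"
        using sym[of u n v] by (cases "u = v") simp_all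
    qed
    also have "\<dots> = real n * (real n - 1) * ?I"
    proof -
      have "(\<Sum>v<n. if u \<noteq> v then ?I else 0) = (real n - 1) * ?I" if "u < n" for u
      proof -
        have "(\<Sum>v<n. if u \<noteq> v then ?I else 0) = (\<Sum>v\<in>{..<n} - {u}. ?I)"
          by (intro sum.mono_neutral_cong_right) auto
        also have "\<dots> = (real n - 1) * ?I" using that by (simp add: of_nat_diff)
        finally show ?thesis .
      qed
      then show ?thesis by simp
    qed
    finally have e: "(\<integral>z. offdiag_sum F n z * indicator (D n) z \<partial>iid) = real n * (real n - 1) * ?I" .
    have "(\<integral>z. (c * (real n * (real n - 1))) * indicator (D n) z \<partial>iid) \<le> (\<integral>z. offdiag_sum F n z * indicator (D n) z \<partial>iid)"
    proof (intro integral_mono i)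
      show "integrable iid (\<lambda>z. (c * (real n * (real n - 1))) * indicator (D n) z)"
        by (simp add: less_top[symmetric])
      show "(c * (real n * (real n - 1))) * indicator (D n) z \<le> offdiag_sum F n z * indicator (D n) z" for z
        by (cases "z \<in> D n") (auto simp: D_def ex_def)
    qed
    then have "real n * (real n - 1) * (c * measure iid (D n)) \<le> real n * (real n - 1) * ?I"
      unfolding e by (simp add: mult_ac)
    then show ?thesis using n by (subst (asm) mult_le_cancel_left_pos) auto
  qed
  have "c * measure iid {z\<in>space iid. \<exists>n\<in>{2..L}. ex n z} = (\<Sum>n\<in>{2..L}. c * measure iid (D n))"
    unfolding un using disj by (subst P.finite_measure_finite_Union) (auto simp: sum_distrib_left)
  also have "\<dots> \<le> (\<Sum>n\<in>{2..L}. \<integral>z. F (z 0, z 1) * indicator (D n) z \<partial>iid)" by (intro sum_mono key)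
  also have "\<dots> = (\<integral>z. (\<Sum>n\<in>{2..L}. F (z 0, z 1) * indicator (D n) z) \<partial>iid)"
    by (rule Bochner_Integration.integral_sum[symmetric]) (rule iF, auto)
  also have "\<dots> \<le> (\<integral>z. F (z 0, z 1) \<partial>iid)"
  proof (intro integral_mono Bochner_Integration.integrable_sum iF iid_pair_integral(1)[OF F])
    fix z
    have "(\<Sum>n\<in>{2..L}. indicator (D n) z) = (indicator (\<Union>n\<in>{2..L}. D n) z :: real)"
      by (rule indicator_UN_disjoint[symmetric]) (use disj in auto)
    also have "\<dots> \<le> 1" by (simp add: indicator_def)
    finally show "(\<Sum>n\<in>{2..L}. F (z 0, z 1) * indicator (D n) z) \<le> F (z 0, z 1)"
      unfolding sum_distrib_left[symmetric] using F0 by (simp add: mult_left_le)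
  qed auto
  also have "\<dots> = (\<integral>x. F x \<partial>(M \<Otimes>\<^sub>M M))" by (rule iid_pair_integral(2)[OF F]) auto
  finally show ?thesis using c unfolding ex_def by (simp add: field_simps)
qed

lemma offdiag_sum_maximal:
  assumes F: "integrable (M \<Otimes>\<^sub>M M) F" and F0: "\<And>x. 0 \<le> F x" and c: "0 < c"
  shows "measure iid {z\<in>space iid. \<exists>n\<ge>2. c * (real n * (real n - 1)) < offdiag_sum F n z} \<le> (\<integral>x. F x \<partial>(M \<Otimes>\<^sub>M M)) / c"
proof -
  interpret P: prob_space iid by (rule prob_space_iid)
  have [measurable]: "F \<in> borel_measurable (M \<Otimes>\<^sub>M M)" using F by auto
  let ?A = "\<lambda>L. {z\<in>space iid. \<exists>n\<in>{2..L}. c * (real n * (real n - 1)) < offdiag_sum F n z}"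
  have "(\<lambda>L. measure iid (?A L)) \<longlonglongrightarrow> measure iid (\<Union>L. ?A L)"
  proof (rule P.finite_Lim_measure_incseq)
    show "incseq ?A"
      by (rule incseq_SucI) auto
  qed auto
  moreover have "(\<Union>L. ?A L) = {z\<in>space iid. \<exists>n\<ge>2. c * (real n * (real n - 1)) < offdiag_sum F n z}"
    by (auto, metis atLeastAtMost_iff order_refl)
  ultimately show ?thesis
    using LIMSEQ_le_const2 offdiag_sum_maximal_finite[OF F F0 c] by force
qed

text \<open>Density of step functions in $L^1$ of the product, with the same partition used in both
  variables. That makes the step function a block model carried by \<open>M\<close> itself.\<close>

definition step_approx :: "('a \<times> 'a \<Rightarrow> real) \<Rightarrow> bool" where
  "step_approx F \<longleftrightarrow> (\<forall>\<eta>>0. \<exists>(k::nat) \<phi> s. \<phi> \<in> measurable M (count_space UNIV) \<and> (\<forall>x\<in>space M. \<phi> x < (k::nat)) \<and>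
     (\<integral>x. \<bar>F x - s (\<phi> (fst x)) (\<phi> (snd x) :: nat)\<bar> \<partial>(M \<Otimes>\<^sub>M M)) < \<eta>)"

lemma step_approxE:
  assumes "step_approx F" "0 < \<eta>"
  obtains k :: nat and \<phi> :: "'a \<Rightarrow> nat" and s :: "nat \<Rightarrow> nat \<Rightarrow> real"
  where "\<phi> \<in> measurable M (count_space UNIV)" "\<And>x. x \<in> space M \<Longrightarrow> \<phi> x < k"
     "(\<integral>x. \<bar>F x - s (\<phi> (fst x)) (\<phi> (snd x))\<bar> \<partial>(M \<Otimes>\<^sub>M M)) < \<eta>"
  using assms unfolding step_approx_def by blast

lemma integrable_step:
  fixes s :: "nat \<Rightarrow> nat \<Rightarrow> real"
  assumes [measurable]: "\<phi> \<in> measurable M (count_space UNIV)" and k: "\<And>x. x \<in> space M \<Longrightarrow> \<phi> x < k"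
  shows "integrable (M \<Otimes>\<^sub>M M) (\<lambda>x. s (\<phi> (fst x)) (\<phi> (snd x)))"
    and "(\<integral>x. s (\<phi> (fst x)) (\<phi> (snd x)) \<partial>(M \<Otimes>\<^sub>M M))
      = (\<Sum>i<k. \<Sum>j<k. prob {x\<in>space M. \<phi> x = i} * prob {x\<in>space M. \<phi> x = j} * s i j)"
  using integral_pair_finite[OF assms(1), of "{..<k}" s] k by auto

lemma step_approx_cong:
  assumes "\<And>x. x \<in> space (M \<Otimes>\<^sub>M M) \<Longrightarrow> F x = G x"
  shows "step_approx F \<longleftrightarrow> step_approx G"
proof -
  have "(\<integral>x. \<bar>F x - s (\<phi> (fst x)) (\<phi> (snd x))\<bar> \<partial>(M \<Otimes>\<^sub>M M)) = (\<integral>x. \<bar>G x - s (\<phi> (fst x)) (\<phi> (snd x))\<bar> \<partial>(M \<Otimes>\<^sub>M M))"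
    for s :: "nat \<Rightarrow> nat \<Rightarrow> real" and \<phi>
    by (intro Bochner_Integration.integral_cong refl) (simp add: assms)
  then show ?thesis by (simp add: step_approx_def)
qed

lemma step_approx_step:
  fixes s :: "nat \<Rightarrow> nat \<Rightarrow> real" and \<phi> :: "'a \<Rightarrow> nat"
  assumes "\<phi> \<in> measurable M (count_space UNIV)" and "\<And>x. x \<in> space M \<Longrightarrow> \<phi> x < k"
    and "\<And>x. x \<in> space (M \<Otimes>\<^sub>M M) \<Longrightarrow> F x = s (\<phi> (fst x)) (\<phi> (snd x))"
  shows "step_approx F"
proof -
  have "step_approx (\<lambda>x. s (\<phi> (fst x)) (\<phi> (snd x)))"
    unfolding step_approx_def using assms(1,2)
    by (intro allI impI exI[of _ k] exI[of _ \<phi>] exI[of _ s]) auto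
  then show ?thesis using step_approx_cong[OF assms(3)] by simp
qed

lemma step_approx_close:
  assumes F: "integrable (M \<Otimes>\<^sub>M M) F"
    and G: "\<And>\<eta>. 0 < \<eta> \<Longrightarrow> \<exists>G. integrable (M \<Otimes>\<^sub>M M) G \<and> step_approx G \<and> (\<integral>x. \<bar>F x - G x\<bar> \<partial>(M \<Otimes>\<^sub>M M)) < \<eta>"
  shows "step_approx F"
  unfolding step_approx_def
proof (intro allI impI)
  fix \<eta> :: real assume "0 < \<eta>"
  then obtain G where G: "integrable (M \<Otimes>\<^sub>M M) G" "step_approx G" "(\<integral>x. \<bar>F x - G x\<bar> \<partial>(M \<Otimes>\<^sub>M M)) < \<eta> / 2"
    using assms(2)[of "\<eta> / 2"] by auto
  obtain k :: nat and \<phi> :: "'a \<Rightarrow> nat" and s :: "nat \<Rightarrow> nat \<Rightarrow> real" where s: "\<phi> \<in> measurable M (count_space UNIV)" "\<And>x. x \<in> space M \<Longrightarrow> \<phi> x < k"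
     "(\<integral>x. \<bar>G x - s (\<phi> (fst x)) (\<phi> (snd x))\<bar> \<partial>(M \<Otimes>\<^sub>M M)) < \<eta> / 2"
    by (rule step_approxE[OF G(2), of "\<eta> / 2"]) (use \<open>0 < \<eta>\<close> in auto)
  note i = integrable_step(1)[OF s(1,2), where s = s]
  have "(\<integral>x. \<bar>F x - s (\<phi> (fst x)) (\<phi> (snd x))\<bar> \<partial>(M \<Otimes>\<^sub>M M))
     \<le> (\<integral>x. \<bar>F x - G x\<bar> + \<bar>G x - s (\<phi> (fst x)) (\<phi> (snd x))\<bar> \<partial>(M \<Otimes>\<^sub>M M))"
    by (intro integral_mono Bochner_Integration.integrable_add integrable_abs Bochner_Integration.integrable_diff F G i) auto
  also have "\<dots> = (\<integral>x. \<bar>F x - G x\<bar> \<partial>(M \<Otimes>\<^sub>M M)) + (\<integral>x. \<bar>G x - s (\<phi> (fst x)) (\<phi> (snd x))\<bar> \<partial>(M \<Otimes>\<^sub>M M))"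
    by (intro Bochner_Integration.integral_add integrable_abs Bochner_Integration.integrable_diff F G i)
  also have "\<dots> < \<eta>" using G(3) s(3) by simp
  finally show "\<exists>(k::nat) \<phi> s. \<phi> \<in> measurable M (count_space UNIV) \<and> (\<forall>x\<in>space M. \<phi> x < k) \<and>
     (\<integral>x. \<bar>F x - s (\<phi> (fst x)) (\<phi> (snd x))\<bar> \<partial>(M \<Otimes>\<^sub>M M)) < \<eta>" using s by blast
qed

text \<open>Two partitions are merged into their common refinement.\<close>

lemma step_approx_add:
  assumes F: "integrable (M \<Otimes>\<^sub>M M) F" "step_approx F" and G: "integrable (M \<Otimes>\<^sub>M M) G" "step_approx G"
  shows "step_approx (\<lambda>x. F x + G x)"
proof (rule step_approx_close)
  show "integrable (M \<Otimes>\<^sub>M M) (\<lambda>x. F x + G x)" using F G by simp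
  fix \<eta> :: real assume "0 < \<eta>"
  obtain k :: nat and \<phi> :: "'a \<Rightarrow> nat" and s :: "nat \<Rightarrow> nat \<Rightarrow> real" where s: "\<phi> \<in> measurable M (count_space UNIV)" "\<And>x. x \<in> space M \<Longrightarrow> \<phi> x < k"
     "(\<integral>x. \<bar>F x - s (\<phi> (fst x)) (\<phi> (snd x))\<bar> \<partial>(M \<Otimes>\<^sub>M M)) < \<eta> / 2"
    by (rule step_approxE[OF F(2), of "\<eta> / 2"]) (use \<open>0 < \<eta>\<close> in auto)
  obtain k' :: nat and \<phi>' :: "'a \<Rightarrow> nat" and s' :: "nat \<Rightarrow> nat \<Rightarrow> real" where s': "\<phi>' \<in> measurable M (count_space UNIV)" "\<And>x. x \<in> space M \<Longrightarrow> \<phi>' x < k'"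
     "(\<integral>x. \<bar>G x - s' (\<phi>' (fst x)) (\<phi>' (snd x))\<bar> \<partial>(M \<Otimes>\<^sub>M M)) < \<eta> / 2"
    by (rule step_approxE[OF G(2), of "\<eta> / 2"]) (use \<open>0 < \<eta>\<close> in auto)
  note [measurable] = s(1) s'(1)
  note i = integrable_step(1)[OF s(1,2), where s = s] integrable_step(1)[OF s'(1,2), where s = s']
  let ?H = "\<lambda>x. s (\<phi> (fst x)) (\<phi> (snd x)) + s' (\<phi>' (fst x)) (\<phi>' (snd x))"
  have "step_approx ?H"
  proof (rule step_approx_step)
    \<comment> \<open>The pair of labels coded in base \<open>k\<close>; remainder and quotient
      recover it.\<close>
    let ?p = "\<lambda>x. \<phi> x + k * \<phi>' x"
    show "?p \<in> measurable M (count_space UNIV)" by measurable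
    show "?p x < k * k'" if "x \<in> space M" for x
    proof -
      have "\<phi> x + k * \<phi>' x < k + k * \<phi>' x" using s(2)[OF that] by simp
      also have "\<dots> = k * Suc (\<phi>' x)" by simp
      also have "\<dots> \<le> k * k'" using s'(2)[OF that] by (intro mult_left_mono) auto
      finally show ?thesis .
    qed
    show "?H x = (\<lambda>i j. s (i mod k) (j mod k) + s' (i div k) (j div k)) (?p (fst x)) (?p (snd x))"
      if "x \<in> space (M \<Otimes>\<^sub>M M)" for x
      using that s(2)[of "fst x"] s(2)[of "snd x"] by (auto simp: space_pair_measure)
  qed
  moreover have "(\<integral>x. \<bar>F x + G x - ?H x\<bar> \<partial>(M \<Otimes>\<^sub>M M)) < \<eta>"
  proof -
    have "(\<integral>x. \<bar>F x + G x - ?H x\<bar> \<partial>(M \<Otimes>\<^sub>M M))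
       \<le> (\<integral>x. \<bar>F x - s (\<phi> (fst x)) (\<phi> (snd x))\<bar> + \<bar>G x - s' (\<phi>' (fst x)) (\<phi>' (snd x))\<bar> \<partial>(M \<Otimes>\<^sub>M M))"
      by (intro integral_mono Bochner_Integration.integrable_add integrable_abs Bochner_Integration.integrable_diff F G i) auto
    also have "\<dots> = (\<integral>x. \<bar>F x - s (\<phi> (fst x)) (\<phi> (snd x))\<bar> \<partial>(M \<Otimes>\<^sub>M M)) + (\<integral>x. \<bar>G x - s' (\<phi>' (fst x)) (\<phi>' (snd x))\<bar> \<partial>(M \<Otimes>\<^sub>M M))"
      by (intro Bochner_Integration.integral_add integrable_abs Bochner_Integration.integrable_diff F G i)
    finally show ?thesis using s(3) s'(3) by linarith
  qed
  ultimately show "\<exists>H. integrable (M \<Otimes>\<^sub>M M) H \<and> step_approx H \<and> (\<integral>x. \<bar>F x + G x - H x\<bar> \<partial>(M \<Otimes>\<^sub>M M)) < \<eta>"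
    using i by (intro exI[of _ ?H]) auto
qed

lemma step_approx_cmult:
  assumes F: "integrable (M \<Otimes>\<^sub>M M) F" "step_approx F"
  shows "step_approx (\<lambda>x. c * F x)"
  unfolding step_approx_def
proof (intro allI impI)
  fix \<eta> :: real assume \<eta>: "0 < \<eta>"
  obtain k :: nat and \<phi> :: "'a \<Rightarrow> nat" and s :: "nat \<Rightarrow> nat \<Rightarrow> real" where s: "\<phi> \<in> measurable M (count_space UNIV)" "\<And>x. x \<in> space M \<Longrightarrow> \<phi> x < k"
     "(\<integral>x. \<bar>F x - s (\<phi> (fst x)) (\<phi> (snd x))\<bar> \<partial>(M \<Otimes>\<^sub>M M)) < \<eta> / (\<bar>c\<bar> + 1)"
    by (rule step_approxE[OF F(2), of "\<eta> / (\<bar>c\<bar> + 1)"]) (use \<eta> in auto)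
  let ?I = "\<integral>x. \<bar>F x - s (\<phi> (fst x)) (\<phi> (snd x))\<bar> \<partial>(M \<Otimes>\<^sub>M M)"
  have "(\<integral>x. \<bar>c * F x - c * s (\<phi> (fst x)) (\<phi> (snd x))\<bar> \<partial>(M \<Otimes>\<^sub>M M)) = \<bar>c\<bar> * ?I"
    by (simp add: right_diff_distrib[symmetric] abs_mult)
  also have "\<dots> \<le> (\<bar>c\<bar> + 1) * ?I" by (intro mult_right_mono) auto
  also have "\<dots> < \<eta>" using s(3) by (simp add: field_simps)
  finally show "\<exists>(k::nat) \<phi> s. \<phi> \<in> measurable M (count_space UNIV) \<and> (\<forall>x\<in>space M. \<phi> x < k) \<and>
     (\<integral>x. \<bar>c * F x - s (\<phi> (fst x)) (\<phi> (snd x))\<bar> \<partial>(M \<Otimes>\<^sub>M M)) < \<eta>"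
    using s(1,2) by (intro exI[of _ k] exI[of _ \<phi>] exI[of _ "\<lambda>i j. c * s i j"]) auto
qed

text \<open>Dominated convergence turns pointwise convergence into $L^1$ convergence, under which
  the class is closed.\<close>

lemma step_approx_lim:
  assumes G: "\<And>i. integrable (M \<Otimes>\<^sub>M M) (G i)" "\<And>i. step_approx (G i)"
    and F: "integrable (M \<Otimes>\<^sub>M M) F" and w: "integrable (M \<Otimes>\<^sub>M M) w"
    and lim: "\<And>x. x \<in> space (M \<Otimes>\<^sub>M M) \<Longrightarrow> (\<lambda>i. G i x) \<longlonglongrightarrow> F x"
    and dom: "\<And>i x. x \<in> space (M \<Otimes>\<^sub>M M) \<Longrightarrow> \<bar>F x - G i x\<bar> \<le> w x"
  shows "step_approx F"
proof (rule step_approx_close[OF F])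
  fix \<eta> :: real assume \<eta>: "0 < \<eta>"
  have "(\<lambda>i. \<integral>x. \<bar>F x - G i x\<bar> \<partial>(M \<Otimes>\<^sub>M M)) \<longlonglongrightarrow> (\<integral>x. 0 \<partial>(M \<Otimes>\<^sub>M M))"
  proof (rule integral_dominated_convergence[OF _ _ w])
    show "AE x in M \<Otimes>\<^sub>M M. (\<lambda>i. \<bar>F x - G i x\<bar>) \<longlonglongrightarrow> 0"
    proof (rule AE_I2)
      fix x assume "x \<in> space (M \<Otimes>\<^sub>M M)"
      then have "(\<lambda>i. \<bar>F x - G i x\<bar>) \<longlonglongrightarrow> \<bar>F x - F x\<bar>" by (intro tendsto_intros lim)
      then show "(\<lambda>i. \<bar>F x - G i x\<bar>) \<longlonglongrightarrow> 0" by simp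
    qed
  qed (use G(1) F dom in \<open>auto intro!: borel_measurable_abs borel_measurable_diff\<close>)
  then have "eventually (\<lambda>i. (\<integral>x. \<bar>F x - G i x\<bar> \<partial>(M \<Otimes>\<^sub>M M)) < \<eta>) sequentially"
    using \<eta> by (intro order_tendstoD(2)[of _ 0]) auto
  then show "\<exists>G. integrable (M \<Otimes>\<^sub>M M) G \<and> step_approx G \<and> (\<integral>x. \<bar>F x - G x\<bar> \<partial>(M \<Otimes>\<^sub>M M)) < \<eta>"
    using G by (auto simp: eventually_sequentially)
qed

lemma step_approx_const: "step_approx (\<lambda>_. c)"
  by (rule step_approx_step[where \<phi> = "\<lambda>_. 0" and k = 1 and s = "\<lambda>_ _. c"]) auto

lemma integrable_indicator_pair: "A \<in> sets (M \<Otimes>\<^sub>M M) \<Longrightarrow> integrable (M \<Otimes>\<^sub>M M) (indicator A :: _ \<Rightarrow> real)"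
proof -
  interpret MM: pair_prob_space M M ..
  show "A \<in> sets (M \<Otimes>\<^sub>M M) \<Longrightarrow> integrable (M \<Otimes>\<^sub>M M) (indicator A :: _ \<Rightarrow> real)"
    by (simp add: less_top[symmetric])
qed

text \<open>Rectangles generate the product sigma-field and are stable under intersection;
  complements and disjoint countable unions are handled by linearity and dominated
  convergence.\<close>

lemma step_approx_indicator:
  assumes A: "A \<in> sets (M \<Otimes>\<^sub>M M)"
  shows "step_approx (indicator A)"
proof -
  interpret MM: pair_prob_space M M ..
  note ii = integrable_indicator_pair[unfolded sets_pair_measure]
  show ?thesis
    using Int_stable_pair_measure_generator[of M M] pair_measure_closed[of M M] A
    unfolding sets_pair_measure
  proof (induct rule: sigma_sets_induct_disjoint)
    case (basic R)
    then obtain A B where R: "R = A \<times> B" and [measurable]: "A \<in> sets M" "B \<in> sets M" by auto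
    show ?case
      unfolding R
    proof (rule step_approx_step)
      \<comment> \<open>Two bits record membership in \<open>A\<close> and in \<open>B\<close>: an
        odd label means in \<open>A\<close>, a label at least 2 means in \<open>B\<close>.\<close>
      let ?p = "\<lambda>x. (if x \<in> A then 1 else 0) + (if x \<in> B then 2 else 0 :: nat)"
      show "?p \<in> measurable M (count_space UNIV)" by measurable
      show "?p x < 4" if "x \<in> space M" for x by auto
      show "indicator (A \<times> B) x = (\<lambda>i j. if odd i \<and> j \<ge> 2 then 1 else 0) (?p (fst x)) (?p (snd x))" for x
        by (auto simp: indicator_def mem_Times_iff)
    qed
  next
    case empty
    show ?case using step_approx_const[of 0] by (simp add: indicator_def[abs_def])
  next
    case (compl A)
    have i: "integrable (M \<Otimes>\<^sub>M M) (indicator A :: _ \<Rightarrow> real)" by (rule ii) fact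
    have "step_approx (\<lambda>x. 1 + (-1) * indicator A x)"
      using i compl(2) by (intro step_approx_add step_approx_const step_approx_cmult) auto
    then show ?case
      by (subst step_approx_cong[of _ "\<lambda>x. 1 + (-1) * indicator A x"]) (auto simp: space_pair_measure indicator_def)
  next
    case (union A)
    have i: "integrable (M \<Otimes>\<^sub>M M) (indicator (A i) :: _ \<Rightarrow> real)" for i by (rule ii) (use union(2) in auto)
    have s: "step_approx (\<lambda>x. \<Sum>i<n. indicator (A i) x)" for n
    proof (induction n)
      case 0
      show ?case using step_approx_const[of 0] by simp
    next
      case (Suc n)
      then show ?case using i union(3) by (auto intro!: step_approx_add)
    qed
    have u: "(\<Union>i. A i) \<in> sets (M \<Otimes>\<^sub>M M)"
      unfolding sets_pair_measure using union(2) by (intro sigma_sets.Union) auto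
    have eq: "(\<Sum>i<n. indicator (A i) x) = (indicator (\<Union>i<n. A i) x :: real)" for n x
      by (rule indicator_UN_disjoint[symmetric])
        (use union(1) in \<open>auto simp: disjoint_family_on_def\<close>)
    show ?case
    proof (rule step_approx_lim[where G = "\<lambda>n x. \<Sum>i<n. indicator (A i) x" and w = "\<lambda>_. 1"])
      show "(\<lambda>n. \<Sum>i<n. indicator (A i) x) \<longlonglongrightarrow> (indicator (\<Union>i. A i) x :: real)" for x
        unfolding eq by (rule LIMSEQ_indicator_UN)
      show "\<bar>indicator (\<Union>i. A i) x - (\<Sum>i<n. indicator (A i) x)\<bar> \<le> (1::real)" for n x
        unfolding eq by (auto simp: indicator_def)
    qed (use i s integrable_indicator_pair[OF u] in auto)
  qed
qed

lemma step_approx_integrable: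
  assumes "integrable (M \<Otimes>\<^sub>M M) F"
  shows "step_approx F"
  using assms
proof (induction rule: integrable_induct)
  case (base A c)
  then have "step_approx (\<lambda>x. c * indicator A x)"
    by (intro step_approx_cmult integrable_indicator_pair step_approx_indicator)
  then show ?case by (simp add: mult.commute)
next
  case (add f g)
  then show ?case by (intro step_approx_add)
next
  case (lim f s)
  show ?case
  proof (rule step_approx_lim[where G = s and w = "\<lambda>x. 3 * \<bar>f x\<bar>"])
    show "\<bar>f x - s i x\<bar> \<le> 3 * \<bar>f x\<bar>" if "x \<in> space (M \<Otimes>\<^sub>M M)" for i x
    proof -
      have "norm (s i x) \<le> 2 * norm (f x)" using lim that by blast
      then show ?thesis by simp
    qed
  qed (use lim in auto)
qed

text \<open>Hoeffding's inequality gives a geometric bound for each tolerance, Borel-Cantelli gives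
  eventual closeness, and countably many tolerances give the limit.\<close>

lemma frequency_converges:
  assumes A[measurable]: "A \<in> sets M"
  shows "AE z in iid. (\<lambda>n. real (card {u\<in>{..<n}. z u \<in> A}) / real n) \<longlonglongrightarrow> prob A"
proof -
  interpret P: prob_space iid by (rule prob_space_iid)
  let ?Y = "\<lambda>i z. indicator A (z i) :: real"
  let ?f = "\<lambda>n z. real (card {u\<in>{..<n}. z u \<in> A}) / real n"
  have f: "?f n z = (\<Sum>i<n. ?Y i z) / real n" for n z
  proof -
    have "(\<Sum>i<n. ?Y i z) = real (card {u\<in>{..<n}. z u \<in> A})"
      by (auto simp: indicator_def intro!: arg_cong[where f = card])
    then show ?thesis by simp
  qed
  have "P.indep_vars (\<lambda>_. M) (\<lambda>i z. z i) (UNIV :: nat set)"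
    by (subst P.indep_vars_iff_distr_eq_PiM) (auto simp: distr_iid_component restrict_def)
  then have ind: "P.indep_vars (\<lambda>_. borel) ?Y (UNIV :: nat set)"
    by (rule P.indep_vars_compose2) auto
  have exp: "P.expectation (?Y 0) = prob A"
  proof -
    have "P.expectation (?Y 0) = (\<integral>x. indicator A x \<partial>distr iid M (\<lambda>z. z 0))"
      by (subst integral_distr) auto
    then show ?thesis by (simp add: distr_iid_component)
  qed
  have tail: "P.prob {z\<in>space iid. \<bar>?f n z - prob A\<bar> \<ge> \<epsilon>} \<le> 2 * exp (- 2 * real n * \<epsilon>\<^sup>2)" if "n > 0" "\<epsilon> > 0" for n \<epsilon>
  proof -
    interpret H: Hoeffding_ineq_iid iid "{..<n}" ?Y "?Y 0" 0 1 "P.expectation (?Y 0)"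
    proof unfold_locales
      show "P.indep_vars (\<lambda>_. borel) ?Y {..<n}" by (rule P.indep_vars_subset[OF ind]) auto
      show "distr iid borel (?Y i) = distr iid borel (?Y 0)" for i
      proof -
        have "distr iid borel (?Y i) = distr (distr iid M (\<lambda>z. z i)) borel (indicator A)" for i
          by (subst distr_distr) (auto simp: comp_def)
        then show ?thesis by (simp only: distr_iid_component)
      qed
    qed (auto simp: indicator_def)
    show ?thesis
      using H.Hoeffding_ineq_abs_ge'[of \<epsilon>] that unfolding f by (auto simp: exp)
  qed
  have ev: "AE z in iid. eventually (\<lambda>n. \<bar>?f n z - prob A\<bar> < \<epsilon>) sequentially" if \<epsilon>: "\<epsilon> > 0" for \<epsilon>
  proof -
    let ?B = "\<lambda>n. {z\<in>space iid. \<bar>?f n z - prob A\<bar> \<ge> \<epsilon>}"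
    have [measurable]: "(\<lambda>z. ?f n z) \<in> borel_measurable iid" for n unfolding f by measurable
    have "AE z in iid. eventually (\<lambda>n. z \<in> space iid - ?B n) sequentially"
    proof (rule borel_cantelli_AE1)
      show "?B n \<in> sets iid" for n by measurable
      show "summable (\<lambda>n. P.prob (?B n))"
      proof (rule summable_comparison_test)
        show "summable (\<lambda>n. 2 * exp (- 2 * \<epsilon>\<^sup>2) ^ n)"
          using \<epsilon> by (intro summable_mult summable_geometric) auto
        show "\<exists>N. \<forall>n\<ge>N. norm (P.prob (?B n)) \<le> 2 * exp (- 2 * \<epsilon>\<^sup>2) ^ n"
          using tail \<epsilon> by (intro exI[of _ 1]) (auto simp: exp_of_nat_mult[symmetric] mult_ac)
      qed
    qed (simp add: less_top[symmetric])
    then show ?thesis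
      by (rule AE_mp) (auto intro!: AE_I2 elim!: eventually_mono)
  qed
  have "AE z in iid. \<forall>m::nat. eventually (\<lambda>n. \<bar>?f n z - prob A\<bar> < 1 / real (Suc m)) sequentially"
    unfolding AE_all_countable by (intro allI ev) auto
  then show ?thesis
  proof eventually_elim
    case (elim z)
    show ?case
    proof (rule LIMSEQ_I)
      fix r :: real assume "0 < r"
      then obtain m where "1 / real (Suc m) < r" using nat_approx_posE by blast
      then show "\<exists>no. \<forall>n\<ge>no. norm (?f n z - prob A) < r"
        using elim[rule_format, of m] unfolding eventually_sequentially by (auto intro: less_trans)
    qed
  qed
qed

end

lemma sum_step_labels:
  fixes s :: "nat \<Rightarrow> nat \<Rightarrow> real" and l :: "nat \<Rightarrow> nat"
  assumes "\<And>u. u < n \<Longrightarrow> l u < k"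
  shows "(\<Sum>u<n. \<Sum>v<n. s (l u) (l v)) = (\<Sum>i<k. \<Sum>j<k. real (card {u\<in>{..<n}. l u = i}) * real (card {u\<in>{..<n}. l u = j}) * s i j)"
proof -
  have im: "l ` {..<n} \<subseteq> {..<k}" using assms by auto
  have c: "(\<Sum>u<n. if l u = j then 1 else 0) = real (card {u\<in>{..<n}. l u = j})" for j
    by (subst sum.inter_filter[symmetric]) auto
  have one: "(\<Sum>u<n. h (l u)) = (\<Sum>j<k. real (card {u\<in>{..<n}. l u = j}) * h j)" for h :: "nat \<Rightarrow> real"
    using sum_labels[OF finite_lessThan im, of "\<lambda>_. 1" h] by (simp add: c mult.commute)
  show ?thesis
    by (subst one, subst one) (simp add: sum_distrib_left mult.assoc)
qed

lemma offdiag_sum_mono: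
  assumes "\<And>u v. u < n \<Longrightarrow> v < n \<Longrightarrow> u \<noteq> v \<Longrightarrow> F (z u, z v) \<le> G (z u, z v)"
  shows "offdiag_sum F n z \<le> offdiag_sum G n z"
  unfolding offdiag_sum_def using assms by (intro sum_mono) auto

lemma offdiag_sum_add: "offdiag_sum (\<lambda>x. F x + G x) n z = offdiag_sum F n z + offdiag_sum G n z"
  unfolding offdiag_sum_def sum.distrib[symmetric] by (intro sum.cong) auto

section \<open>The upper half of a strong law for averages over pairs\<close>

context prob_space
begin

text \<open>For a step kernel the pair average is a polynomial in finitely many label frequencies,
  each of which converges almost surely.\<close>

lemma offdiag_sum_step_le:
  fixes s :: "nat \<Rightarrow> nat \<Rightarrow> real"
  assumes \<phi>[measurable]: "\<phi> \<in> measurable M (count_space UNIV)" and k: "\<And>x. x \<in> space M \<Longrightarrow> \<phi> x < k" and \<eta>: "0 < \<eta>"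
  defines "S \<equiv> \<lambda>x. s (\<phi> (fst x)) (\<phi> (snd x))"
  shows "AE z in iid. eventually (\<lambda>n. offdiag_sum S n z \<le> ((\<integral>x. S x \<partial>(M \<Otimes>\<^sub>M M)) + \<eta>) * (real n)\<^sup>2) sequentially"
proof -
  let ?p = "\<lambda>i. prob {x\<in>space M. \<phi> x = i}"
  have "AE z in iid. \<forall>i. (\<lambda>n. real (card {u\<in>{..<n}. z u \<in> {x\<in>space M. \<phi> x = i}}) / real n) \<longlonglongrightarrow> ?p i"
    unfolding AE_all_countable by (intro allI frequency_converges) measurable
  then show ?thesis using AE_space
  proof eventually_elim
    case (elim z)
    define N where "N n i = real (card {u\<in>{..<n}. \<phi> (z u) = i})" for n i
    have zs: "z u \<in> space M" for u using elim(2) by (auto simp: space_PiM)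
    have lim: "(\<lambda>n. N n i / real n) \<longlonglongrightarrow> ?p i" for i
      using elim(1)[rule_format, of i] zs by (simp add: N_def)
    \<comment> \<open>The subtracted sum is the diagonal, which carries a spare factor 1/n and
      disappears in the limit.\<close>
    have "(\<lambda>n. (\<Sum>i<k. \<Sum>j<k. (N n i / real n) * (N n j / real n) * s i j) - (\<Sum>i<k. (N n i / real n) * s i i) * (1 / real n))
       \<longlonglongrightarrow> (\<Sum>i<k. \<Sum>j<k. ?p i * ?p j * s i j) - (\<Sum>i<k. ?p i * s i i) * 0"
      by (intro tendsto_intros lim lim_1_over_n)
    also have "(\<Sum>i<k. \<Sum>j<k. ?p i * ?p j * s i j) - (\<Sum>i<k. ?p i * s i i) * 0 = (\<integral>x. S x \<partial>(M \<Otimes>\<^sub>M M))"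
      unfolding S_def by (subst integrable_step(2)[OF \<phi> k]) auto
    finally have "eventually (\<lambda>n. (\<Sum>i<k. \<Sum>j<k. (N n i / real n) * (N n j / real n) * s i j) - (\<Sum>i<k. (N n i / real n) * s i i) * (1 / real n)
        < (\<integral>x. S x \<partial>(M \<Otimes>\<^sub>M M)) + \<eta>) sequentially"
      using \<eta> by (intro order_tendstoD(2)) auto
    with eventually_gt_at_top[of 0] show ?case
    proof eventually_elim
      case (elim n)
      have lk: "\<phi> (z u) < k" for u using zs k by auto
      have "offdiag_sum S n z = (\<Sum>u<n. \<Sum>v<n. s (\<phi> (z u)) (\<phi> (z v))) - (\<Sum>u<n. s (\<phi> (z u)) (\<phi> (z u)))"
      proof -
        have "(\<Sum>v<n. if u \<noteq> v then s (\<phi> (z u)) (\<phi> (z v)) else 0) = (\<Sum>v<n. s (\<phi> (z u)) (\<phi> (z v))) - s (\<phi> (z u)) (\<phi> (z u))"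
          if "u < n" for u
        proof -
          have "(\<Sum>v<n. if u \<noteq> v then s (\<phi> (z u)) (\<phi> (z v)) else 0)
            = (\<Sum>v<n. s (\<phi> (z u)) (\<phi> (z v)) - (if v = u then s (\<phi> (z u)) (\<phi> (z u)) else 0))"
            by (intro sum.cong) auto
          then show ?thesis using that by (simp add: sum_subtractf)
        qed
        then show ?thesis by (simp add: offdiag_sum_def S_def sum_subtractf cong: if_cong)
      qed
      also have "(\<Sum>u<n. \<Sum>v<n. s (\<phi> (z u)) (\<phi> (z v))) = (\<Sum>i<k. \<Sum>j<k. N n i * N n j * s i j)"
        unfolding N_def by (rule sum_step_labels) (use lk in auto)
      also have "(\<Sum>u<n. s (\<phi> (z u)) (\<phi> (z u))) = (\<Sum>i<k. N n i * s i i)"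
      proof -
        have "(\<Sum>u<n. if \<phi> (z u) = j then 1 else 0) = N n j" for j
          unfolding N_def by (subst sum.inter_filter[symmetric]) auto
        then show ?thesis
          using sum_labels[of "{..<n}" "\<lambda>u. \<phi> (z u)" k "\<lambda>_. 1" "\<lambda>i. s i i"] lk by (auto simp: mult.commute)
      qed
      also have "(\<Sum>i<k. \<Sum>j<k. N n i * N n j * s i j) - (\<Sum>i<k. N n i * s i i)
         = ((\<Sum>i<k. \<Sum>j<k. (N n i / real n) * (N n j / real n) * s i j) - (\<Sum>i<k. (N n i / real n) * s i i) * (1 / real n)) * (real n)\<^sup>2"
        using elim(1) by (simp add: left_diff_distrib sum_distrib_right sum_divide_distrib power2_eq_square)
      also have "\<dots> \<le> ((\<integral>x. S x \<partial>(M \<Otimes>\<^sub>M M)) + \<eta>) * (real n)\<^sup>2"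
        using elim(2) by (intro mult_right_mono) auto
      finally show ?case .
    qed
  qed
qed

text \<open>The kernel is dominated by a step kernel plus an $L^1$-small remainder \<open>R\<close>.
  The maximal inequality bounds the probability that averages of \<open>R\<close> ever exceed
  \<delta> / 2 by 2 \<eta> / \<delta>, and \<eta> is arbitrary.\<close>

lemma offdiag_sum_eventually_le:
  assumes F: "integrable (M \<Otimes>\<^sub>M M) F" and \<delta>: "0 < \<delta>"
  shows "AE z in iid. eventually (\<lambda>n. offdiag_sum F n z \<le> ((\<integral>x. F x \<partial>(M \<Otimes>\<^sub>M M)) + \<delta>) * (real n)\<^sup>2) sequentially"
proof -
  interpret P: prob_space iid by (rule prob_space_iid)
  have [measurable]: "F \<in> borel_measurable (M \<Otimes>\<^sub>M M)" using F by auto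
  let ?ev = "\<lambda>z. eventually (\<lambda>n. offdiag_sum F n z \<le> ((\<integral>x. F x \<partial>(M \<Otimes>\<^sub>M M)) + \<delta>) * (real n)\<^sup>2) sequentially"
  let ?B = "{z\<in>space iid. \<not> ?ev z}"
  have B[measurable]: "?B \<in> sets iid" unfolding eventually_sequentially by measurable
  have bound: "P.prob ?B \<le> 2 * \<eta> / \<delta>" if \<eta>: "0 < \<eta>" "\<eta> \<le> \<delta> / 4" for \<eta>
  proof -
    obtain k :: nat and \<phi> :: "'a \<Rightarrow> nat" and s :: "nat \<Rightarrow> nat \<Rightarrow> real"
      where s: "\<phi> \<in> measurable M (count_space UNIV)" "\<And>x. x \<in> space M \<Longrightarrow> \<phi> x < k"
      "(\<integral>x. \<bar>F x - s (\<phi> (fst x)) (\<phi> (snd x))\<bar> \<partial>(M \<Otimes>\<^sub>M M)) < \<eta>"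
      by (rule step_approxE[OF step_approx_integrable[OF F], of \<eta>]) (use \<eta> in auto)
    define S where "S x = s (\<phi> (fst x)) (\<phi> (snd x))" for x
    define R where "R x = \<bar>F x - S x\<bar>" for x
    have iS: "integrable (M \<Otimes>\<^sub>M M) S" unfolding S_def by (rule integrable_step[OF s(1,2)])
    have iR: "integrable (M \<Otimes>\<^sub>M M) R" unfolding R_def by (intro integrable_abs Bochner_Integration.integrable_diff F iS)
    have [measurable]: "R \<in> borel_measurable (M \<Otimes>\<^sub>M M)" using iR by auto
    have RI: "(\<integral>x. R x \<partial>(M \<Otimes>\<^sub>M M)) < \<eta>" using s(3) by (simp add: R_def S_def)
    have "(\<integral>x. S x \<partial>(M \<Otimes>\<^sub>M M)) \<le> (\<integral>x. F x + R x \<partial>(M \<Otimes>\<^sub>M M))"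
      by (intro integral_mono iS Bochner_Integration.integrable_add F iR) (auto simp: R_def)
    then have SI: "(\<integral>x. S x \<partial>(M \<Otimes>\<^sub>M M)) \<le> (\<integral>x. F x \<partial>(M \<Otimes>\<^sub>M M)) + \<eta>"
      using RI F iR by simp
    let ?X = "{z\<in>space iid. \<exists>n\<ge>2. \<delta> / 2 * (real n * (real n - 1)) < offdiag_sum R n z}"
    have "AE z in iid. eventually (\<lambda>n. offdiag_sum S n z \<le> ((\<integral>x. S x \<partial>(M \<Otimes>\<^sub>M M)) + \<eta>) * (real n)\<^sup>2) sequentially"
      unfolding S_def by (rule offdiag_sum_step_le[OF s(1,2) \<eta>(1)])
    then have "AE z in iid. z \<in> ?B \<longrightarrow> z \<in> ?X"
    proof eventually_elim
      case (elim z)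
      show ?case
      proof (rule impI, rule ccontr)
        assume zB: "z \<in> ?B" and "z \<notin> ?X"
        then have R: "offdiag_sum R n z \<le> \<delta> / 2 * (real n * (real n - 1))" if "n \<ge> 2" for n
          using that by (auto simp: not_less)
        from elim eventually_ge_at_top[of 2] have "?ev z"
        proof eventually_elim
          case (elim n)
          have "offdiag_sum F n z \<le> offdiag_sum (\<lambda>x. S x + R x) n z"
            by (rule offdiag_sum_mono) (auto simp: R_def)
          also have "\<dots> \<le> ((\<integral>x. S x \<partial>(M \<Otimes>\<^sub>M M)) + \<eta>) * (real n)\<^sup>2 + \<delta> / 2 * (real n)\<^sup>2"
            unfolding offdiag_sum_add
          proof (rule add_mono[OF elim(1)])
            have "\<delta> / 2 * (real n * (real n - 1)) \<le> \<delta> / 2 * (real n * real n)"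
              using \<delta> by (intro mult_left_mono) auto
            then show "offdiag_sum R n z \<le> \<delta> / 2 * (real n)\<^sup>2" using R[OF elim(2)] by (simp add: power2_eq_square)
          qed
          also have "\<dots> = ((\<integral>x. S x \<partial>(M \<Otimes>\<^sub>M M)) + \<eta> + \<delta> / 2) * (real n)\<^sup>2" by (simp add: algebra_simps)
          also have "\<dots> \<le> ((\<integral>x. F x \<partial>(M \<Otimes>\<^sub>M M)) + \<delta>) * (real n)\<^sup>2"
            using SI \<eta> by (intro mult_right_mono) auto
          finally show ?case .
        qed
        then show False using zB by auto
      qed
    qed
    then have "P.prob ?B \<le> P.prob ?X" by (intro P.finite_measure_mono_AE) measurable
    also have "\<dots> \<le> (\<integral>x. R x \<partial>(M \<Otimes>\<^sub>M M)) / (\<delta> / 2)"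
      by (rule offdiag_sum_maximal[OF iR]) (use \<delta> in \<open>auto simp: R_def\<close>)
    also have "\<dots> \<le> 2 * \<eta> / \<delta>" using RI \<delta> by (simp add: field_simps)
    finally show ?thesis .
  qed
  have "P.prob ?B = 0"
  proof (rule ccontr)
    assume "P.prob ?B \<noteq> 0"
    then have pos: "0 < P.prob ?B" by (simp add: zero_less_measure_iff)
    \<comment> \<open>Chosen so that the bound is at most half of the probability that it
      bounds.\<close>
    define \<eta> where "\<eta> = min (\<delta> / 4) (\<delta> * P.prob ?B / 4)"
    have "P.prob ?B \<le> 2 * \<eta> / \<delta>" by (rule bound) (use \<delta> pos in \<open>auto simp: \<eta>_def\<close>)
    also have "\<dots> \<le> 2 * (\<delta> * P.prob ?B / 4) / \<delta>" using \<delta> by (intro divide_right_mono mult_left_mono) (auto simp: \<eta>_def)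
    also have "\<dots> = P.prob ?B / 2" using \<delta> by simp
    finally show False using pos by simp
  qed
  then show ?thesis
    by (intro AE_I[where N = ?B]) (auto simp: P.emeasure_eq_measure B)
qed

end

section \<open>Labelled samples and the fit of rounded labellings\<close>

context block_coupling
begin

abbreviation "iidM \<equiv> \<Pi>\<^sub>M _\<in>(UNIV::nat set). M"

text \<open>Independent points of \<open>N\<close> project to independent points of
  \<open>M\<close>, so the labels can be sampled as additional information without changing the law
  of the points. Cylinders determine the law.\<close>

lemma distr_iid_\<xi>: "distr iid iidM (\<lambda>z i. \<xi> (z i)) = iidM"
proof -
  interpret PN: product_prob_space "\<lambda>_::nat. N" "UNIV :: nat set" by (rule product_prob_space_iid)
  interpret M: prob_space M by (rule prob_M)
  interpret PM: product_prob_space "\<lambda>_::nat. M" "UNIV :: nat set" by (rule M.product_prob_space_iid)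
  have [measurable]: "(\<lambda>z i. \<xi> (z i)) \<in> measurable iid iidM"
    by (rule measurable_PiM_single') (auto simp: space_PiM intro: measurable_space[OF meas_\<xi>])
  show ?thesis
  proof (rule PM.PiM_eq)
    fix J :: "nat set" and F assume J: "finite J" and F: "\<And>j. j \<in> J \<Longrightarrow> F j \<in> sets M"
    let ?A = "\<lambda>j. \<xi> -` F j \<inter> space N"
    have mF: "prod_emb UNIV (\<lambda>_. M) J (Pi\<^sub>E J F) \<in> sets iidM"
      using J F by (intro measurable_prod_emb sets_PiM_I_finite) auto
    have "emeasure (distr iid iidM (\<lambda>z i. \<xi> (z i))) (prod_emb UNIV (\<lambda>_. M) J (Pi\<^sub>E J F))
      = emeasure iid {z\<in>space iid. \<forall>j\<in>J. z j \<in> ?A j}"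
      using mF
      by (subst emeasure_distr)
        (auto simp: prod_emb_def space_PiM PiE_iff intro!: arg_cong2[where f = emeasure] intro: measurable_space[OF meas_\<xi>])
    also have "\<dots> = (\<Prod>j\<in>J. emeasure N (?A j))"
      using J F by (intro PN.emeasure_PiM_Collect) (auto intro: measurable_sets[OF meas_\<xi>])
    also have "\<dots> = (\<Prod>j\<in>J. emeasure M (F j))"
    proof (rule prod.cong[OF refl])
      fix j assume "j \<in> J"
      then have "emeasure (distr N M \<xi>) (F j) = emeasure N (?A j)" using F by (intro emeasure_distr) auto
      then show "emeasure N (?A j) = emeasure M (F j)" by (simp add: distr_\<xi>)
    qed
    finally show "emeasure (distr iid iidM (\<lambda>z i. \<xi> (z i))) (prod_emb UNIV (\<lambda>_. M) J (Pi\<^sub>E J F))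
      = (\<Prod>j\<in>J. emeasure M (F j))" .
  qed simp
qed

lemma meas_\<xi>_seq [measurable]:
  "(\<lambda>z i. \<xi> (z i)) \<in> measurable iid iidM"
  by (rule measurable_PiM_single') (auto simp: space_PiM intro: measurable_space[OF meas_\<xi>])

text \<open>A function of the points and a fixed labelling; no sampled label enters. This permits
  the transfer of statements from \<open>iid\<close> to \<open>iidM\<close>.\<close>

definition fit :: "real \<Rightarrow> nat \<Rightarrow> (nat \<Rightarrow> 'a) \<Rightarrow> (nat \<Rightarrow> nat) \<Rightarrow> real" where
  "fit \<rho> n x \<pi> = l1_norm n (\<lambda>u v. trunc_sample W \<rho> x u v - B (\<pi> u) (\<pi> v))"

lemma meas_W [measurable]: "(\<lambda>x. W (fst x) (snd x)) \<in> borel_measurable (M \<Otimes>\<^sub>M M)"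
  using graphon by (simp add: graphon_def case_prod_unfold)

lemma meas_fit [measurable]: "(\<lambda>x. fit \<rho> n x \<pi>) \<in> borel_measurable iidM"
proof -
  have "(\<lambda>x. trunc_sample W \<rho> x u v) \<in> borel_measurable iidM" for u v
  proof (cases "u = v")
    case False
    have "(\<lambda>x. W (x u) (x v)) \<in> borel_measurable iidM"
      using measurable_compose[OF _ meas_W, of "\<lambda>x. (x u, x v)"] by simp
    then show ?thesis using False by (simp add: trunc_sample_def)
  qed (simp add: trunc_sample_def)
  then show ?thesis unfolding fit_def l1_norm_def by measurable
qed

lemma meas_ex_fit:
  "{x\<in>space iidM. \<exists>\<pi>\<in>good_labels n. fit \<rho> n x \<pi> \<le> c} \<in> sets iidM"
proof -
  have "{x\<in>space iidM. \<exists>\<pi>\<in>good_labels n. fit \<rho> n x \<pi> \<le> c}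
    = (\<Union>\<pi>\<in>good_labels n. {x\<in>space iidM. fit \<rho> n x \<pi> \<le> c})" by auto
  also have "\<dots> \<in> sets iidM"
    by (intro sets.finite_UN finite_good_labels) measurable
  finally show ?thesis .
qed

definition sample_labels :: "nat \<Rightarrow> (nat \<Rightarrow> 'c) \<Rightarrow> nat \<Rightarrow> nat" where
  "sample_labels n z = restrict (\<lambda>u. lab (z u)) {..<n}"

definition deviation :: "nat \<Rightarrow> (nat \<Rightarrow> 'c) \<Rightarrow> nat \<Rightarrow> real" where
  "deviation n z i = \<bar>real (card {u\<in>{..<n}. lab (z u) = i}) / real n - q i\<bar>"

text \<open>The correction term of \<open>good_labels_near\<close>, evaluated at the sampled
  labels.\<close>

definition relabel_error :: "nat \<Rightarrow> (nat \<Rightarrow> 'c) \<Rightarrow> real" where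
  "relabel_error n z = (\<Sum>i<k. \<Sum>j<k. B i j * ((deviation n z i + 1 / real n) * (q j + deviation n z j)
      + (q i + 1 / real n) * (deviation n z j + 1 / real n)))"

text \<open>The diagonal vanishes in the sample but not in its block approximation.\<close>
lemma ex_good_labels_fit:
  assumes z: "\<And>u. z u \<in> space N" and n: "0 < n"
  obtains \<pi> where "\<pi> \<in> good_labels n"
   "fit \<rho> n (\<lambda>i. \<xi> (z i)) \<pi> \<le>
     offdiag_sum (\<lambda>(a,b). \<bar>min (W (\<xi> a) (\<xi> b)) (1 / \<rho>) - B (lab a) (lab b)\<bar>) n z / (real n)\<^sup>2
      + (\<Sum>u<n. B (lab (z u)) (lab (z u))) / (real n)\<^sup>2 + relabel_error n z"
proof -
  let ?s = "sample_labels n z"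
  let ?H = "trunc_sample W \<rho> (\<lambda>i. \<xi> (z i))"
  have s: "?s \<in> {..<n} \<rightarrow>\<^sub>E {..<k}" using z lab_less by (auto simp: sample_labels_def)
  have cls: "cls n ?s i = {u\<in>{..<n}. lab (z u) = i}" for i by (auto simp: cls_def sample_labels_def)
  obtain \<pi> where \<pi>: "\<pi> \<in> good_labels n"
    "\<And>H. l1_norm n (\<lambda>u v. H u v - B (\<pi> u) (\<pi> v)) \<le> l1_norm n (\<lambda>u v. H u v - B (?s u) (?s v))
       + relabel_error n z"
    using good_labels_near[OF s n] unfolding relabel_error_def deviation_def cls by blast
  \<comment> \<open>On the diagonal the sample matrix is 0, so the error there is the block entry
    itself.\<close>
  have "l1_norm n (\<lambda>u v. ?H u v - B (?s u) (?s v))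
     = (\<Sum>u<n. \<Sum>v<n. (if u \<noteq> v then \<bar>min (W (\<xi> (z u)) (\<xi> (z v))) (1 / \<rho>) - B (lab (z u)) (lab (z v))\<bar> else 0)
          + (if v = u then B (lab (z u)) (lab (z u)) else 0)) / (real n)\<^sup>2"
    unfolding l1_norm_def
    using z lab_less B_nonneg
    by (intro arg_cong2[where f = "(/)"] sum.cong refl) (auto simp: sample_labels_def trunc_sample_def)
  also have "\<dots> = offdiag_sum (\<lambda>(a,b). \<bar>min (W (\<xi> a) (\<xi> b)) (1 / \<rho>) - B (lab a) (lab b)\<bar>) n z / (real n)\<^sup>2
      + (\<Sum>u<n. B (lab (z u)) (lab (z u))) / (real n)\<^sup>2"
    by (simp add: sum.distrib offdiag_sum_def add_divide_distrib cong: if_cong)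
  finally show ?thesis using \<pi>(2)[of ?H] by (intro that[OF \<pi>(1)]) (simp add: fit_def)
qed

end

lemma (in prob_space) offdiag_sum_expectation:
  assumes F: "integrable (M \<Otimes>\<^sub>M M) F"
  shows "integrable iid (offdiag_sum F n)"
    and "(\<integral>z. offdiag_sum F n z \<partial>iid) = real n * (real n - 1) * (\<integral>x. F x \<partial>(M \<Otimes>\<^sub>M M))"
proof -
  have io: "integrable iid (\<lambda>z. if u \<noteq> v then F (z u, z v) else 0)" for u v
    using iid_pair_integral(1)[OF F, of u v] by (cases "u = v") auto
  show "integrable iid (offdiag_sum F n)"
    unfolding offdiag_sum_def by (intro Bochner_Integration.integrable_sum io)
  have "(\<integral>z. offdiag_sum F n z \<partial>iid) = (\<Sum>u<n. \<Sum>v<n. \<integral>z. (if u \<noteq> v then F (z u, z v) else 0) \<partial>iid)"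
    unfolding offdiag_sum_def
    by (subst Bochner_Integration.integral_sum, intro Bochner_Integration.integrable_sum io,
        intro sum.cong refl Bochner_Integration.integral_sum io)
  also have "\<dots> = (\<Sum>u<n. \<Sum>v<n. if v \<noteq> u then (\<integral>x. F x \<partial>(M \<Otimes>\<^sub>M M)) else 0)"
    using iid_pair_integral(2)[OF F] by (intro sum.cong refl) auto
  also have "\<dots> = (\<Sum>u<n. (real n - 1) * (\<integral>x. F x \<partial>(M \<Otimes>\<^sub>M M)))"
  proof (intro sum.cong refl)
    fix u assume "u \<in> {..<n}"
    have "(\<Sum>v<n. if v \<noteq> u then (\<integral>x. F x \<partial>(M \<Otimes>\<^sub>M M)) else 0) = (\<Sum>v\<in>{..<n} - {u}. (\<integral>x. F x \<partial>(M \<Otimes>\<^sub>M M)))"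
      by (intro sum.mono_neutral_cong_right) auto
    then show "(\<Sum>v<n. if v \<noteq> u then (\<integral>x. F x \<partial>(M \<Otimes>\<^sub>M M)) else 0) = (real n - 1) * (\<integral>x. F x \<partial>(M \<Otimes>\<^sub>M M))"
      using \<open>u \<in> {..<n}\<close> by (simp add: of_nat_diff)
  qed
  finally show "(\<integral>z. offdiag_sum F n z \<partial>iid) = real n * (real n - 1) * (\<integral>x. F x \<partial>(M \<Otimes>\<^sub>M M))" by simp
qed

section \<open>Almost sure and expected quality of the best fit\<close>

context block_coupling
begin

definition tail_fun :: "real \<Rightarrow> 'a \<times> 'a \<Rightarrow> real" where
  "tail_fun c x = \<bar>W (fst x) (snd x) - min (W (fst x) (snd x)) c\<bar>"

lemma integrable_W_M: "integrable (M \<Otimes>\<^sub>M M) (\<lambda>x. W (fst x) (snd x))"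
  using graphon by (simp add: graphon_def case_prod_unfold)

lemma W_nonneg: "x \<in> space M \<Longrightarrow> y \<in> space M \<Longrightarrow> 0 \<le> W x y"
  and W_sym: "x \<in> space M \<Longrightarrow> y \<in> space M \<Longrightarrow> W x y = W y x"
  using graphon by (auto simp: graphon_def)

lemma tail_fun_integrable:
  assumes "0 \<le> c"
  shows "integrable (M \<Otimes>\<^sub>M M) (tail_fun c)"
proof (rule Bochner_Integration.integrable_bound[OF integrable_W_M])
  show "tail_fun c \<in> borel_measurable (M \<Otimes>\<^sub>M M)" unfolding tail_fun_def by measurable
  show "AE x in M \<Otimes>\<^sub>M M. norm (tail_fun c x) \<le> norm (W (fst x) (snd x))"
    using assms W_nonneg by (intro AE_I2) (auto simp: tail_fun_def space_pair_measure min_def)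
qed

lemma tail_fun_N:
  assumes "0 \<le> c"
  shows "integrable (N \<Otimes>\<^sub>M N) (\<lambda>z. tail_fun c (\<xi> (fst z), \<xi> (snd z)))"
    and "(\<integral>z. tail_fun c (\<xi> (fst z), \<xi> (snd z)) \<partial>(N \<Otimes>\<^sub>M N)) = (\<integral>x. tail_fun c x \<partial>(M \<Otimes>\<^sub>M M))"
  using integrable_pair_comp[OF prob_space_axioms meas_\<xi> distr_\<xi>, of "\<lambda>a b. tail_fun c (a, b)"] tail_fun_integrable[OF assms]
  by (auto simp: case_prod_unfold)

lemma tail_fun_small:
  assumes "0 < \<delta>"
  obtains c where "0 \<le> c" "(\<integral>x. tail_fun c x \<partial>(M \<Otimes>\<^sub>M M)) < \<delta>"
proof -
  have "(\<lambda>m. \<integral>x. tail_fun (real m) x \<partial>(M \<Otimes>\<^sub>M M)) \<longlonglongrightarrow> (\<integral>x. 0 \<partial>(M \<Otimes>\<^sub>M M))"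
  proof (rule integral_dominated_convergence[OF _ _ integrable_W_M])
    show "AE x in M \<Otimes>\<^sub>M M. (\<lambda>m. tail_fun (real m) x) \<longlonglongrightarrow> 0"
    proof (rule AE_I2, rule tendsto_eventually)
      fix x
      obtain m0 where "W (fst x) (snd x) \<le> real m0" using real_arch_simple by blast
      then show "eventually (\<lambda>m. tail_fun (real m) x = 0) sequentially"
        by (intro eventually_sequentiallyI[of m0]) (auto simp: tail_fun_def)
    qed
    show "AE x in M \<Otimes>\<^sub>M M. norm (tail_fun (real m) x) \<le> W (fst x) (snd x)" for m
      using W_nonneg by (intro AE_I2) (auto simp: tail_fun_def space_pair_measure min_def)
  qed (use tail_fun_integrable in auto)
  then have "eventually (\<lambda>m. (\<integral>x. tail_fun (real m) x \<partial>(M \<Otimes>\<^sub>M M)) < \<delta>) sequentially"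
    using assms by (intro order_tendstoD(2)[of _ 0]) auto
  then obtain m where "(\<integral>x. tail_fun (real m) x \<partial>(M \<Otimes>\<^sub>M M)) < \<delta>" by (auto simp: eventually_sequentially)
  then show ?thesis by (intro that[of "real m"]) auto
qed

definition misfit :: "real \<Rightarrow> 'c \<times> 'c \<Rightarrow> real" where
  "misfit \<rho> = (\<lambda>(a,b). \<bar>min (W (\<xi> a) (\<xi> b)) (1 / \<rho>) - B (lab a) (lab b)\<bar>)"

lemma misfit_le:
  "misfit \<rho> z \<le> \<bar>B (lab (fst z)) (lab (snd z)) - W (\<xi> (fst z)) (\<xi> (snd z))\<bar> + tail_fun (1 / \<rho>) (\<xi> (fst z), \<xi> (snd z))"
  by (auto simp: misfit_def tail_fun_def case_prod_unfold)

text \<open>The hypothesis is proved with labels at hand on \<open>N\<close>, the conclusion speaks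
  of points only; this works for properties that depend on the points alone.\<close>

lemma AE_iid_transfer:
  assumes m: "{x\<in>space iidM. P x} \<in> sets iidM" and "AE z in iid. P (\<lambda>i. \<xi> (z i))"
  shows "AE x in iidM. P x"
proof -
  have "AE x in distr iid iidM (\<lambda>z i. \<xi> (z i)). P x"
    using assms by (subst AE_distr_iff) auto
  then show ?thesis unfolding distr_iid_\<xi> .
qed

lemma B_le_B_tot: "i < k \<Longrightarrow> j < k \<Longrightarrow> B i j \<le> B_tot"
proof -
  assume ij: "i < k" "j < k"
  have "B i j \<le> (\<Sum>j<k. B i j)" using ij B_nonneg by (intro member_le_sum) auto
  also have "\<dots> \<le> B_tot" unfolding B_tot_def using ij B_nonneg by (intro member_le_sum[of i _ "\<lambda>i. \<Sum>j<k. B i j"]) (auto intro: sum_nonneg)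
  finally show ?thesis .
qed

lemma relabel_error_tendsto:
  "AE z in iid. (\<lambda>n. relabel_error n z) \<longlonglongrightarrow> 0"
proof -
  have "AE z in iid. \<forall>i. (\<lambda>n. real (card {u\<in>{..<n}. z u \<in> {x\<in>space N. lab x = i}}) / real n) \<longlonglongrightarrow> q i"
    unfolding AE_all_countable q_def by (intro allI frequency_converges) measurable
  then show ?thesis using AE_space
  proof eventually_elim
    case (elim z)
    have zs: "z u \<in> space N" for u using elim(2) by (auto simp: space_PiM)
    have "(\<lambda>n. deviation n z i) \<longlonglongrightarrow> \<bar>q i - q i\<bar>" for i
      unfolding deviation_def using elim(1)[rule_format, of i] zs by (intro tendsto_intros) simp
    then have d: "(\<lambda>n. deviation n z i) \<longlonglongrightarrow> 0" for i by simp
    have "(\<lambda>n. relabel_error n z) \<longlonglongrightarrow> (\<Sum>i<k. \<Sum>j<k. B i j * ((0 + 0) * (q j + 0) + (q i + 0) * (0 + 0)))"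
      unfolding relabel_error_def by (intro tendsto_intros d lim_1_over_n)
    then show ?case by simp
  qed
qed

text \<open>The budget is \<delta> / 2 for the pair average (truncation and strong law), \<delta> /
  4 for the diagonal and \<delta> / 4 for the relabelling.\<close>

lemma ex_fit_AE:
  assumes \<rho>: "\<rho> \<longlonglongrightarrow> 0" "\<And>n. n \<ge> 2 \<Longrightarrow> 0 < \<rho> n" and \<delta>: "0 < \<delta>"
  shows "AE x in iidM. eventually (\<lambda>n. \<exists>\<pi>\<in>good_labels n. fit (\<rho> n) n x \<pi> \<le> err + \<delta>) sequentially"
proof (rule AE_iid_transfer)
  have [measurable]: "Measurable.pred iidM (\<lambda>x. \<exists>\<pi>\<in>good_labels n. fit r n x \<pi> \<le> c)" for n r c
    using meas_ex_fit by (simp add: pred_def)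
  show "{x\<in>space iidM. eventually (\<lambda>n. \<exists>\<pi>\<in>good_labels n. fit (\<rho> n) n x \<pi> \<le> err + \<delta>) sequentially} \<in> sets iidM"
    unfolding eventually_sequentially by measurable
  \<comment> \<open>The truncation level 1 / \<rho> varies with n, but the strong law needs one
    kernel. A fixed level \<open>c\<close> gives a kernel that dominates the misfit as soon as c
    \<le> 1 / \<rho>.\<close>
  obtain c where c: "0 \<le> c" "(\<integral>x. tail_fun c x \<partial>(M \<Otimes>\<^sub>M M)) < \<delta> / 4" by (rule tail_fun_small[of "\<delta> / 4"]) (use \<delta> in auto)
  define F where "F z = \<bar>B (lab (fst z)) (lab (snd z)) - W (\<xi> (fst z)) (\<xi> (snd z))\<bar> + tail_fun c (\<xi> (fst z), \<xi> (snd z))" for z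
  have iF: "integrable (N \<Otimes>\<^sub>M N) F" unfolding F_def using c by (intro Bochner_Integration.integrable_add integrable_diff tail_fun_N)
  have eF: "(\<integral>z. F z \<partial>(N \<Otimes>\<^sub>M N)) < err + \<delta> / 4"
    unfolding F_def using c by (subst Bochner_Integration.integral_add[OF integrable_diff tail_fun_N(1)]) (auto simp: tail_fun_N(2) err_def)
  have "(\<lambda>n. c * \<rho> n) \<longlonglongrightarrow> c * 0" by (intro tendsto_intros \<rho>)
  then have "eventually (\<lambda>n. c * \<rho> n < 1) sequentially"
    by (rule order_tendstoD(2)) simp
  then have ev1: "eventually (\<lambda>n. 2 \<le> n \<and> c \<le> 1 / \<rho> n) sequentially"
    using eventually_ge_at_top[of 2]
  proof eventually_elim
    case (elim n)
    then show ?case using \<rho>(2)[of n] by (simp add: field_simps)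
  qed
  have "(\<lambda>n. B_tot * (1 / real n)) \<longlonglongrightarrow> B_tot * 0" by (intro tendsto_intros lim_1_over_n)
  then have ev2: "eventually (\<lambda>n. B_tot * (1 / real n) < \<delta> / 4) sequentially"
    using \<delta> by (intro order_tendstoD(2)) auto
  have "AE z in iid. eventually (\<lambda>n. offdiag_sum F n z \<le> ((\<integral>x. F x \<partial>(N \<Otimes>\<^sub>M N)) + \<delta> / 4) * (real n)\<^sup>2) sequentially"
    by (rule offdiag_sum_eventually_le[OF iF]) (use \<delta> in auto)
  then show "AE z in iid. eventually (\<lambda>n. \<exists>\<pi>\<in>good_labels n. fit (\<rho> n) n (\<lambda>i. \<xi> (z i)) \<pi> \<le> err + \<delta>) sequentially"
    using relabel_error_tendsto AE_space
  proof eventually_elim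
    case (elim z)
    have zs: "z u \<in> space N" for u using elim(3) by (auto simp: space_PiM)
    have "eventually (\<lambda>n. relabel_error n z < \<delta> / 4) sequentially"
      using elim(2) \<delta> by (intro order_tendstoD(2)) auto
    with elim(1) ev1 ev2 show ?case
    proof eventually_elim
      case (elim n)
      have n: "0 < n" using elim by auto
      have "c \<le> 1 / \<rho> n" using elim by auto
      then have mF: "misfit (\<rho> n) w \<le> F w" for w
        using misfit_le[of "\<rho> n" w] by (auto simp: F_def tail_fun_def min_def split: if_splits)
      obtain \<pi> where \<pi>: "\<pi> \<in> good_labels n" "fit (\<rho> n) n (\<lambda>i. \<xi> (z i)) \<pi> \<le>
         offdiag_sum (misfit (\<rho> n)) n z / (real n)\<^sup>2 + (\<Sum>u<n. B (lab (z u)) (lab (z u))) / (real n)\<^sup>2 + relabel_error n z"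
        unfolding misfit_def by (rule ex_good_labels_fit[OF zs n])
      have "offdiag_sum (misfit (\<rho> n)) n z \<le> offdiag_sum F n z"
        by (rule offdiag_sum_mono) (rule mF)
      also have "\<dots> \<le> ((\<integral>x. F x \<partial>(N \<Otimes>\<^sub>M N)) + \<delta> / 4) * (real n)\<^sup>2" by (rule elim)
      also have "\<dots> \<le> (err + \<delta> / 2) * (real n)\<^sup>2" using eF by (intro mult_right_mono) auto
      finally have 1: "offdiag_sum (misfit (\<rho> n)) n z / (real n)\<^sup>2 \<le> err + \<delta> / 2" using n by (simp add: field_simps)
      have "(\<Sum>u<n. B (lab (z u)) (lab (z u))) \<le> (\<Sum>u<n. B_tot)"
        using lab_less zs by (intro sum_mono B_le_B_tot) auto
      then have "(\<Sum>u<n. B (lab (z u)) (lab (z u))) / (real n)\<^sup>2 \<le> real n * B_tot / (real n)\<^sup>2"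
        by (intro divide_right_mono) auto
      also have "\<dots> = B_tot * (1 / real n)" by (simp add: power2_eq_square)
      finally have 2: "(\<Sum>u<n. B (lab (z u)) (lab (z u))) / (real n)\<^sup>2 \<le> \<delta> / 4" using elim by linarith
      have "fit (\<rho> n) n (\<lambda>i. \<xi> (z i)) \<pi> \<le> err + \<delta>" using \<pi>(2) 1 2 elim by linarith
      then show ?case using \<pi>(1) by blast
    qed
  qed
qed

lemma lab_expectation:
  fixes h :: "nat \<Rightarrow> real"
  shows "integrable iid (\<lambda>z. h (lab (z u)))" and "(\<integral>z. h (lab (z u)) \<partial>iid) = (\<Sum>i<k. q i * h i)"
proof -
  \<comment> \<open>A function of one label is treated as a pair kernel that ignores its second
    argument.\<close>
  note i = iid_pair_integral[OF integrable_lab(1)[of "\<lambda>i j. h i"], of u "Suc u"]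
  show "integrable iid (\<lambda>z. h (lab (z u)))" using i(1) by simp
  have "(\<integral>z. h (lab (z u)) \<partial>iid) = (\<Sum>i<k. \<Sum>j<k. q i * q j * h i)"
    using i(2) integrable_lab(2)[of "\<lambda>i j. h i"] by simp
  also have "\<dots> = (\<Sum>i<k. q i * h i)"
    by (intro sum.cong refl) (simp add: sum_q sum_distrib_left[symmetric] sum_distrib_right[symmetric])
  finally show "(\<integral>z. h (lab (z u)) \<partial>iid) = (\<Sum>i<k. q i * h i)" .
qed

text \<open>The variance of a frequency. The centred indicators \<open>g\<close> make the
  off-diagonal kernel integrate to 0, and the diagonal contributes q (1 - q) / n.\<close>

lemma deviation_second_moment:
  assumes i: "i < k" and n: "0 < n"
  shows "integrable iid (\<lambda>z. (deviation n z i)\<^sup>2)" and "(\<integral>z. (deviation n z i)\<^sup>2 \<partial>iid) \<le> q i / real n"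
proof -
  define g where "g j = (if j = i then 1 else 0) - q i" for j
  define F where "F z = g (lab (fst z)) * g (lab (snd z))" for z
  have sg: "(\<Sum>j<k. q j * g j) = 0"
    using i sum_q by (simp add: g_def right_diff_distrib sum_subtractf sum_distrib_right[symmetric] mult_delta_right)
  have iF: "integrable (N \<Otimes>\<^sub>M N) F" unfolding F_def by (rule integrable_lab(1)[of "\<lambda>a b. g a * g b"])
  have "(\<integral>z. F z \<partial>(N \<Otimes>\<^sub>M N)) = (\<Sum>a<k. \<Sum>b<k. (q a * g a) * (q b * g b))"
    unfolding F_def integrable_lab(2)[of "\<lambda>a b. g a * g b"] by (simp add: mult_ac)
  also have "\<dots> = 0" by (simp add: sum_product[symmetric] sg)
  finally have F0: "(\<integral>z. F z \<partial>(N \<Otimes>\<^sub>M N)) = 0" .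
  have eq: "(deviation n z i)\<^sup>2 = (offdiag_sum F n z + (\<Sum>u<n. (g (lab (z u)))\<^sup>2)) / (real n)\<^sup>2" for z
  proof -
    have "(\<Sum>u<n. g (lab (z u))) = real (card {u\<in>{..<n}. lab (z u) = i}) - real n * q i"
      unfolding g_def sum_subtractf by (subst sum.inter_filter[symmetric]) auto
    then have "deviation n z i = \<bar>(\<Sum>u<n. g (lab (z u))) / real n\<bar>"
      using n by (simp add: deviation_def diff_divide_distrib)
    then have "(deviation n z i)\<^sup>2 = (\<Sum>u<n. g (lab (z u)))\<^sup>2 / (real n)\<^sup>2" by (simp add: power_divide)
    also have "(\<Sum>u<n. g (lab (z u)))\<^sup>2 = (\<Sum>u<n. \<Sum>v<n. (if u \<noteq> v then F (z u, z v) else 0) + (if v = u then (g (lab (z u)))\<^sup>2 else 0))"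
      unfolding power2_eq_square sum_product F_def by (intro sum.cong refl) auto
    also have "\<dots> = offdiag_sum F n z + (\<Sum>u<n. (g (lab (z u)))\<^sup>2)"
      by (simp add: sum.distrib offdiag_sum_def)
    finally show ?thesis .
  qed
  note ig = lab_expectation(1)[of "\<lambda>j. (g j)\<^sup>2"]
  show "integrable iid (\<lambda>z. (deviation n z i)\<^sup>2)"
    unfolding eq by (intro Bochner_Integration.integrable_divide Bochner_Integration.integrable_add offdiag_sum_expectation(1)[OF iF] Bochner_Integration.integrable_sum ig)
  have "(\<integral>z. (deviation n z i)\<^sup>2 \<partial>iid) = ((\<integral>z. offdiag_sum F n z \<partial>iid) + (\<integral>z. (\<Sum>u<n. (g (lab (z u)))\<^sup>2) \<partial>iid)) / (real n)\<^sup>2"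
    unfolding eq by (simp add: Bochner_Integration.integral_add[OF offdiag_sum_expectation(1)[OF iF] Bochner_Integration.integrable_sum[OF ig]])
  also have "(\<integral>z. (\<Sum>u<n. (g (lab (z u)))\<^sup>2) \<partial>iid) = (\<Sum>u<n. \<integral>z. (g (lab (z u)))\<^sup>2 \<partial>iid)"
    by (intro Bochner_Integration.integral_sum ig)
  also have "\<dots> = real n * (\<Sum>j<k. q j * (g j)\<^sup>2)" using lab_expectation(2)[of "\<lambda>j. (g j)\<^sup>2"] by simp
  also have "(\<Sum>j<k. q j * (g j)\<^sup>2) \<le> q i"
  proof -
    have "(\<Sum>j<k. q j * (g j)\<^sup>2) = (\<Sum>j<k. (if j = i then q i * (1 - 2 * q i) else 0) + q j * (q i)\<^sup>2)"
      by (intro sum.cong refl) (auto simp: g_def power2_eq_square algebra_simps)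
    also have "\<dots> = q i * (1 - 2 * q i) + (q i)\<^sup>2"
      using i by (simp add: sum.distrib sum_distrib_right[symmetric] sum_q)
    also have "\<dots> = q i - (q i)\<^sup>2" by (simp add: power2_eq_square algebra_simps)
    finally show ?thesis by simp
  qed
  also have "((\<integral>z. offdiag_sum F n z \<partial>iid) + real n * q i) / (real n)\<^sup>2 = q i / real n"
    using n by (simp add: offdiag_sum_expectation(2)[OF iF] F0 power2_eq_square)
  finally show "(\<integral>z. (deviation n z i)\<^sup>2 \<partial>iid) \<le> q i / real n"
    using n by (simp add: divide_right_mono)
qed

definition B_norm :: real where
  "B_norm = (\<Sum>i<k. \<Sum>j<k. q i * q j * B i j)"

lemma B_norm_nonneg: "0 \<le> B_norm"
  unfolding B_norm_def by (intro sum_nonneg mult_nonneg_nonneg q_nonneg B_nonneg) auto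

lemma err_nonneg: "0 \<le> err"
  unfolding err_def by (intro integral_nonneg_AE) auto

text \<open>With \<open>W\<close> of norm 1 this makes every later multiple of \<open>B_norm\<close>
  a constant plus \<open>err\<close>, independently of the number and size of the blocks.\<close>

lemma B_norm_le: "B_norm \<le> (\<integral>x. W (fst x) (snd x) \<partial>(M \<Otimes>\<^sub>M M)) + err"
proof -
  have "B_norm = (\<integral>z. B (lab (fst z)) (lab (snd z)) \<partial>(N \<Otimes>\<^sub>M N))"
    unfolding B_norm_def integrable_lab(2) ..
  also have "\<dots> \<le> (\<integral>z. W (\<xi> (fst z)) (\<xi> (snd z)) + \<bar>B (lab (fst z)) (lab (snd z)) - W (\<xi> (fst z)) (\<xi> (snd z))\<bar> \<partial>(N \<Otimes>\<^sub>M N))"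
    by (intro integral_mono integrable_lab(1) Bochner_Integration.integrable_add integrable_W(1) integrable_diff) auto
  also have "\<dots> = (\<integral>x. W (fst x) (snd x) \<partial>(M \<Otimes>\<^sub>M M)) + err"
    by (subst Bochner_Integration.integral_add[OF integrable_W(1) integrable_diff]) (simp add: integrable_W(2) err_def)
  finally show ?thesis .
qed

text \<open>Deviation relative to the weight, scaled by s = sqrt(n \<kappa>) so that its second
  moment s^2 / (n q) = \<kappa> / q is at most 1.\<close>

definition rel_dev :: "real \<Rightarrow> nat \<Rightarrow> (nat \<Rightarrow> 'c) \<Rightarrow> nat \<Rightarrow> real" where
  "rel_dev s n z i = deviation n z i * (s / q i)"

text \<open>Every factor is compared with the weight of its block, so that each summand carries
  \<open>q i * q j * B i j / s\<close>. Taking expectations then gives 1 + 2 + 5 = 8 times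
  \<open>B_norm / s\<close>.\<close>

lemma relabel_error_le:
  assumes \<kappa>: "0 < \<kappa>" "\<And>i. i < k \<Longrightarrow> \<kappa> \<le> q i" and n: "1 \<le> real n * \<kappa>"
  defines "s \<equiv> sqrt (real n * \<kappa>)"
  shows "relabel_error n z \<le> (\<Sum>i<k. \<Sum>j<k. q i * q j * B i j / s * ((rel_dev s n z i)\<^sup>2 + 2 * (rel_dev s n z j)\<^sup>2 + 5))"
  unfolding relabel_error_def
proof (intro sum_mono)
  fix i j assume "i \<in> {..<k}" "j \<in> {..<k}"
  then have ij: "i < k" "j < k" by auto
  define d where "d = rel_dev s n z i"
  define e where "e = rel_dev s n z j"
  define r where "r = 1 / s"
  have s1: "1 \<le> s" using n by (simp add: s_def)
  have s2: "s\<^sup>2 = real n * \<kappa>" using n by (simp add: s_def)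
  have r: "0 < r" "r \<le> 1" using s1 by (auto simp: r_def)
  have rr: "r\<^sup>2 \<le> r" using r by (simp add: power2_eq_square mult_left_le)
  have n0: "0 < real n" using n \<kappa> by (cases n) auto
  have qp: "0 < q i" "0 < q j" using \<kappa> ij by (meson less_le_trans)+
  have dv: "deviation n z i = q i * (d * r)" "deviation n z j = q j * (e * r)"
    using qp s1 by (auto simp: d_def e_def r_def rel_dev_def)
  have de: "0 \<le> d" "0 \<le> e"
    using qp s1 by (auto simp: d_def e_def rel_dev_def deviation_def)
  \<comment> \<open>The rounding error 1/n equals \<kappa> / s^2 and is therefore small even
    relative to the lightest block.\<close>
  have nq: "1 / real n \<le> q l * r\<^sup>2" if "l < k" for l
  proof -
    have "1 / real n = \<kappa> * r\<^sup>2" using \<kappa>(1) n0 by (simp add: r_def power_divide s2)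
    also have "\<dots> \<le> q l * r\<^sup>2" using \<kappa>(2)[OF that] by (intro mult_right_mono) auto
    finally show ?thesis .
  qed
  have a1: "deviation n z i + 1 / real n \<le> q i * (r * (d + 1))"
  proof -
    have "deviation n z i + 1 / real n \<le> q i * (d * r) + q i * r\<^sup>2" using nq[OF ij(1)] dv by simp
    also have "\<dots> \<le> q i * (d * r) + q i * r" using mult_left_mono[OF rr, of "q i"] qp by simp
    finally show ?thesis by (simp add: algebra_simps)
  qed
  have a2: "q j + deviation n z j \<le> q j * (1 + e)"
  proof -
    have "q j * (e * r) \<le> q j * (e * 1)" using qp de r by (intro mult_left_mono) auto
    then show ?thesis using dv by (simp add: algebra_simps)
  qed
  have a3: "q i + 1 / real n \<le> q i * 2"
  proof -
    have "q i * r\<^sup>2 \<le> q i * 1" using qp rr r by (intro mult_left_mono) auto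
    then show ?thesis using nq[OF ij(1)] by linarith
  qed
  have a4: "deviation n z j + 1 / real n \<le> q j * (r * (e + 1))"
  proof -
    have "deviation n z j + 1 / real n \<le> q j * (e * r) + q j * r\<^sup>2" using nq[OF ij(2)] dv by simp
    also have "\<dots> \<le> q j * (e * r) + q j * r" using mult_left_mono[OF rr, of "q j"] qp by simp
    finally show ?thesis by (simp add: algebra_simps)
  qed
  have dn: "0 \<le> deviation n z l" for l by (simp add: deviation_def)
  have "(deviation n z i + 1 / real n) * (q j + deviation n z j) + (q i + 1 / real n) * (deviation n z j + 1 / real n)
     \<le> q i * (r * (d + 1)) * (q j * (1 + e)) + q i * 2 * (q j * (r * (e + 1)))"
    using a1 a2 a3 a4 dn qp de r n0 by (intro add_mono mult_mono) auto
  also have "\<dots> = q i * q j * r * ((d + 1) * (1 + e) + 2 * (e + 1))" by (simp add: algebra_simps)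
  also have "\<dots> \<le> q i * q j * r * (d\<^sup>2 + 2 * e\<^sup>2 + 5)"
  proof (rule mult_left_mono)
    \<comment> \<open>Half of this sum of squares is the difference of the two sides.\<close>
    have "0 \<le> (d - e)\<^sup>2 + (d - 1)\<^sup>2 + 3 * (e - 1)\<^sup>2" by simp
    then show "(d + 1) * (1 + e) + 2 * (e + 1) \<le> d\<^sup>2 + 2 * e\<^sup>2 + 5"
      by (simp add: power2_eq_square algebra_simps)
  qed (use qp r in auto)
  finally have "B i j * ((deviation n z i + 1 / real n) * (q j + deviation n z j) + (q i + 1 / real n) * (deviation n z j + 1 / real n))
     \<le> B i j * (q i * q j * r * (d\<^sup>2 + 2 * e\<^sup>2 + 5))"
    using B_nonneg[OF ij] by (rule mult_left_mono)
  then show "B i j * ((deviation n z i + 1 / real n) * (q j + deviation n z j) + (q i + 1 / real n) * (deviation n z j + 1 / real n))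
     \<le> q i * q j * B i j / s * ((rel_dev s n z i)\<^sup>2 + 2 * (rel_dev s n z j)\<^sup>2 + 5)"
    by (simp add: d_def e_def r_def mult_ac)
qed

lemma rel_dev_moment:
  assumes \<kappa>: "0 < \<kappa>" "\<And>i. i < k \<Longrightarrow> \<kappa> \<le> q i" and n: "1 \<le> real n * \<kappa>" and i: "i < k"
  defines "s \<equiv> sqrt (real n * \<kappa>)"
  shows "integrable iid (\<lambda>z. (rel_dev s n z i)\<^sup>2)" "(\<integral>z. (rel_dev s n z i)\<^sup>2 \<partial>iid) \<le> 1"
proof -
  have n0: "0 < n" using n \<kappa> by (cases n) auto
  have s2: "s\<^sup>2 = real n * \<kappa>" using n by (simp add: s_def)
  have qi: "\<kappa> \<le> q i" "0 < q i" using \<kappa> i by (auto intro: less_le_trans)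
  have eq: "(rel_dev s n z i)\<^sup>2 = (deviation n z i)\<^sup>2 * (s / q i)\<^sup>2" for z
    unfolding rel_dev_def by (rule power_mult_distrib)
  note m = deviation_second_moment[OF i n0]
  show "integrable iid (\<lambda>z. (rel_dev s n z i)\<^sup>2)" unfolding eq using m(1) by simp
  have "(\<integral>z. (rel_dev s n z i)\<^sup>2 \<partial>iid) = (\<integral>z. (deviation n z i)\<^sup>2 \<partial>iid) * (s / q i)\<^sup>2"
    unfolding eq by simp
  also have "\<dots> \<le> q i / real n * (s / q i)\<^sup>2" using m(2) by (intro mult_right_mono) auto
  also have "\<dots> = q i / real n * (real n * \<kappa> / (q i)\<^sup>2)" by (simp only: power_divide s2)
  also have "\<dots> = \<kappa> / q i" using n0 qi by (simp add: power2_eq_square)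
  also have "\<dots> \<le> 1" using qi by simp
  finally show "(\<integral>z. (rel_dev s n z i)\<^sup>2 \<partial>iid) \<le> 1" .
qed

lemma misfit_integral:
  assumes "0 < \<rho>"
  shows "integrable (N \<Otimes>\<^sub>M N) (misfit \<rho>)"
    and "(\<integral>z. misfit \<rho> z \<partial>(N \<Otimes>\<^sub>M N)) \<le> err + (\<integral>x. tail_fun (1 / \<rho>) x \<partial>(M \<Otimes>\<^sub>M M))"
proof -
  let ?G = "\<lambda>z. \<bar>B (lab (fst z)) (lab (snd z)) - W (\<xi> (fst z)) (\<xi> (snd z))\<bar> + tail_fun (1 / \<rho>) (\<xi> (fst z), \<xi> (snd z))"
  have c: "0 \<le> 1 / \<rho>" using assms by simp
  have iG: "integrable (N \<Otimes>\<^sub>M N) ?G" by (intro Bochner_Integration.integrable_add integrable_diff tail_fun_N c)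
  have [measurable]: "(\<lambda>z. W (\<xi> (fst z)) (\<xi> (snd z))) \<in> borel_measurable (N \<Otimes>\<^sub>M N)"
    "(\<lambda>z. B (lab (fst z)) (lab (snd z))) \<in> borel_measurable (N \<Otimes>\<^sub>M N)"
    using integrable_W(1) integrable_lab(1) by auto
  have m: "misfit \<rho> \<in> borel_measurable (N \<Otimes>\<^sub>M N)"
    unfolding misfit_def case_prod_unfold by measurable
  show i: "integrable (N \<Otimes>\<^sub>M N) (misfit \<rho>)"
    by (rule Bochner_Integration.integrable_bound[OF iG m], rule AE_I2)
      (use misfit_le in \<open>force simp: misfit_def tail_fun_def case_prod_unfold\<close>)
  have "(\<integral>z. misfit \<rho> z \<partial>(N \<Otimes>\<^sub>M N)) \<le> (\<integral>z. ?G z \<partial>(N \<Otimes>\<^sub>M N))"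
    by (intro integral_mono i iG misfit_le)
  also have "\<dots> = err + (\<integral>x. tail_fun (1 / \<rho>) x \<partial>(M \<Otimes>\<^sub>M M))"
    by (subst Bochner_Integration.integral_add[OF integrable_diff tail_fun_N(1)[OF c]]) (simp add: tail_fun_N(2)[OF c] err_def)
  finally show "(\<integral>z. misfit \<rho> z \<partial>(N \<Otimes>\<^sub>M N)) \<le> \<dots>" .
qed

text \<open>Markov's inequality for a bound of the fit in three parts: pair average
  \<open>R1\<close>, diagonal \<open>R2\<close>, relabelling \<open>R3\<close>. The constant 9 is 1
  from the diagonal plus 8 from the relabelling.\<close>

lemma fit_probability:
  assumes \<kappa>: "0 < \<kappa>" "\<And>i. i < k \<Longrightarrow> \<kappa> \<le> q i" and n: "1 \<le> real n * \<kappa>" and \<rho>: "0 < \<rho>" and c: "0 < c"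
  shows "measure iidM {x\<in>space iidM. \<not> (\<exists>\<pi>\<in>good_labels n. fit \<rho> n x \<pi> \<le> c)}
    \<le> (err + (\<integral>x. tail_fun (1 / \<rho>) x \<partial>(M \<Otimes>\<^sub>M M)) + 9 * B_norm / sqrt (real n * \<kappa>)) / c"
proof -
  interpret P: prob_space iid by (rule prob_space_iid)
  define s where "s = sqrt (real n * \<kappa>)"
  have n0: "0 < n" using n \<kappa> by (cases n) auto
  have s1: "1 \<le> s" using n by (simp add: s_def)
  have s2: "s\<^sup>2 = real n * \<kappa>" using n by (simp add: s_def)
  define R1 where "R1 z = offdiag_sum (misfit \<rho>) n z / (real n)\<^sup>2" for z
  define R2 where "R2 z = (\<Sum>u<n. B (lab (z u)) (lab (z u))) / (real n)\<^sup>2" for z :: "nat \<Rightarrow> 'c"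
  define R3 where "R3 z = (\<Sum>i<k. \<Sum>j<k. q i * q j * B i j / s * ((rel_dev s n z i)\<^sup>2 + 2 * (rel_dev s n z j)\<^sup>2 + 5))" for z
  note mi = misfit_integral[OF \<rho>]
  have i1: "integrable iid R1" unfolding R1_def by (intro Bochner_Integration.integrable_divide offdiag_sum_expectation(1) mi)
  note l = lab_expectation[of "\<lambda>i. B i i"]
  have i2: "integrable iid R2" unfolding R2_def by (intro Bochner_Integration.integrable_divide Bochner_Integration.integrable_sum l)
  have rd: "integrable iid (\<lambda>z. (rel_dev s n z i)\<^sup>2)" "(\<integral>z. (rel_dev s n z i)\<^sup>2 \<partial>iid) \<le> 1" if "i < k" for i
    unfolding s_def using rel_dev_moment[of \<kappa> n i] \<kappa> n that by auto
  have t3: "integrable iid (\<lambda>z. q i * q j * B i j / s * ((rel_dev s n z i)\<^sup>2 + 2 * (rel_dev s n z j)\<^sup>2 + 5))" if "i < k" "j < k" for i j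
    by (intro integrable_mult_right Bochner_Integration.integrable_add P.integrable_const rd that)
  have i3: "integrable iid R3" unfolding R3_def by (intro Bochner_Integration.integrable_sum t3) auto
  have e1: "(\<integral>z. R1 z \<partial>iid) \<le> err + (\<integral>x. tail_fun (1 / \<rho>) x \<partial>(M \<Otimes>\<^sub>M M))"
  proof -
    have m0: "0 \<le> (\<integral>z. misfit \<rho> z \<partial>(N \<Otimes>\<^sub>M N))" by (intro integral_nonneg_AE AE_I2) (simp add: misfit_def case_prod_unfold)
    have "(\<integral>z. R1 z \<partial>iid) = real n * (real n - 1) * (\<integral>z. misfit \<rho> z \<partial>(N \<Otimes>\<^sub>M N)) / (real n)\<^sup>2"
      unfolding R1_def by (simp add: offdiag_sum_expectation(2)[OF mi(1)])
    also have "\<dots> \<le> (real n)\<^sup>2 * (\<integral>z. misfit \<rho> z \<partial>(N \<Otimes>\<^sub>M N)) / (real n)\<^sup>2"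
      using m0 by (intro divide_right_mono mult_right_mono) (auto simp: power2_eq_square mult_left_mono)
    also have "\<dots> = (\<integral>z. misfit \<rho> z \<partial>(N \<Otimes>\<^sub>M N))" using n0 by simp
    finally show ?thesis using mi(2) by linarith
  qed
  have e2: "(\<integral>z. R2 z \<partial>iid) \<le> B_norm / s"
  proof -
    have "(\<integral>z. R2 z \<partial>iid) = (\<Sum>u<n. \<integral>z. B (lab (z u)) (lab (z u)) \<partial>iid) / (real n)\<^sup>2"
      unfolding R2_def by (simp add: Bochner_Integration.integral_sum[OF l(1)])
    also have "\<dots> = (\<Sum>i<k. q i * B i i) / real n" by (simp add: l(2) power2_eq_square)
    \<comment> \<open>A diagonal entry comes with only one weight; the missing factor q is bought at
      the price 1 / \<kappa>, which the factor 1/n pays for.\<close>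
    also have "\<dots> \<le> (\<Sum>i<k. q i * q i * B i i / \<kappa>) / real n"
    proof (intro divide_right_mono sum_mono)
      fix i assume "i \<in> {..<k}"
      then have i: "i < k" by simp
      have "q i * B i i * \<kappa> \<le> q i * B i i * q i" using \<kappa>(2)[OF i] q_nonneg B_nonneg[OF i i] by (intro mult_left_mono) auto
      then show "q i * B i i \<le> q i * q i * B i i / \<kappa>" using \<kappa>(1) by (simp add: field_simps)
    qed auto
    also have "\<dots> = (\<Sum>i<k. q i * q i * B i i) / s\<^sup>2" by (simp add: s2 sum_divide_distrib[symmetric] mult.commute)
    also have "\<dots> \<le> B_norm / s\<^sup>2"
      unfolding B_norm_def
    proof (intro divide_right_mono sum_mono)
      fix i assume "i \<in> {..<k}"
      then show "q i * q i * B i i \<le> (\<Sum>j<k. q i * q j * B i j)"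
        using q_nonneg B_nonneg by (intro member_le_sum[of i _ "\<lambda>j. q i * q j * B i j"]) auto
    qed auto
    also have "\<dots> \<le> B_norm / s"
      using s1 B_norm_nonneg by (intro divide_left_mono) (auto simp: power2_eq_square)
    finally show ?thesis .
  qed
  have e3: "(\<integral>z. R3 z \<partial>iid) \<le> 8 * B_norm / s"
  proof -
    have "(\<integral>z. R3 z \<partial>iid) = (\<Sum>i<k. \<Sum>j<k. \<integral>z. q i * q j * B i j / s * ((rel_dev s n z i)\<^sup>2 + 2 * (rel_dev s n z j)\<^sup>2 + 5) \<partial>iid)"
      unfolding R3_def
      by (subst Bochner_Integration.integral_sum, intro Bochner_Integration.integrable_sum t3, simp, simp,
          intro sum.cong refl Bochner_Integration.integral_sum t3, auto)
    also have "\<dots> \<le> (\<Sum>i<k. \<Sum>j<k. q i * q j * B i j / s * 8)"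
    proof (intro sum_mono)
      fix i j assume "i \<in> {..<k}" "j \<in> {..<k}"
      then have ij: "i < k" "j < k" by auto
      have "(\<integral>z. q i * q j * B i j / s * ((rel_dev s n z i)\<^sup>2 + 2 * (rel_dev s n z j)\<^sup>2 + 5) \<partial>iid)
         = q i * q j * B i j / s * ((\<integral>z. (rel_dev s n z i)\<^sup>2 \<partial>iid) + 2 * (\<integral>z. (rel_dev s n z j)\<^sup>2 \<partial>iid) + 5)"
        using rd(1)[OF ij(1)] rd(1)[OF ij(2)] by (simp add: P.prob_space)
      also have "\<dots> \<le> q i * q j * B i j / s * 8"
        using rd(2)[OF ij(1)] rd(2)[OF ij(2)] q_nonneg B_nonneg[OF ij] s1 by (intro mult_left_mono) auto
      finally show "(\<integral>z. q i * q j * B i j / s * ((rel_dev s n z i)\<^sup>2 + 2 * (rel_dev s n z j)\<^sup>2 + 5) \<partial>iid) \<le> q i * q j * B i j / s * 8" .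
    qed
    also have "\<dots> = 8 * B_norm / s"
      by (simp add: B_norm_def sum_distrib_left sum_divide_distrib mult_ac)
    finally show ?thesis .
  qed
  let ?S = "{x\<in>space iidM. \<not> (\<exists>\<pi>\<in>good_labels n. fit \<rho> n x \<pi> \<le> c)}"
  have S: "?S \<in> sets iidM"
  proof -
    have "?S = space iidM - {x\<in>space iidM. \<exists>\<pi>\<in>good_labels n. fit \<rho> n x \<pi> \<le> c}" by auto
    then show ?thesis using meas_ex_fit by auto
  qed
  have R: "integrable iid (\<lambda>z. R1 z + R2 z + R3 z)" using i1 i2 i3 by simp
  then have [measurable]: "(\<lambda>z. R1 z + R2 z + R3 z) \<in> borel_measurable iid" by auto
  have "measure iidM ?S = measure (distr iid iidM (\<lambda>z i. \<xi> (z i))) ?S" unfolding distr_iid_\<xi> ..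
  also have "\<dots> = P.prob ((\<lambda>z i. \<xi> (z i)) -` ?S \<inter> space iid)" by (rule measure_distr[OF meas_\<xi>_seq S])
  also have "\<dots> \<le> P.prob {z\<in>space iid. c \<le> R1 z + R2 z + R3 z}"
  proof (rule P.finite_measure_mono)
    show "(\<lambda>z i. \<xi> (z i)) -` ?S \<inter> space iid \<subseteq> {z\<in>space iid. c \<le> R1 z + R2 z + R3 z}"
    proof
      fix z assume z: "z \<in> (\<lambda>z i. \<xi> (z i)) -` ?S \<inter> space iid"
      then have zs: "z u \<in> space N" for u by (auto simp: space_PiM)
      obtain \<pi> where \<pi>: "\<pi> \<in> good_labels n" "fit \<rho> n (\<lambda>i. \<xi> (z i)) \<pi> \<le> R1 z + R2 z + relabel_error n z"
        unfolding misfit_def R1_def R2_def by (rule ex_good_labels_fit[OF zs n0])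
      have "c < fit \<rho> n (\<lambda>i. \<xi> (z i)) \<pi>" using z \<pi>(1) by (auto simp: not_le)
      also have "\<dots> \<le> R1 z + R2 z + R3 z"
        using \<pi>(2) relabel_error_le[OF \<kappa> n, folded s_def, of z] by (simp add: R3_def)
      finally show "z \<in> {z\<in>space iid. c \<le> R1 z + R2 z + R3 z}" using z by auto
    qed
  qed measurable
  also have "\<dots> \<le> (\<integral>z. R1 z + R2 z + R3 z \<partial>iid) / c"
  proof (rule integral_Markov_inequality_measure[OF R sets.empty_sets _ c])
    show "AE z in iid. 0 \<le> R1 z + R2 z + R3 z"
    proof (rule AE_I2)
      fix z assume "z \<in> space iid"
      then have zs: "z u \<in> space N" for u by (auto simp: space_PiM)
      have "0 \<le> R1 z" unfolding R1_def by (intro divide_nonneg_nonneg offdiag_sum_nonneg) (auto simp: misfit_def case_prod_unfold)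
      moreover have "0 \<le> R2 z" unfolding R2_def using zs lab_less B_nonneg by (intro divide_nonneg_nonneg sum_nonneg) auto
      moreover have "0 \<le> R3 z" unfolding R3_def using s1 q_nonneg B_nonneg by (intro sum_nonneg mult_nonneg_nonneg divide_nonneg_nonneg) auto
      ultimately show "0 \<le> R1 z + R2 z + R3 z" by simp
    qed
  qed
  also have "(\<integral>z. R1 z + R2 z + R3 z \<partial>iid) = (\<integral>z. R1 z \<partial>iid) + (\<integral>z. R2 z \<partial>iid) + (\<integral>z. R3 z \<partial>iid)"
    using i1 i2 i3 by simp
  also have "\<dots> \<le> err + (\<integral>x. tail_fun (1 / \<rho>) x \<partial>(M \<Otimes>\<^sub>M M)) + 9 * B_norm / s"
  proof -
    have "9 * B_norm / s = B_norm / s + 8 * B_norm / s" by (simp add: add_divide_distrib[symmetric])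
    then show ?thesis using e1 e2 e3 by linarith
  qed
  finally show ?thesis using c unfolding s_def by (simp add: divide_right_mono)
qed

end

lemma borel_measurable_cut_norm:
  assumes "\<And>u v. u < n \<Longrightarrow> v < n \<Longrightarrow> (\<lambda>x. A x u v) \<in> borel_measurable N"
  shows "(\<lambda>x. cut_norm n (A x)) \<in> borel_measurable N"
proof -
  let ?I = "Pow {..<n} \<times> Pow {..<n}"
  have "cut_norm n F = Max ((\<lambda>ST. \<bar>\<Sum>u\<in>fst ST. \<Sum>v\<in>snd ST. F u v\<bar> / (real n)\<^sup>2) ` ?I)" for F
    unfolding cut_norm_def
    by (intro arg_cong[where f = Max]) (force simp: sum.cartesian_product)
  moreover have "(\<lambda>x. Max ((\<lambda>ST. \<bar>\<Sum>u\<in>fst ST. \<Sum>v\<in>snd ST. A x u v\<bar> / (real n)\<^sup>2) ` ?I)) \<in> borel_measurable N"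
    by (intro borel_measurable_Max borel_measurable_divide borel_measurable_abs borel_measurable_sum assms)
      (auto simp: subset_iff)
  ultimately show ?thesis by simp
qed

section \<open>The random graph sequence\<close>

locale wrg = prob_space M for M :: "'a measure" +
  fixes W :: "'a \<Rightarrow> 'a \<Rightarrow> real" and \<rho> :: "nat \<Rightarrow> real" and Q :: "'q measure"
    and X :: "nat \<Rightarrow> 'q \<Rightarrow> 'a" and G :: "nat \<Rightarrow> 'q \<Rightarrow> (nat \<times> nat) set"
  assumes graphon_W: "graphon M W" and norm_W: "graphon_norm 1 M W = 1"
    and \<rho>_pos: "\<And>n. n \<ge> 2 \<Longrightarrow> 0 < \<rho> n" and \<rho>_le: "\<And>n. n \<ge> 2 \<Longrightarrow> \<rho> n \<le> 1"
    and wrg: "wrg_sequence M W \<rho> Q X G"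
begin

sublocale Q: prob_space Q using wrg by (simp add: wrg_sequence_def)

lemma W_nonneg: "x \<in> space M \<Longrightarrow> y \<in> space M \<Longrightarrow> 0 \<le> W x y"
  and W_sym: "x \<in> space M \<Longrightarrow> y \<in> space M \<Longrightarrow> W x y = W y x"
  using graphon_W by (auto simp: graphon_def)

lemma integrable_W: "integrable (M \<Otimes>\<^sub>M M) (\<lambda>x. W (fst x) (snd x))"
  using graphon_W by (simp add: graphon_def case_prod_unfold)

lemma meas_W [measurable]: "(\<lambda>x. W (fst x) (snd x)) \<in> borel_measurable (M \<Otimes>\<^sub>M M)"
  using integrable_W by auto

lemma integral_W: "(\<integral>x. W (fst x) (snd x) \<partial>(M \<Otimes>\<^sub>M M)) = 1"
proof -
  have "0 \<le> (\<integral>x. \<bar>W (fst x) (snd x)\<bar> \<partial>(M \<Otimes>\<^sub>M M))" by (intro integral_nonneg_AE) auto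
  moreover have "graphon_norm 1 M W = (\<integral>x. \<bar>W (fst x) (snd x)\<bar> powr 1 \<partial>(M \<Otimes>\<^sub>M M)) powr 1"
    by (simp add: graphon_norm_def lp_int_def case_prod_unfold)
  ultimately have "(\<integral>x. \<bar>W (fst x) (snd x)\<bar> \<partial>(M \<Otimes>\<^sub>M M)) = 1" using norm_W by (simp add: powr_one')
  moreover have "(\<integral>x. \<bar>W (fst x) (snd x)\<bar> \<partial>(M \<Otimes>\<^sub>M M)) = (\<integral>x. W (fst x) (snd x) \<partial>(M \<Otimes>\<^sub>M M))"
    using W_nonneg by (intro Bochner_Integration.integral_cong refl) (auto simp: space_pair_measure)
  ultimately show ?thesis by simp
qed

lemma meas_X [measurable]: "X i \<in> measurable Q M"
  using wrg by (simp add: wrg_sequence_def)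

lemma meas_G: "G n \<in> measurable Q (count_space UNIV)"
  using wrg by (simp add: wrg_sequence_def)

lemma meas_X_seq [measurable]: "(\<lambda>\<omega> i. X i \<omega>) \<in> measurable Q iid"
  by (rule measurable_PiM_single') (auto simp: space_PiM intro: measurable_space[OF meas_X])

lemma distr_X_seq: "distr Q iid (\<lambda>\<omega> i. X i \<omega>) = iid"
proof -
  have "Q.indep_vars (\<lambda>_. M) X UNIV" using wrg by (simp add: wrg_sequence_def)
  then have "distr Q iid (\<lambda>\<omega>. \<lambda>i\<in>UNIV. X i \<omega>) = (\<Pi>\<^sub>M i\<in>UNIV. distr Q M (X i))"
    by (subst (asm) Q.indep_vars_iff_distr_eq_PiM) auto
  moreover have "distr Q M (X i) = M" for i using wrg by (simp add: wrg_sequence_def)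
  ultimately show ?thesis by (simp add: restrict_def)
qed

lemma AE_X: "AE x in iid. P x \<Longrightarrow> AE \<omega> in Q. P (\<lambda>i. X i \<omega>)"
  using AE_distrD[OF meas_X_seq, of P] by (simp only: distr_X_seq)

lemma measure_X: "A \<in> sets iid \<Longrightarrow> Q.prob {\<omega>\<in>space Q. (\<lambda>i. X i \<omega>) \<in> A} = measure iid A"
  using measure_distr[OF meas_X_seq, of A] by (simp add: distr_X_seq vimage_def Int_def conj_commute)

abbreviation "fin_iid n \<equiv> \<Pi>\<^sub>M _\<in>{..<n::nat}. M"

lemma prob_space_fin_iid: "prob_space (fin_iid n)"
  by (intro prob_space_PiM prob_space_axioms)

lemma meas_W_fin: "i < n \<Longrightarrow> j < n \<Longrightarrow> (\<lambda>x. W (x i) (x j)) \<in> borel_measurable (fin_iid n)"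
  using measurable_compose[OF _ meas_W, of "\<lambda>x. (x i, x j)" "fin_iid n"] by simp

lemma meas_edge_prob: "e \<in> vpairs n \<Longrightarrow> (\<lambda>x. edge_prob W r x e) \<in> borel_measurable (fin_iid n)"
  unfolding edge_prob_def by (intro borel_measurable_min borel_measurable_times borel_measurable_const meas_W_fin) (auto simp: vpairs_def)

lemma wrg_prob_integrable:
  assumes n: "n \<ge> 2" and E: "E \<subseteq> vpairs n" and A: "A \<in> sets (fin_iid n)"
  shows "integrable (fin_iid n) (\<lambda>x. indicator A x * wrg_prob W (\<rho> n) n x E)"
proof -
  interpret F: prob_space "fin_iid n" by (rule prob_space_fin_iid)
  have m: "(\<lambda>x. wrg_prob W (\<rho> n) n x E) \<in> borel_measurable (fin_iid n)"
    unfolding wrg_prob_eq_bern_weight[OF E] bern_weight_def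
  proof (rule borel_measurable_prod)
    fix e assume "e \<in> vpairs n"
    then show "(\<lambda>x. if e \<in> E then edge_prob W (\<rho> n) x e else 1 - edge_prob W (\<rho> n) x e) \<in> borel_measurable (fin_iid n)"
      using meas_edge_prob by (cases "e \<in> E") auto
  qed
  show ?thesis
  proof (rule F.integrable_const_bound[where B = 1])
    show "(\<lambda>x. indicator A x * wrg_prob W (\<rho> n) n x E) \<in> borel_measurable (fin_iid n)"
      using A m by measurable
    show "AE x in fin_iid n. norm (indicator A x * wrg_prob W (\<rho> n) n x E) \<le> 1"
    proof (rule AE_I2)
      fix x assume "x \<in> space (fin_iid n)"
      then have xs: "x u \<in> space M" if "u < n" for u using that by (auto simp: space_PiM PiE_iff)
      have p: "0 \<le> edge_prob W (\<rho> n) x e \<and> edge_prob W (\<rho> n) x e \<le> 1" if "e \<in> vpairs n" for e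
        using edge_prob_bounds[of "\<rho> n" n W x e] \<rho>_pos[OF n] W_nonneg xs that by auto
      have "0 \<le> wrg_prob W (\<rho> n) n x E" "wrg_prob W (\<rho> n) n x E \<le> 1"
        unfolding wrg_prob_eq_bern_weight[OF E] using p
        by (auto intro!: bern_weight_nonneg) (auto simp: bern_weight_def intro!: prod_le_1)
      then show "norm (indicator A x * wrg_prob W (\<rho> n) n x E) \<le> 1" by (auto simp: indicator_def)
    qed
  qed
qed

lemma meas_joint: "A \<in> sets (fin_iid n) \<Longrightarrow> {\<omega>\<in>space Q. restrict (\<lambda>i. X i \<omega>) {..<n} \<in> A \<and> G n \<omega> = E} \<in> sets Q"
proof -
  assume A: "A \<in> sets (fin_iid n)"
  have [measurable]: "(\<lambda>\<omega>. restrict (\<lambda>i. X i \<omega>) {..<n}) \<in> measurable Q (fin_iid n)"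
    by (rule measurable_restrict) simp
  have [measurable]: "G n \<in> measurable Q (count_space UNIV)" by (rule meas_G)
  have [measurable]: "A \<in> sets (fin_iid n)" by (rule A)
  show ?thesis by measurable
qed

lemma law_joint:
  "A \<in> sets (fin_iid n) \<Longrightarrow> Q.prob {\<omega>\<in>space Q. restrict (\<lambda>i. X i \<omega>) {..<n} \<in> A \<and> G n \<omega> = E}
     = (\<integral>x. indicator A x * wrg_prob W (\<rho> n) n x E \<partial>(fin_iid n))"
  using wrg by (simp add: wrg_sequence_def)

text \<open>Conditioning on the points in finite form: for each edge set the joint law is an
  integral over the points, and summing under the integral leaves the conditional probability of
  \<open>C\<close>, bounded by \<open>g\<close> at every point.\<close>

lemma joint_bound:
  assumes n: "n \<ge> 2" and C: "\<And>E. E \<subseteq> vpairs n \<Longrightarrow> {x\<in>space (fin_iid n). C x E} \<in> sets (fin_iid n)"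
    and g: "\<And>x. x \<in> space (fin_iid n) \<Longrightarrow> (\<Sum>E\<in>Pow (vpairs n). wrg_prob W (\<rho> n) n x E * (if C x E then 1 else 0)) \<le> g"
  defines "S \<equiv> {\<omega>\<in>space Q. G n \<omega> \<subseteq> vpairs n \<and> C (restrict (\<lambda>i. X i \<omega>) {..<n}) (G n \<omega>)}"
  shows "S \<in> sets Q" and "Q.prob S \<le> g"
proof -
  interpret F: prob_space "fin_iid n" by (rule prob_space_fin_iid)
  let ?A = "\<lambda>E. {x\<in>space (fin_iid n). C x E}"
  let ?S = "\<lambda>E. {\<omega>\<in>space Q. restrict (\<lambda>i. X i \<omega>) {..<n} \<in> ?A E \<and> G n \<omega> = E}"
  have m: "?S E \<in> sets Q" if "E \<in> Pow (vpairs n)" for E by (rule meas_joint[OF C]) (use that in auto)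
  have rs: "restrict (\<lambda>i. X i \<omega>) {..<n} \<in> space (fin_iid n)" if "\<omega> \<in> space Q" for \<omega>
    using measurable_space[OF meas_X that] by (auto simp: space_PiM)
  have eq: "S = (\<Union>E\<in>Pow (vpairs n). ?S E)"
    using rs by (auto simp: S_def)
  show "S \<in> sets Q" unfolding eq using m by (intro sets.finite_UN) auto
  have "Q.prob S \<le> (\<Sum>E\<in>Pow (vpairs n). Q.prob (?S E))"
    unfolding eq using m by (intro Q.finite_measure_subadditive_finite) auto
  also have "\<dots> = (\<Sum>E\<in>Pow (vpairs n). \<integral>x. indicator (?A E) x * wrg_prob W (\<rho> n) n x E \<partial>(fin_iid n))"
    using C by (intro sum.cong refl law_joint) auto
  also have "\<dots> = (\<integral>x. (\<Sum>E\<in>Pow (vpairs n). indicator (?A E) x * wrg_prob W (\<rho> n) n x E) \<partial>(fin_iid n))"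
    using C by (intro Bochner_Integration.integral_sum[symmetric] wrg_prob_integrable n) auto
  also have "\<dots> \<le> (\<integral>x. g \<partial>(fin_iid n))"
  proof (intro integral_mono Bochner_Integration.integrable_sum wrg_prob_integrable n F.integrable_const)
    fix x assume x: "x \<in> space (fin_iid n)"
    have "(\<Sum>E\<in>Pow (vpairs n). indicator (?A E) x * wrg_prob W (\<rho> n) n x E)
       = (\<Sum>E\<in>Pow (vpairs n). wrg_prob W (\<rho> n) n x E * (if C x E then 1 else 0))"
      using x by (intro sum.cong refl) (auto simp: indicator_def)
    then show "(\<Sum>E\<in>Pow (vpairs n). indicator (?A E) x * wrg_prob W (\<rho> n) n x E) \<le> g" using g[OF x] by simp
  qed (use C in auto)
  finally show "Q.prob S \<le> g" by (simp add: F.prob_space)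
qed

text \<open>The prescribed weights of the subsets of \<open>vpairs n\<close> sum to 1 at every
  point, so other edge sets have probability 0.\<close>

lemma AE_G:
  assumes n: "n \<ge> 2"
  shows "AE \<omega> in Q. G n \<omega> \<subseteq> vpairs n"
proof -
  interpret F: prob_space "fin_iid n" by (rule prob_space_fin_iid)
  have [measurable]: "G n \<in> measurable Q (count_space UNIV)" by (rule meas_G)
  let ?S = "\<lambda>E. {\<omega>\<in>space Q. G n \<omega> = E}"
  have rs: "restrict (\<lambda>i. X i \<omega>) {..<n} \<in> space (fin_iid n)" if "\<omega> \<in> space Q" for \<omega>
    using measurable_space[OF meas_X that] by (auto simp: space_PiM)
  have "Q.prob {\<omega>\<in>space Q. G n \<omega> \<in> Pow (vpairs n)} = Q.prob (\<Union>E\<in>Pow (vpairs n). ?S E)"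
    by (intro arg_cong[where f = Q.prob]) auto
  also have "\<dots> = (\<Sum>E\<in>Pow (vpairs n). Q.prob (?S E))"
    by (intro Q.finite_measure_finite_Union) (auto simp: disjoint_family_on_def)
  also have "\<dots> = (\<Sum>E\<in>Pow (vpairs n). \<integral>x. indicator (space (fin_iid n)) x * wrg_prob W (\<rho> n) n x E \<partial>(fin_iid n))"
  proof (intro sum.cong refl)
    fix E
    have "?S E = {\<omega>\<in>space Q. restrict (\<lambda>i. X i \<omega>) {..<n} \<in> space (fin_iid n) \<and> G n \<omega> = E}" using rs by auto
    then show "Q.prob (?S E) = (\<integral>x. indicator (space (fin_iid n)) x * wrg_prob W (\<rho> n) n x E \<partial>(fin_iid n))"
      using law_joint[OF sets.top] by simp
  qed
  also have "\<dots> = (\<integral>x. (\<Sum>E\<in>Pow (vpairs n). indicator (space (fin_iid n)) x * wrg_prob W (\<rho> n) n x E) \<partial>(fin_iid n))"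
    by (intro Bochner_Integration.integral_sum[symmetric] wrg_prob_integrable n) auto
  also have "\<dots> = (\<integral>x. 1 \<partial>(fin_iid n))"
  proof (intro Bochner_Integration.integral_cong refl)
    fix x assume "x \<in> space (fin_iid n)"
    then have "(\<Sum>E\<in>Pow (vpairs n). indicator (space (fin_iid n)) x * wrg_prob W (\<rho> n) n x E)
       = (\<Sum>E\<in>Pow (vpairs n). bern_weight (vpairs n) (edge_prob W (\<rho> n) x) E)"
      by (intro sum.cong refl) (auto simp: wrg_prob_eq_bern_weight)
    then show "(\<Sum>E\<in>Pow (vpairs n). indicator (space (fin_iid n)) x * wrg_prob W (\<rho> n) n x E) = 1"
      by (simp add: sum_bern_weight)
  qed
  also have "\<dots> = 1" by (simp add: F.prob_space)
  finally have "AE \<omega> in Q. G n \<omega> \<in> Pow (vpairs n)"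
    using Q.prob_Collect_eq_1[of "\<lambda>\<omega>. G n \<omega> \<in> Pow (vpairs n)"] by simp
  then show ?thesis by simp
qed

abbreviation "W_pair \<equiv> \<lambda>x. W (fst x) (snd x)"

text \<open>The edge density is under control only where the sample average of \<open>W\<close> is bounded.\<close>

definition noisy :: "nat \<Rightarrow> real \<Rightarrow> real \<Rightarrow> (nat \<Rightarrow> 'a) \<Rightarrow> (nat \<times> nat) set \<Rightarrow> bool" where
  "noisy n c t x E \<longleftrightarrow> offdiag_sum W_pair n x \<le> c * (real n)\<^sup>2 \<and> t * \<rho> n < cut_norm n (noise W (\<rho> n) x E)"

lemma noisy_restrict: "noisy n c t (restrict x {..<n}) E = noisy n c t x E"
proof -
  have "offdiag_sum W_pair n (restrict x {..<n}) = offdiag_sum W_pair n x"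
    unfolding offdiag_sum_def by (intro sum.cong refl) auto
  moreover have "cut_norm n (noise W (\<rho> n) (restrict x {..<n}) E) = cut_norm n (noise W (\<rho> n) x E)"
    by (rule cut_norm_cong) (simp add: noise_def trunc_sample_def)
  ultimately show ?thesis by (simp add: noisy_def)
qed

lemma noisy_meas:
  "{x\<in>space (fin_iid n). noisy n c t x E} \<in> sets (fin_iid n)"
proof -
  have [measurable]: "(\<lambda>x. offdiag_sum W_pair n x) \<in> borel_measurable (fin_iid n)"
    unfolding offdiag_sum_def
  proof (intro borel_measurable_sum)
    fix u v assume "u \<in> {..<n}" "v \<in> {..<n}"
    then show "(\<lambda>x. if u \<noteq> v then W_pair (x u, x v) else 0) \<in> borel_measurable (fin_iid n)"
      using meas_W_fin[of u n v] by (cases "u = v") auto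
  qed
  have [measurable]: "(\<lambda>x. cut_norm n (noise W (\<rho> n) x E)) \<in> borel_measurable (fin_iid n)"
  proof (rule borel_measurable_cut_norm)
    fix u v assume uv: "u < n" "v < n"
    have "(\<lambda>x. trunc_sample W (\<rho> n) x u v) \<in> borel_measurable (fin_iid n)"
      unfolding trunc_sample_def using meas_W_fin[OF uv] by (cases "u = v") auto
    then show "(\<lambda>x. noise W (\<rho> n) x E u v) \<in> borel_measurable (fin_iid n)" unfolding noise_def by auto
  qed
  show ?thesis unfolding noisy_def by measurable
qed

lemma sum_edge_prob_le:
  assumes n: "n \<ge> 2" and x: "\<And>u. u < n \<Longrightarrow> x u \<in> space M"
  shows "(\<Sum>e\<in>vpairs n. edge_prob W (\<rho> n) x e) \<le> \<rho> n * offdiag_sum W_pair n x"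
proof -
  have "(\<Sum>e\<in>vpairs n. edge_prob W (\<rho> n) x e) \<le> (\<Sum>e\<in>vpairs n. \<rho> n * (if fst e \<noteq> snd e then W (x (fst e)) (x (snd e)) else 0))"
    by (intro sum_mono) (auto simp: edge_prob_def vpairs_def)
  also have "\<dots> \<le> (\<Sum>e\<in>{..<n} \<times> {..<n}. \<rho> n * (if fst e \<noteq> snd e then W (x (fst e)) (x (snd e)) else 0))"
    using \<rho>_pos[OF n] W_nonneg x by (intro sum_mono2) (auto simp: vpairs_def)
  also have "\<dots> = \<rho> n * offdiag_sum W_pair n x"
    by (simp add: sum.cartesian_product' offdiag_sum_def sum_distrib_left cong: if_cong)
  finally show ?thesis .
qed

definition noisy_event :: "nat \<Rightarrow> real \<Rightarrow> real \<Rightarrow> 'q set" where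
  "noisy_event n c t = {\<omega>\<in>space Q. G n \<omega> \<subseteq> vpairs n \<and> noisy n c t (\<lambda>i. X i \<omega>) (G n \<omega>)}"

lemma noisy_event_bound:
  assumes n: "n \<ge> 2"
    and g: "\<And>x. x \<in> space (fin_iid n) \<Longrightarrow> (\<Sum>E\<in>Pow (vpairs n). wrg_prob W (\<rho> n) n x E * (if noisy n c t x E then 1 else 0)) \<le> g"
  shows "noisy_event n c t \<in> sets Q" and "Q.prob (noisy_event n c t) \<le> g"
proof -
  have eq: "noisy_event n c t = {\<omega>\<in>space Q. G n \<omega> \<subseteq> vpairs n \<and> noisy n c t (restrict (\<lambda>i. X i \<omega>) {..<n}) (G n \<omega>)}"
    by (simp add: noisy_event_def noisy_restrict)
  show "noisy_event n c t \<in> sets Q" "Q.prob (noisy_event n c t) \<le> g"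
    unfolding eq by (rule joint_bound[OF n noisy_meas g]; assumption)+
qed

text \<open>Where the average of \<open>W\<close> is large the event is empty; elsewhere the
  expected number of edges is at most c \<rho> n^2 and enters the Chernoff exponent.\<close>

lemma noisy_event_exp:
  assumes n: "n \<ge> 2" and l: "0 \<le> l" "l \<le> 1/2"
  shows "noisy_event n c t \<in> sets Q"
    and "Q.prob (noisy_event n c t) \<le> 2 * 4 ^ n * exp (4 * l\<^sup>2 * (c * \<rho> n * (real n)\<^sup>2) - l * (t * \<rho> n * (real n)\<^sup>2))"
proof -
  let ?g = "2 * 4 ^ n * exp (4 * l\<^sup>2 * (c * \<rho> n * (real n)\<^sup>2) - l * (t * \<rho> n * (real n)\<^sup>2))"
  have "(\<Sum>E\<in>Pow (vpairs n). wrg_prob W (\<rho> n) n x E * (if noisy n c t x E then 1 else 0)) \<le> ?g"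
    if "x \<in> space (fin_iid n)" for x
  proof (cases "offdiag_sum W_pair n x \<le> c * (real n)\<^sup>2")
    case True
    have xs: "x u \<in> space M" if "u < n" for u using \<open>x \<in> _\<close> that by (auto simp: space_PiM PiE_iff)
    have "(\<Sum>E\<in>Pow (vpairs n). wrg_prob W (\<rho> n) n x E * (if noisy n c t x E then 1 else 0))
       = (\<Sum>E\<in>Pow (vpairs n). wrg_prob W (\<rho> n) n x E * (if t * \<rho> n < cut_norm n (noise W (\<rho> n) x E) then 1 else 0))"
      using True by (simp add: noisy_def)
    also have "\<dots> \<le> 2 * 4 ^ n * exp (4 * l\<^sup>2 * (\<Sum>e\<in>vpairs n. edge_prob W (\<rho> n) x e) - l * (t * \<rho> n * (real n)\<^sup>2))"
      using n \<rho>_pos[OF n] W_sym W_nonneg xs l by (intro cut_norm_noise_tail) auto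
    also have "\<dots> \<le> ?g"
    proof -
      have "(\<Sum>e\<in>vpairs n. edge_prob W (\<rho> n) x e) \<le> \<rho> n * (c * (real n)\<^sup>2)"
        using sum_edge_prob_le[OF n xs] True \<rho>_pos[OF n] by (meson order_trans mult_left_mono less_imp_le)
      then have "4 * l\<^sup>2 * (\<Sum>e\<in>vpairs n. edge_prob W (\<rho> n) x e) \<le> 4 * l\<^sup>2 * (c * \<rho> n * (real n)\<^sup>2)"
        by (intro mult_left_mono) (auto simp: mult_ac)
      then show ?thesis by (intro mult_left_mono) auto
    qed
    finally show ?thesis .
  next
    case False
    then show ?thesis by (simp add: noisy_def)
  qed
  from noisy_event_bound[OF n this]
  show "noisy_event n c t \<in> sets Q" "Q.prob (noisy_event n c t) \<le> ?g" by auto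
qed

text \<open>At this threshold the crude bound forces more than K \<rho> n^2 edges, while at most c
  \<rho> n^2 are expected; Markov's inequality for the edge count concludes.\<close>

lemma noisy_event_sparse:
  assumes n: "n \<ge> 2" and c: "0 \<le> c" and K: "0 < K"
  shows "Q.prob (noisy_event n c (2 * (K + c))) \<le> c / K"
proof (rule noisy_event_bound(2)[OF n])
  fix x assume x: "x \<in> space (fin_iid n)"
  have xs: "x u \<in> space M" if "u < n" for u using x that by (auto simp: space_PiM PiE_iff)
  let ?p = "edge_prob W (\<rho> n) x" and ?V = "vpairs n"
  let ?L = "K * \<rho> n * (real n)\<^sup>2"
  have L: "0 < ?L" using K \<rho>_pos[OF n] n by simp
  have r: "0 < \<rho> n" by (rule \<rho>_pos[OF n])
  have p: "0 \<le> ?p e \<and> ?p e \<le> 1" if "e \<in> ?V" for e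
    using edge_prob_bounds[of "\<rho> n" n W x e] r W_nonneg xs that by auto
  show "(\<Sum>E\<in>Pow ?V. wrg_prob W (\<rho> n) n x E * (if noisy n c (2 * (K + c)) x E then 1 else 0)) \<le> c / K"
  proof (cases "offdiag_sum W_pair n x \<le> c * (real n)\<^sup>2")
    case True
    have sp: "(\<Sum>e\<in>?V. ?p e) \<le> c * \<rho> n * (real n)\<^sup>2"
    proof -
      have "\<rho> n * offdiag_sum W_pair n x \<le> \<rho> n * (c * (real n)\<^sup>2)" using True r by (intro mult_left_mono) auto
      then show ?thesis using sum_edge_prob_le[OF n, of x] xs by (simp add: mult_ac)
    qed
    have "(\<Sum>E\<in>Pow ?V. wrg_prob W (\<rho> n) n x E * (if noisy n c (2 * (K + c)) x E then 1 else 0))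
       \<le> (\<Sum>E\<in>Pow ?V. bern_weight ?V ?p E * (real (card E) / ?L))"
    proof (rule sum_mono)
      fix E assume E: "E \<in> Pow ?V"
      have "(if noisy n c (2 * (K + c)) x E then 1 else 0) \<le> real (card E) / ?L"
      proof (cases "noisy n c (2 * (K + c)) x E")
        case True
        then have "2 * (K + c) * \<rho> n < cut_norm n (noise W (\<rho> n) x E)" by (simp add: noisy_def)
        also have "\<dots> \<le> 2 * (real (card E) + (\<Sum>e\<in>?V. ?p e)) / (real n)\<^sup>2"
          using E r W_sym W_nonneg xs by (intro cut_norm_noise_le_card) auto
        also have "\<dots> \<le> 2 * (real (card E) + c * \<rho> n * (real n)\<^sup>2) / (real n)\<^sup>2"
          using sp by (intro divide_right_mono mult_left_mono) auto
        finally have "K * \<rho> n * (real n)\<^sup>2 < real (card E)" using n by (simp add: field_simps)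
        then show ?thesis using True L by (simp add: field_simps)
      next
        case False
        then show ?thesis using L by simp
      qed
      moreover have "0 \<le> bern_weight ?V ?p E" by (rule bern_weight_nonneg[OF p])
      ultimately have "bern_weight ?V ?p E * (if noisy n c (2 * (K + c)) x E then 1 else 0) \<le> bern_weight ?V ?p E * (real (card E) / ?L)"
        by (rule mult_left_mono)
      then show "wrg_prob W (\<rho> n) n x E * (if noisy n c (2 * (K + c)) x E then 1 else 0) \<le> bern_weight ?V ?p E * (real (card E) / ?L)"
        using E by (simp only: wrg_prob_eq_bern_weight Pow_iff)
    qed
    also have "\<dots> = (\<Sum>e\<in>?V. ?p e) / ?L"
      by (simp add: sum_divide_distrib[symmetric] sum_bern_weight_card)
    also have "\<dots> \<le> c * \<rho> n * (real n)\<^sup>2 / ?L" using sp L by (intro divide_right_mono) auto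
    also have "\<dots> = c / K" using K r n by simp
    finally show ?thesis .
  next
    case False
    then show ?thesis using c K by (simp add: noisy_def)
  qed
qed

lemma cut_norm_trunc_le:
  assumes n: "n \<ge> 2" and c: "offdiag_sum W_pair n x \<le> c * (real n)\<^sup>2" and "\<not> noisy n c t x E"
  shows "cut_norm n (\<lambda>u v. adj E u v / \<rho> n - trunc_sample W (\<rho> n) x u v) \<le> t"
proof -
  have r: "0 < \<rho> n" by (rule \<rho>_pos[OF n])
  have "cut_norm n (\<lambda>u v. adj E u v / \<rho> n - trunc_sample W (\<rho> n) x u v) = cut_norm n (\<lambda>u v. 1 / \<rho> n * noise W (\<rho> n) x E u v)"
    by (rule cut_norm_cong) (use r in \<open>simp add: noise_def diff_divide_distrib\<close>)
  also have "\<dots> = 1 / \<rho> n * cut_norm n (noise W (\<rho> n) x E)" by (rule cut_norm_scale) (use r in simp)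
  also have "\<dots> \<le> 1 / \<rho> n * (t * \<rho> n)" using assms r by (intro mult_left_mono) (auto simp: noisy_def)
  finally show ?thesis using r by simp
qed

text \<open>Only the normalization of \<open>W\<close> is available, so the control of the edge
  density in (i) is a first-moment bound.\<close>

lemma offdiag_W_markov:
  assumes c: "0 < c"
  shows "Q.prob {\<omega>\<in>space Q. \<not> offdiag_sum W_pair n (\<lambda>i. X i \<omega>) \<le> c * (real n)\<^sup>2} \<le> 1 / c"
proof (cases "n = 0")
  case False
  interpret P: prob_space iid by (rule prob_space_iid)
  let ?A = "{x\<in>space iid. \<not> offdiag_sum W_pair n x \<le> c * (real n)\<^sup>2}"
  have A: "?A \<in> sets iid" by measurable
  have "{\<omega>\<in>space Q. \<not> offdiag_sum W_pair n (\<lambda>i. X i \<omega>) \<le> c * (real n)\<^sup>2} = {\<omega>\<in>space Q. (\<lambda>i. X i \<omega>) \<in> ?A}"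
    using measurable_space[OF meas_X_seq] by auto
  then have "Q.prob {\<omega>\<in>space Q. \<not> offdiag_sum W_pair n (\<lambda>i. X i \<omega>) \<le> c * (real n)\<^sup>2} = P.prob ?A"
    using measure_X[OF A] by simp
  also have "\<dots> \<le> P.prob {x\<in>space iid. c * (real n)\<^sup>2 \<le> offdiag_sum W_pair n x}"
    by (intro P.finite_measure_mono) (auto, measurable)
  also have "\<dots> \<le> (\<integral>x. offdiag_sum W_pair n x \<partial>iid) / (c * (real n)\<^sup>2)"
  proof (rule integral_Markov_inequality_measure[OF offdiag_sum_expectation(1)[OF integrable_W] sets.empty_sets])
    show "AE x in iid. 0 \<le> offdiag_sum W_pair n x"
      unfolding offdiag_sum_def using W_nonneg
      by (intro AE_I2 sum_nonneg) (auto simp: space_PiM)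
  qed (use c False in auto)
  also have "\<dots> = real n * (real n - 1) / (c * (real n)\<^sup>2)"
    by (simp add: offdiag_sum_expectation(2)[OF integrable_W] integral_W)
  also have "\<dots> \<le> (real n)\<^sup>2 / (c * (real n)\<^sup>2)"
    using c by (intro divide_right_mono) (auto simp: power2_eq_square mult_left_mono)
  also have "\<dots> = 1 / c" using False by simp
  finally show ?thesis .
next
  case True
  then show ?thesis using c by (simp add: offdiag_sum_def)
qed

end

section \<open>Optimal block models\<close>

lemma lp_int_1: "lp_int 1 \<mu> f = (\<integral>z. \<bar>f z\<bar> \<partial>\<mu>)"
proof -
  have "0 \<le> (\<integral>z. \<bar>f z\<bar> \<partial>\<mu>)" by (intro integral_nonneg_AE) auto
  then show ?thesis by (simp add: lp_int_def powr_one')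
qed

lemma prob_space_bm_measure:
  assumes "\<And>i. i < k \<Longrightarrow> 0 \<le> p i" "(\<Sum>i<k. p i) = 1"
  shows "prob_space (bm_measure k p)"
proof (rule prob_spaceI)
  have "emeasure (bm_measure k p) {..<k} = (\<Sum>i<k. ennreal (p i))"
    unfolding bm_measure_def by (subst emeasure_point_measure_finite) auto
  also have "\<dots> = ennreal (\<Sum>i<k. p i)" using assms(1) by (intro sum_ennreal) auto
  finally show "emeasure (bm_measure k p) (space (bm_measure k p)) = 1" using assms(2) by simp
qed

lemma product_in_couplings:
  assumes "prob_space M" "prob_space N"
  shows "M \<Otimes>\<^sub>M N \<in> couplings M N"
proof -
  interpret M: prob_space M by fact
  interpret N: prob_space N by fact
  have "distr (M \<Otimes>\<^sub>M N) N snd = N"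
  proof (rule measure_eqI)
    fix A assume "A \<in> sets (distr (M \<Otimes>\<^sub>M N) N snd)"
    then have A: "A \<in> sets N" by simp
    have "emeasure (distr (M \<Otimes>\<^sub>M N) N snd) A = emeasure (M \<Otimes>\<^sub>M N) (space M \<times> A)"
      using A sets.sets_into_space[OF A]
      by (subst emeasure_distr) (auto intro!: arg_cong2[where f = emeasure] simp: space_pair_measure)
    then show "emeasure (distr (M \<Otimes>\<^sub>M N) N snd) A = emeasure N A"
      using A by (simp add: N.emeasure_pair_measure_Times M.emeasure_space_1)
  qed simp
  then show ?thesis by (simp add: couplings_def N.distr_pair_fst)
qed

text \<open>The coupling itself serves as the space \<open>N\<close>, its projections as point and
  label.\<close>

lemma block_coupling_of_coupling:
  assumes M: "prob_space M" and W: "graphon M W"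
    and p: "\<And>i. i < k \<Longrightarrow> 0 \<le> p i" "(\<Sum>i<k. p i) = 1" and B: "graphon (bm_measure k p) B"
    and c: "\<nu> \<in> couplings M (bm_measure k p)"
  shows "block_coupling \<nu> M W fst snd k B"
    and "\<And>i. i < k \<Longrightarrow> block_coupling.q \<nu> snd i = p i"
    and "block_coupling.err \<nu> W fst snd B = lp_int 1 (\<nu> \<Otimes>\<^sub>M \<nu>) (\<lambda>((x,x'),(y,y')). W x y - B x' y')"
proof -
  interpret nu: prob_space \<nu> by (rule coupling_prob_space[OF prob_space_bm_measure[OF p] c])
  have s: "sets \<nu> = sets (M \<Otimes>\<^sub>M bm_measure k p)" and d1: "distr \<nu> M fst = M" and d2: "distr \<nu> (bm_measure k p) snd = bm_measure k p"
    using c by (auto simp: couplings_def)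
  have sp: "space \<nu> = space M \<times> {..<k}" using sets_eq_imp_space_eq[OF s] by (simp add: space_pair_measure)
  have fst: "fst \<in> measurable \<nu> M" by (subst measurable_cong_sets[OF s refl]) simp
  have snd: "snd \<in> measurable \<nu> (bm_measure k p)" by (subst measurable_cong_sets[OF s refl]) simp
  then have snd': "snd \<in> measurable \<nu> (count_space UNIV)"
    by (rule measurable_compose[OF _ measurable_from_bm, of snd _ k p "\<lambda>x. x", simplified]) simp
  show bc: "block_coupling \<nu> M W fst snd k B"
  proof (intro block_coupling.intro nu.prob_space_axioms block_coupling_axioms.intro M W fst d1 snd')
    show "0 \<le> B i j" if "i < k" "j < k" for i j using B that by (auto simp: graphon_def)
    show "snd z < k" if "z \<in> space \<nu>" for z using that by (auto simp: sp)
  qed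
  show "block_coupling.q \<nu> snd i = p i" if i: "i < k" for i
  proof -
    have "block_coupling.q \<nu> snd i = measure (distr \<nu> (bm_measure k p) snd) {i}"
      unfolding block_coupling.q_def[OF bc] using snd i
      by (subst measure_distr) (auto intro!: arg_cong2[where f = measure])
    also have "\<dots> = p i" unfolding d2 unfolding bm_measure_def measure_def using i p
      by (subst emeasure_point_measure_finite) auto
    finally show ?thesis .
  qed
  show "block_coupling.err \<nu> W fst snd B = lp_int 1 (\<nu> \<Otimes>\<^sub>M \<nu>) (\<lambda>((x,x'),(y,y')). W x y - B x' y')"
    unfolding block_coupling.err_def[OF bc] lp_int_1
    by (intro Bochner_Integration.integral_cong refl) (auto simp: case_prod_unfold abs_minus_commute)
qed

text \<open>Two nested infima, over block models and over couplings, are each undercut strictly; the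
  same slack \<eta> suffices for both.\<close>

lemma eps_block_attained:
  fixes W :: "'a \<Rightarrow> 'a \<Rightarrow> real"
  assumes M: "prob_space M" and W: "graphon M W" and \<kappa>: "\<kappa> \<le> 1" and \<eta>: "0 < \<eta>"
  obtains \<nu> :: "('a \<times> nat) measure" and k and B :: "nat \<Rightarrow> nat \<Rightarrow> real" where "block_coupling \<nu> M W fst snd k B"
    "\<And>i. i < k \<Longrightarrow> \<kappa> \<le> block_coupling.q \<nu> snd i"
    "block_coupling.err \<nu> W fst snd B < eps_block 1 M W \<kappa> + \<eta>"
proof -
  let ?S = "{delta_p 1 M W (bm_measure k q) B | k q B.
            (\<forall>i<k. 0 \<le> q i) \<and> (\<Sum>i<k. q i) = 1 \<and> (\<forall>i<k. \<kappa> \<le> q i) \<and> graphon (bm_measure k q) B}"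
  \<comment> \<open>The zero model with a single block of weight 1 shows that the infimum ranges
    over a nonempty set.\<close>
  have "graphon (bm_measure 1 (\<lambda>_. 1)) (\<lambda>_ _. 0)" by (simp add: graphon_def case_prod_unfold)
  then have "delta_p 1 M W (bm_measure 1 (\<lambda>_. 1)) (\<lambda>_ _. 0) \<in> ?S"
    using \<kappa> by (auto intro!: exI[of _ "1::nat"] exI[of _ "\<lambda>_::nat. 1::real"])
  then have "?S \<noteq> {}" by blast
  then have "\<exists>d\<in>?S. d < eps_block 1 M W \<kappa> + \<eta>"
    unfolding eps_block_def by (rule cInf_lessD) (use \<eta> in simp)
  then obtain k p B where p: "\<And>i. i < k \<Longrightarrow> 0 \<le> p i" "(\<Sum>i<k. p i) = 1" "\<And>i. i < k \<Longrightarrow> \<kappa> \<le> p i"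
    and B: "graphon (bm_measure k p) B" and d: "delta_p 1 M W (bm_measure k p) B < eps_block 1 M W \<kappa> + \<eta>"
    by blast
  have "couplings M (bm_measure k p) \<noteq> {}" using product_in_couplings[OF M prob_space_bm_measure[OF p(1,2)]] by blast
  then have "\<exists>l\<in>(\<lambda>\<nu>. lp_int 1 (\<nu> \<Otimes>\<^sub>M \<nu>) (\<lambda>((x,x'),(y,y')). W x y - B x' y')) ` couplings M (bm_measure k p). l < eps_block 1 M W \<kappa> + \<eta>"
    using d unfolding delta_p_def by (intro cInf_lessD) auto
  then obtain \<nu> where \<nu>: "\<nu> \<in> couplings M (bm_measure k p)"
    "lp_int 1 (\<nu> \<Otimes>\<^sub>M \<nu>) (\<lambda>((x,x'),(y,y')). W x y - B x' y') < eps_block 1 M W \<kappa> + \<eta>" by auto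
  show ?thesis
    using block_coupling_of_coupling[OF M W p(1,2) B \<nu>(1)] p(3) \<nu>(2) by (intro that[of \<nu> k B]) auto
qed

lemma eps_block_nonneg:
  fixes W :: "'a \<Rightarrow> 'a \<Rightarrow> real"
  assumes "prob_space M" "graphon M W" "\<kappa> \<le> 1"
  shows "0 \<le> eps_block 1 M W \<kappa>"
proof (rule field_le_epsilon)
  fix \<eta> :: real assume "0 < \<eta>"
  show "0 \<le> eps_block 1 M W \<kappa> + \<eta>"
  proof (rule eps_block_attained[OF assms \<open>0 < \<eta>\<close>])
    fix \<nu> :: "('a \<times> nat) measure" and k B
    assume b: "block_coupling \<nu> M W fst snd k B" and "block_coupling.err \<nu> W fst snd B < eps_block 1 M W \<kappa> + \<eta>"
    then show ?thesis using block_coupling.err_nonneg[OF b] by linarith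
  qed
qed

text \<open>Here \<open>N\<close> is \<open>M\<close> and the point map is the identity. Such models
  are as accurate as desired, without control on the weights of their blocks.\<close>

lemma step_block_coupling:
  fixes W :: "'a \<Rightarrow> 'a \<Rightarrow> real"
  assumes M: "prob_space M" and W: "graphon M W" and \<eta>: "0 < \<eta>"
  obtains lab :: "'a \<Rightarrow> nat" and k and B where "block_coupling M M W (\<lambda>x. x) lab k B" "block_coupling.err M W (\<lambda>x. x) lab B < \<eta>"
proof -
  interpret prob_space M by fact
  have iW: "integrable (M \<Otimes>\<^sub>M M) (\<lambda>x. W (fst x) (snd x))" using W by (simp add: graphon_def case_prod_unfold)
  obtain k :: nat and \<phi> :: "'a \<Rightarrow> nat" and s :: "nat \<Rightarrow> nat \<Rightarrow> real"
    where s: "\<phi> \<in> measurable M (count_space UNIV)" "\<And>x. x \<in> space M \<Longrightarrow> \<phi> x < k"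
    "(\<integral>x. \<bar>W (fst x) (snd x) - s (\<phi> (fst x)) (\<phi> (snd x))\<bar> \<partial>(M \<Otimes>\<^sub>M M)) < \<eta>"
    by (rule step_approxE[OF step_approx_integrable[OF iW], of \<eta>]) (use \<eta> in auto)
  \<comment> \<open>Block entries have to be nonnegative. As \<open>W\<close> is nonnegative,
    clipping can only reduce the error.\<close>
  let ?B = "\<lambda>i j. max 0 (s i j)"
  have bc: "block_coupling M M W (\<lambda>x. x) \<phi> k ?B"
    by (intro block_coupling.intro M block_coupling_axioms.intro) (use M W s in \<open>auto simp: distr_id2\<close>)
  have "block_coupling.err M W (\<lambda>x. x) \<phi> ?B \<le> (\<integral>x. \<bar>W (fst x) (snd x) - s (\<phi> (fst x)) (\<phi> (snd x))\<bar> \<partial>(M \<Otimes>\<^sub>M M))"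
    unfolding block_coupling.err_def[OF bc]
  proof (intro integral_mono)
    show "integrable (M \<Otimes>\<^sub>M M) (\<lambda>z. \<bar>?B (\<phi> (fst z)) (\<phi> (snd z)) - W (fst z) (snd z)\<bar>)"
      using block_coupling.integrable_diff[OF bc] by simp
    show "integrable (M \<Otimes>\<^sub>M M) (\<lambda>x. \<bar>W (fst x) (snd x) - s (\<phi> (fst x)) (\<phi> (snd x))\<bar>)"
      by (intro integrable_abs Bochner_Integration.integrable_diff iW integrable_step(1)[OF s(1,2)])
    show "\<bar>?B (\<phi> (fst z)) (\<phi> (snd z)) - W (fst z) (snd z)\<bar> \<le> \<bar>W (fst z) (snd z) - s (\<phi> (fst z)) (\<phi> (snd z))\<bar>"
      if "z \<in> space (M \<Otimes>\<^sub>M M)" for z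
    proof -
      have "0 \<le> W (fst z) (snd z)" using W that by (auto simp: graphon_def space_pair_measure)
      then show ?thesis by auto
    qed
  qed
  then show ?thesis using s(3) by (intro that[OF bc]) linarith
qed

lemma tail_eq:
  "tail 1 M W \<rho> = (\<integral>x. \<bar>W (fst x) (snd x) - min (W (fst x) (snd x)) (1 / \<rho>)\<bar> \<partial>(M \<Otimes>\<^sub>M M))"
  by (simp add: tail_def graphon_norm_def lp_int_1 case_prod_unfold)

text \<open>The exponent -3n outweighs the number of cuts because exp 3 \<ge> 8, and leaves a
  summable bound.\<close>

lemma small_power: "4 ^ n * exp (- 3 * real n) \<le> (1 / 2 :: real) ^ n"
proof -
  have "exp (1::real) ^ 3 \<ge> 2 ^ 3" using exp_ge_add_one_self[of "1::real"] by (intro power_mono) auto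
  then have e: "8 \<le> exp (3::real)" by (simp add: exp_of_nat_mult[of 3 1, symmetric, simplified])
  have "4 ^ n * exp (- 3 * real n) = (4 / exp 3) ^ n"
    by (simp add: exp_minus divide_inverse power_mult_distrib exp_of_nat_mult[symmetric] mult.commute power_inverse)
  also have "\<dots> \<le> (1 / 2) ^ n" using e by (intro power_mono) (auto simp: field_simps)
  finally show ?thesis .
qed

section \<open>Size of the noise in the dense and sparse regimes\<close>

context wrg
begin

text \<open>With r = sqrt(\<rho> n) the choice l = 1 / (2r) makes the Chernoff exponent c n - (c +
  3) n = -3n. The assumption \<rho> n \<ge> 1 is what makes l \<le> 1/2.\<close>

lemma noisy_event_dense:
  assumes n: "n \<ge> 2" and c: "0 \<le> c" and d: "1 \<le> \<rho> n * real n"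
  shows "noisy_event n c (2 * (c + 3) / sqrt (\<rho> n * real n)) \<in> sets Q"
    and "Q.prob (noisy_event n c (2 * (c + 3) / sqrt (\<rho> n * real n))) \<le> 2 * (1 / 2) ^ n"
proof -
  define r where "r = sqrt (\<rho> n * real n)"
  have r: "1 \<le> r" "r\<^sup>2 = \<rho> n * real n" using d by (auto simp: r_def)
  let ?t = "2 * (c + 3) / r"
  have l: "0 \<le> 1 / (2 * r)" "1 / (2 * r) \<le> 1 / 2" using r by auto
  note e = noisy_event_exp[OF n l, of c ?t]
  have "4 * (1 / (2 * r))\<^sup>2 * (c * \<rho> n * (real n)\<^sup>2) = c * real n * (\<rho> n * real n) / r\<^sup>2"
    by (simp add: power_divide power_mult_distrib power2_eq_square field_simps)
  also have "\<dots> = c * real n" using r(1) by (simp add: r(2)[symmetric])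
  finally have a: "4 * (1 / (2 * r))\<^sup>2 * (c * \<rho> n * (real n)\<^sup>2) = c * real n" .
  have "1 / (2 * r) * (?t * \<rho> n * (real n)\<^sup>2) = (c + 3) * real n * (\<rho> n * real n) / r\<^sup>2"
    using r(1) by (simp add: power2_eq_square field_simps)
  also have "\<dots> = (c + 3) * real n" using r(1) by (simp add: r(2)[symmetric])
  finally have b: "1 / (2 * r) * (?t * \<rho> n * (real n)\<^sup>2) = (c + 3) * real n" .
  show "noisy_event n c (2 * (c + 3) / sqrt (\<rho> n * real n)) \<in> sets Q" using e(1) by (simp add: r_def)
  have "Q.prob (noisy_event n c ?t) \<le> 2 * 4 ^ n * exp (c * real n - (c + 3) * real n)"
    using e(2) unfolding a b .
  also have "c * real n - (c + 3) * real n = - 3 * real n" by (simp add: algebra_simps)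
  also have "2 * 4 ^ n * exp (- 3 * real n) \<le> 2 * (1 / 2) ^ n" using small_power[of n] by simp
  finally show "Q.prob (noisy_event n c (2 * (c + 3) / sqrt (\<rho> n * real n))) \<le> 2 * (1 / 2) ^ n" by (simp add: r_def)
qed

lemma noisy_event_mono: "s \<le> t \<Longrightarrow> n \<ge> 2 \<Longrightarrow> noisy_event n c t \<subseteq> noisy_event n c s"
  using \<rho>_pos[of n] by (auto simp: noisy_event_def noisy_def intro: le_less_trans[OF mult_right_mono])

lemma noisy_event_sets: "n \<ge> 2 \<Longrightarrow> noisy_event n c t \<in> sets Q"
  by (rule noisy_event_exp(1)[of n 0]) auto

text \<open>For \<rho> n \<ge> 1 exponential moments apply. For \<rho> n < 1 the threshold K /
  sqrt(\<rho> n) is at least K, and a bound by a constant, from counting edges, is enough.\<close>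

lemma noisy_event_probability:
  assumes \<epsilon>: "0 < \<epsilon>" and c: "0 \<le> c"
  obtains K N where "0 < K" "\<And>n. n \<ge> N \<Longrightarrow> Q.prob (noisy_event n c (K / sqrt (\<rho> n * real n))) \<le> \<epsilon>"
proof -
  \<comment> \<open>Makes c / K0 at most \<epsilon> in the sparse case, and positive even if c =
    0.\<close>
  define K0 where "K0 = (c + 1) / \<epsilon>"
  define K where "K = 2 * (K0 + c + 3)"
  have K0: "0 < K0" using \<epsilon> c by (simp add: K0_def)
  have "(\<lambda>n. 2 * (1 / 2 :: real) ^ n) \<longlonglongrightarrow> 2 * 0" by (intro tendsto_intros LIMSEQ_power_zero) auto
  then have "eventually (\<lambda>n. 2 * (1 / 2 :: real) ^ n < \<epsilon>) sequentially" using \<epsilon> by (intro order_tendstoD(2)) auto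
  then obtain N0 where N0: "\<And>n. n \<ge> N0 \<Longrightarrow> 2 * (1 / 2 :: real) ^ n < \<epsilon>" by (auto simp: eventually_sequentially)
  show ?thesis
  proof (rule that[of K "max 2 N0"])
    show "0 < K" using K0 c by (simp add: K_def)
    fix n assume "max 2 N0 \<le> n"
    then have n: "n \<ge> 2" "n \<ge> N0" by auto
    have rn: "0 < \<rho> n * real n" using \<rho>_pos[OF n(1)] n by simp
    show "Q.prob (noisy_event n c (K / sqrt (\<rho> n * real n))) \<le> \<epsilon>"
    proof (cases "1 \<le> \<rho> n * real n")
      case True
      have "2 * (c + 3) / sqrt (\<rho> n * real n) \<le> K / sqrt (\<rho> n * real n)"
        using K0 rn by (intro divide_right_mono) (auto simp: K_def)
      then have "Q.prob (noisy_event n c (K / sqrt (\<rho> n * real n))) \<le> Q.prob (noisy_event n c (2 * (c + 3) / sqrt (\<rho> n * real n)))"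
        using noisy_event_mono[OF _ n(1)] noisy_event_sets[OF n(1)] by (intro Q.finite_measure_mono) auto
      also have "\<dots> \<le> 2 * (1 / 2) ^ n" by (rule noisy_event_dense(2)[OF n(1) c True])
      finally show ?thesis using N0[OF n(2)] by linarith
    next
      case False
      then have s: "0 < sqrt (\<rho> n * real n)" "sqrt (\<rho> n * real n) \<le> 1" using rn by auto
      have "2 * (K0 + c) \<le> K" by (simp add: K_def)
      also have "K \<le> K / sqrt (\<rho> n * real n)"
      proof -
        have "0 \<le> K" using K0 c by (simp add: K_def)
        then have "K * sqrt (\<rho> n * real n) \<le> K * 1" using s by (intro mult_left_mono) auto
        then show ?thesis using s by (simp add: pos_le_divide_eq)
      qed
      finally have "Q.prob (noisy_event n c (K / sqrt (\<rho> n * real n))) \<le> Q.prob (noisy_event n c (2 * (K0 + c)))"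
        using noisy_event_mono[OF _ n(1)] noisy_event_sets[OF n(1)] by (intro Q.finite_measure_mono) auto
      also have "\<dots> \<le> c / K0" by (rule noisy_event_sparse[OF n(1) c K0])
      also have "\<dots> \<le> \<epsilon>" using c \<epsilon> by (simp add: K0_def field_simps)
      finally show ?thesis .
    qed
  qed
qed

text \<open>The joint law of graphs of different sizes is left open by \<open>wrg_sequence\<close>,
  so the argument runs through summable probabilities and the first Borel-Cantelli lemma.\<close>

lemma AE_not_noisy:
  assumes t: "0 < t" and lim: "filterlim (\<lambda>n. real n * \<rho> n) at_top sequentially"
  shows "AE \<omega> in Q. eventually (\<lambda>n. cut_norm n (\<lambda>u v. adj (G n \<omega>) u v / \<rho> n - trunc_sample W (\<rho> n) (\<lambda>i. X i \<omega>) u v) \<le> t) sequentially"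
proof -
  \<comment> \<open>16 l \<le> t makes the quadratic term at most half of the linear one; the other
    half is at least 3n once \<rho> n \<ge> 6 / (l t).\<close>
  define l where "l = min (1 / 2) (t / 16)"
  have l: "0 < l" "l \<le> 1 / 2" "16 * l \<le> t" using t by (auto simp: l_def)
  have "eventually (\<lambda>n. 6 / (l * t) \<le> real n * \<rho> n) sequentially" using lim by (simp add: filterlim_at_top)
  then have ev: "eventually (\<lambda>n. n \<ge> 2 \<and> Q.prob (noisy_event n 2 t) \<le> 2 * (1 / 2) ^ n) sequentially"
    using eventually_ge_at_top[of 2]
  proof eventually_elim
    case (elim n)
    have rn: "0 \<le> \<rho> n * (real n)\<^sup>2" using \<rho>_pos[of n] elim(2) by auto
    have "6 \<le> l * t * (real n * \<rho> n)" using elim(1) l t by (simp add: field_simps)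
    then have "6 * real n \<le> l * t * (real n * \<rho> n) * real n" by (intro mult_right_mono) auto
    then have a: "3 * real n \<le> l * t / 2 * (\<rho> n * (real n)\<^sup>2)" by (simp add: power2_eq_square mult_ac)
    have "8 * l\<^sup>2 \<le> l * t / 2" using l by (simp add: power2_eq_square)
    then have "8 * l\<^sup>2 * (\<rho> n * (real n)\<^sup>2) \<le> l * t / 2 * (\<rho> n * (real n)\<^sup>2)" using rn by (rule mult_right_mono)
    then have "4 * l\<^sup>2 * (2 * \<rho> n * (real n)\<^sup>2) - l * (t * \<rho> n * (real n)\<^sup>2) \<le> - 3 * real n"
      using a by (simp add: mult_ac)
    then have "2 * 4 ^ n * exp (4 * l\<^sup>2 * (2 * \<rho> n * (real n)\<^sup>2) - l * (t * \<rho> n * (real n)\<^sup>2)) \<le> 2 * 4 ^ n * exp (- 3 * real n)"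
      by (intro mult_left_mono) auto
    also have "\<dots> \<le> 2 * (1 / 2) ^ n" using small_power[of n] by simp
    finally show ?case using noisy_event_exp(2)[OF elim(2), of l 2 t] l elim(2) by linarith
  qed
  then obtain N where N: "\<And>n. n \<ge> N \<Longrightarrow> n \<ge> 2" "\<And>n. n \<ge> N \<Longrightarrow> Q.prob (noisy_event n 2 t) \<le> 2 * (1 / 2) ^ n"
    unfolding eventually_sequentially by blast
  define A where "A n = (if n \<ge> N then noisy_event n 2 t else {})" for n
  have bc: "AE \<omega> in Q. eventually (\<lambda>n. \<omega> \<in> space Q - A n) sequentially"
  proof (rule borel_cantelli_AE1)
    show "A n \<in> sets Q" for n using noisy_event_sets N(1) by (auto simp: A_def)
    show "summable (\<lambda>n. Q.prob (A n))"
    proof (rule summable_comparison_test)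
      show "summable (\<lambda>n. 2 * (1 / 2 :: real) ^ n)" by (intro summable_mult summable_geometric) auto
      show "\<exists>N. \<forall>n\<ge>N. norm (Q.prob (A n)) \<le> 2 * (1 / 2) ^ n"
        using N(2) by (intro exI[of _ N]) (auto simp: A_def)
    qed
  qed (simp add: less_top[symmetric])
  have aeG: "AE \<omega> in Q. \<forall>n. n \<ge> 2 \<longrightarrow> G n \<omega> \<subseteq> vpairs n"
    unfolding AE_all_countable
  proof
    fix n show "AE \<omega> in Q. n \<ge> 2 \<longrightarrow> G n \<omega> \<subseteq> vpairs n" using AE_G[of n] by (cases "n \<ge> 2") auto
  qed
  \<comment> \<open>The level 2 is the integral 1 of \<open>W\<close> plus a slack of 1.\<close>
  have aeW: "AE \<omega> in Q. eventually (\<lambda>n. offdiag_sum W_pair n (\<lambda>i. X i \<omega>) \<le> 2 * (real n)\<^sup>2) sequentially"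
    using AE_X[OF offdiag_sum_eventually_le[OF integrable_W, of 1]] by (simp add: integral_W)
  from bc aeG aeW show ?thesis
  proof eventually_elim
    case (elim \<omega>)
    from elim(1,3) eventually_ge_at_top[of N] show ?case
    proof eventually_elim
      case inner: (elim n)
      have n: "n \<ge> 2" using N(1) inner by auto
      have "\<not> noisy n 2 t (\<lambda>i. X i \<omega>) (G n \<omega>)"
        using inner elim(2) n by (auto simp: A_def noisy_event_def)
      then show ?case using cut_norm_trunc_le[OF n inner(2)] by blast
    qed
  qed
qed

end

context block_coupling
begin

text \<open>As all weights are at least \<kappa>, q i + q j \<le> 2 q i q j / \<kappa> and 1 \<le> q
  i q j / \<kappa>^2. This turns the rounding coefficients into multiples of
  \<open>B_norm\<close>.\<close>

lemma class_error_le: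
  assumes \<kappa>: "0 < \<kappa>" "\<And>i. i < k \<Longrightarrow> \<kappa> \<le> q i" and n: "1 \<le> real n * \<kappa>"
  shows "B_col / real n + B_tot / (real n)\<^sup>2 \<le> 3 * B_norm / sqrt (real n * \<kappa>)"
proof -
  let ?m = "real n * \<kappa>"
  have n0: "0 < real n" using n \<kappa> by (cases n) auto
  have qq: "q i / \<kappa> \<ge> 1" if "i < k" for i using \<kappa>(2)[OF that] \<kappa>(1) by simp
  have "B_col \<le> (\<Sum>i<k. \<Sum>j<k. 2 * (q i * q j * B i j) / \<kappa>)"
    unfolding B_col_def
  proof (intro sum_mono)
    fix i j assume "i \<in> {..<k}" "j \<in> {..<k}"
    then have ij: "i < k" "j < k" by auto
    have "q i * \<kappa> \<le> q i * q j" "q j * \<kappa> \<le> q j * q i" using \<kappa>(2) ij q_nonneg by (auto intro: mult_left_mono)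
    then have "(q i + q j) * \<kappa> \<le> 2 * (q i * q j)" by (simp add: algebra_simps)
    then have "q i + q j \<le> 2 * (q i * q j) / \<kappa>" using \<kappa>(1) by (simp add: pos_le_divide_eq)
    then have "B i j * (q i + q j) \<le> B i j * (2 * (q i * q j) / \<kappa>)" using B_nonneg[OF ij] by (rule mult_left_mono)
    then show "B i j * (q i + q j) \<le> 2 * (q i * q j * B i j) / \<kappa>" by (simp add: mult_ac)
  qed
  also have "\<dots> = 2 * B_norm / \<kappa>" by (simp add: B_norm_def sum_distrib_left sum_divide_distrib)
  finally have "B_col / real n \<le> 2 * B_norm / \<kappa> / real n" by (rule divide_right_mono) simp
  then have 1: "B_col / real n \<le> 2 * B_norm / ?m" by (simp add: mult.commute)
  have "B_tot \<le> (\<Sum>i<k. \<Sum>j<k. q i * q j * B i j / \<kappa>\<^sup>2)"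
    unfolding B_tot_def
  proof (intro sum_mono)
    fix i j assume "i \<in> {..<k}" "j \<in> {..<k}"
    then have ij: "i < k" "j < k" by auto
    have "1 * 1 \<le> (q i / \<kappa>) * (q j / \<kappa>)" using qq[OF ij(1)] qq[OF ij(2)] by (intro mult_mono) auto
    then have "B i j * 1 \<le> B i j * ((q i / \<kappa>) * (q j / \<kappa>))" using B_nonneg[OF ij] by (intro mult_left_mono) auto
    then show "B i j \<le> q i * q j * B i j / \<kappa>\<^sup>2" by (simp add: power2_eq_square mult_ac)
  qed
  also have "\<dots> = B_norm / \<kappa>\<^sup>2" by (simp add: B_norm_def sum_divide_distrib)
  finally have "B_tot / (real n)\<^sup>2 \<le> B_norm / \<kappa>\<^sup>2 / (real n)\<^sup>2" by (rule divide_right_mono) simp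
  also have "\<dots> = B_norm / ?m\<^sup>2" by (simp add: power_mult_distrib mult.commute)
  also have "\<dots> \<le> B_norm / ?m"
  proof (rule divide_left_mono[OF _ B_norm_nonneg])
    show "?m \<le> ?m\<^sup>2" using n by (rule self_le_power) simp
    show "0 < ?m\<^sup>2 * ?m" using n0 \<kappa>(1) by simp
  qed
  finally have 2: "B_tot / (real n)\<^sup>2 \<le> B_norm / ?m" .
  have "3 * B_norm / ?m = 2 * B_norm / ?m + B_norm / ?m" by (simp add: add_divide_distrib[symmetric])
  then have "B_col / real n + B_tot / (real n)\<^sup>2 \<le> 3 * B_norm / ?m"
    using add_mono[OF 1 2] by (simp only:)
  also have "\<dots> \<le> 3 * B_norm / sqrt ?m"
  proof (rule divide_left_mono)
    show "sqrt ?m \<le> ?m" using n by (intro real_le_lsqrt) (auto intro: self_le_power)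
    show "0 < ?m * sqrt ?m" using n0 \<kappa>(1) by simp
  qed (use B_norm_nonneg in simp)
  finally show ?thesis .
qed

lemma card_blocks_le:
  assumes "\<And>i. i < k \<Longrightarrow> \<kappa> \<le> q i"
  shows "real k * \<kappa> \<le> 1"
  using sum_mono[of "{..<k}" "\<lambda>_. \<kappa>" q] assms by (simp add: sum_q)

end

section \<open>Assembling the bound in probability and the almost sure bound\<close>

context wrg
begin

lemma output_mem:
  assumes "lcn_selection \<kappa> alg" "1 \<le> nat \<lfloor>\<kappa> n * real n\<rfloor>" "0 < \<kappa> n" "\<kappa> n \<le> 1"
  shows "alg n E \<in> lcn_outputs n (\<kappa> n) E"
  using assms lcn_outputs_nonempty[of "\<kappa> n" n E] by (auto simp: lcn_selection_def)

text \<open>The common source of (ii) and (iii). The error of the competing model counts twice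
  through its fit; that of the second model once through its fit and once through the transport to
  \<open>W\<close>.\<close>

lemma scaled_err_eventually_le:
  assumes b: "block_coupling N M W \<xi> lab k B" and b': "block_coupling N' M W \<xi>' lab' k' B'"
    and \<rho>: "\<rho> \<longlonglongrightarrow> 0" and lim: "filterlim (\<lambda>n. real n * \<rho> n) at_top sequentially"
    and adm: "eventually (\<lambda>n. 1 \<le> nat \<lfloor>\<kappa> n * real n\<rfloor> \<and> 0 < \<kappa> n \<and> \<kappa> n \<le> 1 \<and> k \<le> lcn_k n (\<kappa> n) \<and>
       (\<forall>i<k. block_coupling.q N lab i = 0 \<or> \<kappa> n \<le> block_coupling.q N lab i)) sequentially"
    and alg: "lcn_selection \<kappa> alg" and \<delta>: "0 < \<delta>"
  shows "AE \<omega> in Q. eventually (\<lambda>n. scaled_err M W (\<rho> n) (alg n (G n \<omega>))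
     \<le> 2 * block_coupling.err N W \<xi> lab B + 2 * block_coupling.err N' W \<xi>' lab' B' + \<delta>) sequentially"
proof -
  interpret b: block_coupling N M W \<xi> lab k B by fact
  interpret b': block_coupling N' M W \<xi>' lab' k' B' by fact
  \<comment> \<open>Seven tenths are spent: three on the noise, two and one on the fits, one on
    rounding.\<close>
  let ?d = "\<delta> / 10"
  have d: "0 < ?d" using \<delta> by simp
  have ae: "AE \<omega> in Q. eventually (\<lambda>n. \<exists>\<pi>\<in>b.good_labels n. b.fit (\<rho> n) n (\<lambda>i. X i \<omega>) \<pi> \<le> b.err + ?d) sequentially"
    by (rule AE_X[OF b.ex_fit_AE[OF \<rho> \<rho>_pos d]])
  have ae': "AE \<omega> in Q. eventually (\<lambda>n. \<exists>\<pi>\<in>b'.good_labels n. b'.fit (\<rho> n) n (\<lambda>i. X i \<omega>) \<pi> \<le> b'.err + ?d) sequentially"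
    by (rule AE_X[OF b'.ex_fit_AE[OF \<rho> \<rho>_pos d]])
  have "(\<lambda>n. b'.B_col * (1 / real n) + b'.B_tot * (1 / real n) * (1 / real n)) \<longlonglongrightarrow> b'.B_col * 0 + b'.B_tot * 0 * 0"
    by (intro tendsto_intros lim_1_over_n)
  then have "eventually (\<lambda>n. b'.B_col * (1 / real n) + b'.B_tot * (1 / real n) * (1 / real n) < ?d) sequentially"
    using d by (intro order_tendstoD(2)) auto
  then have ev: "eventually (\<lambda>n. b'.B_col / real n + b'.B_tot / (real n)\<^sup>2 < ?d) sequentially"
    by (simp add: power2_eq_square)
  from ae ae' AE_not_noisy[OF d lim] show ?thesis
  proof eventually_elim
    case (elim \<omega>)
    from elim adm ev eventually_ge_at_top[of 2] show ?case
    proof eventually_elim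
      case inner: (elim n)
      obtain \<pi> where \<pi>: "\<pi> \<in> b.good_labels n" "b.fit (\<rho> n) n (\<lambda>i. X i \<omega>) \<pi> \<le> b.err + ?d" using inner(1) by blast
      obtain \<pi>' where \<pi>': "\<pi>' \<in> b'.good_labels n" "b'.fit (\<rho> n) n (\<lambda>i. X i \<omega>) \<pi>' \<le> b'.err + ?d" using inner(2) by blast
      have n: "n > 0" and r: "0 < \<rho> n" using inner(6) \<rho>_pos by auto
      have "scaled_err M W (\<rho> n) (alg n (G n \<omega>)) \<le> 3 * cut_norm n (\<lambda>u v. adj (G n \<omega>) u v / \<rho> n - trunc_sample W (\<rho> n) (\<lambda>i. X i \<omega>) u v)
         + 2 * b.fit (\<rho> n) n (\<lambda>i. X i \<omega>) \<pi> + b'.fit (\<rho> n) n (\<lambda>i. X i \<omega>) \<pi>' + (b'.B_col / real n + b'.B_tot / (real n)\<^sup>2) + b'.err"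
        unfolding b.fit_def b'.fit_def
        using inner(4) output_mem[OF alg, of n]
        by (intro scaled_err_le[OF b b' \<pi>(1) \<pi>'(1) n r]) auto
      then show ?case using inner(3,5) \<pi>(2) \<pi>'(2) \<delta> by linarith
    qed
  qed
qed

text \<open>One near-optimal coupling plays both parts of \<open>scaled_err_le\<close>. Three bad
  events, for the noise, the fit and the edge density, get probability \<epsilon> / 3 each.\<close>

lemma scaled_err_probability:
  assumes \<kappa>: "\<And>n. n \<ge> 2 \<Longrightarrow> ln (real n) / real n \<le> \<kappa> n \<and> \<kappa> n \<le> 1" and alg: "lcn_selection \<kappa> alg" and \<epsilon>: "0 < \<epsilon>"
  shows "\<exists>C N. \<forall>n\<ge>N.
          1 - \<epsilon> \<le> measure Q {\<omega>\<in>space Q.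
             \<bar>scaled_err M W (\<rho> n) (alg n (G n \<omega>))\<bar>
               \<le> C * \<bar>eps_block 1 M W (\<kappa> n) + sqrt (1 / (\<rho> n * real n))
                       + sqrt (ln (real n) / (\<kappa> n * real n)) + tail 1 M W (\<rho> n)\<bar>}"
proof -
  define s where "s = 3 / \<epsilon>"
  have s: "0 < s" using \<epsilon> by (simp add: s_def)
  have "0 < \<epsilon> / 3" using \<epsilon> by simp
  from noisy_event_probability[OF this less_imp_le[OF s]] obtain K N1
    where K: "0 < K" "\<And>n. n \<ge> N1 \<Longrightarrow> Q.prob (noisy_event n s (K / sqrt (\<rho> n * real n))) \<le> \<epsilon> / 3" by blast
  \<comment> \<open>3K from the noise; 180 / \<epsilon> from three fits, each at most (3 /
    \<epsilon>) times 20 \<open>bnd\<close>; 6 from rounding and 1 from \<open>err\<close>.\<close>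
  define C where "C = 3 * K + 180 / \<epsilon> + 7"
  show ?thesis
  proof (intro exI[of _ C] exI[of _ "max 3 N1"] allI impI)
    fix n assume "max 3 N1 \<le> n"
    then have n: "n \<ge> 3" "n \<ge> N1" "n \<ge> 2" "0 < n" by auto
    have r: "0 < \<rho> n" by (rule \<rho>_pos[OF n(3)])
    have k: "ln (real n) / real n \<le> \<kappa> n" "\<kappa> n \<le> 1" using \<kappa>[OF n(3)] by auto
    have "exp 1 \<le> real n" using exp_le n(1) by linarith
    then have ln1: "1 \<le> ln (real n)" using n(4) by (simp add: ln_ge_iff)
    have lnk: "ln (real n) \<le> real n * \<kappa> n" using k(1) n(4) by (simp add: field_simps)
    have nk: "1 \<le> real n * \<kappa> n" using ln1 lnk by linarith
    have k0: "0 < \<kappa> n" using nk n(4) by (metis less_le_trans mult_le_0_iff not_le of_nat_0_le_iff zero_less_one)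
    define r1 where "r1 = sqrt (1 / (\<rho> n * real n))"
    define r2 where "r2 = sqrt (ln (real n) / (\<kappa> n * real n))"
    define T where "T = tail 1 M W (\<rho> n)"
    define bnd where "bnd = eps_block 1 M W (\<kappa> n) + r1 + r2 + T"
    have r1: "0 < r1" using r n(4) by (simp add: r1_def)
    have sq: "1 \<le> sqrt (real n * \<kappa> n)" using nk by simp
    have r2: "1 / sqrt (real n * \<kappa> n) \<le> r2"
    proof -
      have "1 / (real n * \<kappa> n) \<le> ln (real n) / (\<kappa> n * real n)"
        using ln1 nk by (subst mult.commute, intro divide_right_mono) (auto simp: mult.commute)
      then have "sqrt (1 / (real n * \<kappa> n)) \<le> r2" unfolding r2_def by (rule real_sqrt_le_mono)
      then show ?thesis by (simp add: real_sqrt_divide)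
    qed
    have T0: "0 \<le> T" unfolding T_def tail_eq by (intro integral_nonneg_AE) auto
    have e0: "0 \<le> eps_block 1 M W (\<kappa> n)" by (rule eps_block_nonneg[OF prob_space_axioms graphon_W k(2)])
    have r20: "0 \<le> r2" using r2 sq by (meson divide_nonneg_nonneg order_trans zero_le_one)
    show "1 - \<epsilon> \<le> measure Q {\<omega>\<in>space Q.
             \<bar>scaled_err M W (\<rho> n) (alg n (G n \<omega>))\<bar>
               \<le> C * \<bar>eps_block 1 M W (\<kappa> n) + sqrt (1 / (\<rho> n * real n))
                       + sqrt (ln (real n) / (\<kappa> n * real n)) + tail 1 M W (\<rho> n)\<bar>}" (is "_ \<le> Q.prob ?good")
    proof (rule eps_block_attained[OF prob_space_axioms graphon_W k(2) r1])
      fix \<nu> :: "('a \<times> nat) measure" and l and B :: "nat \<Rightarrow> nat \<Rightarrow> real"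
      assume b: "block_coupling \<nu> M W fst snd l B" and q: "\<And>i. i < l \<Longrightarrow> \<kappa> n \<le> block_coupling.q \<nu> snd i"
        and err: "block_coupling.err \<nu> W fst snd B < eps_block 1 M W (\<kappa> n) + r1"
      interpret b: block_coupling \<nu> M W fst snd l B by fact
      have eb: "b.err \<le> bnd" using err r20 T0 by (simp add: bnd_def)
      have b0: "0 \<le> bnd" using eb b.err_nonneg by linarith
      \<comment> \<open>The slack in the choice of the coupling was \<open>r1\<close>, a term of
        \<open>bnd\<close> itself, so the choice costs no additional constant.\<close>
      have Tb: "T \<le> bnd" "r1 \<le> bnd" "1 / sqrt (real n * \<kappa> n) \<le> bnd" using e0 r1 r20 T0 r2 by (simp_all add: bnd_def)
      have Bn: "b.B_norm \<le> 1 + b.err" using b.B_norm_le by (simp add: integral_W)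
      have Bs: "b.B_norm / sqrt (real n * \<kappa> n) \<le> (1 + b.err) / sqrt (real n * \<kappa> n)"
        using Bn sq by (intro divide_right_mono) auto
      have Es: "(1 + b.err) / sqrt (real n * \<kappa> n) \<le> 2 * bnd"
      proof -
        have "b.err / sqrt (real n * \<kappa> n) \<le> b.err / 1" using sq b.err_nonneg by (intro divide_left_mono) auto
        then show ?thesis using Tb(3) eb by (simp add: add_divide_distrib)
      qed
      \<comment> \<open>Dominates the expected fit. The summand 1 keeps it positive even if
        \<open>err\<close> and \<open>T\<close> vanish, as Markov's inequality needs a positive
        level; 1 + 1 + 9 * 2 gives the factor 20.\<close>
      define st where "st = b.err + T + 9 * ((1 + b.err) / sqrt (real n * \<kappa> n))"
      have st0: "0 < st"
      proof -
        have "0 < (1 + b.err) / sqrt (real n * \<kappa> n)" using b.err_nonneg sq by (intro divide_pos_pos) linarith+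
        then show ?thesis using b.err_nonneg T0 unfolding st_def by linarith
      qed
      have stb: "st \<le> 20 * bnd" using Es Tb eb unfolding st_def by linarith
      define c where "c = 3 / \<epsilon> * st"
      have c: "0 < c" using st0 \<epsilon> by (simp add: c_def)
      let ?A = "{x\<in>space iid. \<not> (\<exists>\<pi>\<in>b.good_labels n. b.fit (\<rho> n) n x \<pi> \<le> c)}"
      have A: "?A \<in> sets iid"
      proof -
        have "?A = space iid - {x\<in>space iid. \<exists>\<pi>\<in>b.good_labels n. b.fit (\<rho> n) n x \<pi> \<le> c}" by auto
        then show ?thesis using b.meas_ex_fit by auto
      qed
      have "measure iid ?A \<le> (b.err + (\<integral>x. b.tail_fun (1 / \<rho> n) x \<partial>(M \<Otimes>\<^sub>M M)) + 9 * b.B_norm / sqrt (real n * \<kappa> n)) / c"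
        by (rule b.fit_probability[OF k0 q nk r c])
      also have "(\<integral>x. b.tail_fun (1 / \<rho> n) x \<partial>(M \<Otimes>\<^sub>M M)) = T" by (simp add: T_def tail_eq b.tail_fun_def)
      also have "(b.err + T + 9 * b.B_norm / sqrt (real n * \<kappa> n)) / c \<le> st / c"
      proof (rule divide_right_mono)
        show "b.err + T + 9 * b.B_norm / sqrt (real n * \<kappa> n) \<le> st" unfolding st_def using Bs by linarith
      qed (use c in simp)
      also have "\<dots> = \<epsilon> / 3" using st0 \<epsilon> by (simp add: c_def)
      finally have pA: "measure iid ?A \<le> \<epsilon> / 3" .
      define b1 where "b1 = noisy_event n s (K / sqrt (\<rho> n * real n))"
      define b2 where "b2 = {\<omega>\<in>space Q. (\<lambda>i. X i \<omega>) \<in> ?A}"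
      define b3 where "b3 = {\<omega>\<in>space Q. \<not> offdiag_sum W_pair n (\<lambda>i. X i \<omega>) \<le> s * (real n)\<^sup>2}"
      have m1: "b1 \<in> sets Q" unfolding b1_def by (rule noisy_event_sets[OF n(3)])
      have m2: "b2 \<in> sets Q"
      proof -
        have "b2 = (\<lambda>\<omega> i. X i \<omega>) -` ?A \<inter> space Q" by (auto simp: b2_def)
        then show ?thesis using measurable_sets[OF meas_X_seq A] by simp
      qed
      have m3: "b3 \<in> sets Q"
      proof -
        have "b3 = (\<lambda>\<omega> i. X i \<omega>) -` {x\<in>space iid. \<not> offdiag_sum W_pair n x \<le> s * (real n)\<^sup>2} \<inter> space Q"
          using measurable_space[OF meas_X_seq] by (auto simp: b3_def)
        moreover have "{x\<in>space iid. \<not> offdiag_sum W_pair n x \<le> s * (real n)\<^sup>2} \<in> sets iid" by measurable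
        ultimately show ?thesis using measurable_sets[OF meas_X_seq] by simp
      qed
      \<comment> \<open>The error is a function of the graph alone, and every set of graphs is
        measurable, so the choice among minimizers causes no measurability problem.\<close>
      have "?good = G n -` {E. \<bar>scaled_err M W (\<rho> n) (alg n E)\<bar> \<le> C * \<bar>bnd\<bar>} \<inter> space Q"
        by (auto simp: bnd_def r1_def r2_def T_def)
      also have "\<dots> \<in> sets Q" by (rule measurable_sets[OF meas_G]) simp
      finally have mg: "?good \<in> sets Q" .
      have adm: "1 \<le> nat \<lfloor>\<kappa> n * real n\<rfloor>" using nk by (simp add: mult.commute le_nat_iff)
      have main: "\<omega> \<in> ?good" if \<omega>: "\<omega> \<in> space Q" "\<omega> \<notin> b1" "\<omega> \<notin> b2" "\<omega> \<notin> b3" and G: "G n \<omega> \<subseteq> vpairs n" for \<omega>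
      proof -
        have xs: "(\<lambda>i. X i \<omega>) \<in> space iid" using measurable_space[OF meas_X_seq \<omega>(1)] .
        have W: "offdiag_sum W_pair n (\<lambda>i. X i \<omega>) \<le> s * (real n)\<^sup>2" using \<omega> by (auto simp: b3_def)
        have "\<not> noisy n s (K / sqrt (\<rho> n * real n)) (\<lambda>i. X i \<omega>) (G n \<omega>)" using \<omega> G by (auto simp: b1_def noisy_event_def)
        then have 1: "cut_norm n (\<lambda>u v. adj (G n \<omega>) u v / \<rho> n - trunc_sample W (\<rho> n) (\<lambda>i. X i \<omega>) u v) \<le> K * r1"
          using cut_norm_trunc_le[OF n(3) W] by (fastforce simp: r1_def real_sqrt_divide)
        obtain \<pi> where \<pi>: "\<pi> \<in> b.good_labels n" "b.fit (\<rho> n) n (\<lambda>i. X i \<omega>) \<pi> \<le> c"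
          using \<omega> xs by (auto simp: b2_def)
        have out: "alg n (G n \<omega>) \<in> lcn_outputs n (\<kappa> n) (G n \<omega>)" by (rule output_mem[OF alg adm k0 k(2)])
        have "scaled_err M W (\<rho> n) (alg n (G n \<omega>)) \<le> 3 * cut_norm n (\<lambda>u v. adj (G n \<omega>) u v / \<rho> n - trunc_sample W (\<rho> n) (\<lambda>i. X i \<omega>) u v)
           + 2 * b.fit (\<rho> n) n (\<lambda>i. X i \<omega>) \<pi> + b.fit (\<rho> n) n (\<lambda>i. X i \<omega>) \<pi> + (b.B_col / real n + b.B_tot / (real n)\<^sup>2) + b.err"
          unfolding b.fit_def
          using q lcn_k_ge[OF adm k0 b.card_blocks_le[OF q]] out
          by (intro scaled_err_le[OF b b \<pi>(1) \<pi>(1) n(4) r]) auto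
        also have "\<dots> \<le> 3 * (K * r1) + 3 * c + 3 * b.B_norm / sqrt (real n * \<kappa> n) + b.err"
          using 1 \<pi>(2) b.class_error_le[OF k0 q nk] by linarith
        also have "\<dots> \<le> 3 * (K * bnd) + 3 * (3 / \<epsilon> * (20 * bnd)) + 6 * bnd + bnd"
        proof (intro add_mono)
          show "3 * (K * r1) \<le> 3 * (K * bnd)" using Tb K(1) by simp
          show "3 * c \<le> 3 * (3 / \<epsilon> * (20 * bnd))" unfolding c_def using stb \<epsilon> by (intro mult_left_mono) auto
          show "3 * b.B_norm / sqrt (real n * \<kappa> n) \<le> 6 * bnd" using Bs Es by linarith
        qed (rule eb)
        also have "\<dots> = C * bnd" by (simp add: C_def algebra_simps)
        finally have "scaled_err M W (\<rho> n) (alg n (G n \<omega>)) \<le> C * \<bar>bnd\<bar>" using b0 by simp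
        moreover have "0 \<le> scaled_err M W (\<rho> n) (alg n (G n \<omega>))"
          by (rule scaled_err_nonneg[OF prob_space_axioms graphon_W n(4) out])
        ultimately show ?thesis using \<omega>(1) by (simp add: bnd_def r1_def r2_def T_def)
      qed
      have "1 - Q.prob ?good = Q.prob (space Q - ?good)" by (rule Q.prob_compl[OF mg, symmetric])
      also have "\<dots> \<le> Q.prob (b1 \<union> b2 \<union> b3)"
      proof (rule Q.finite_measure_mono_AE)
        show "AE \<omega> in Q. \<omega> \<in> space Q - ?good \<longrightarrow> \<omega> \<in> b1 \<union> b2 \<union> b3"
          using AE_G[OF n(3)]
        proof eventually_elim
          case (elim \<omega>)
          then show ?case using main by blast
        qed
      qed (use m1 m2 m3 in auto)
      also have "\<dots> \<le> Q.prob b1 + Q.prob b2 + Q.prob b3"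
        using measure_Un_le[of "b1 \<union> b2" Q b3] measure_Un_le[of b1 Q b2] m1 m2 m3 by auto
      also have "\<dots> \<le> \<epsilon> / 3 + \<epsilon> / 3 + \<epsilon> / 3"
      proof (intro add_mono)
        show "Q.prob b1 \<le> \<epsilon> / 3" unfolding b1_def by (rule K(2)[OF n(2)])
        show "Q.prob b2 \<le> \<epsilon> / 3" unfolding b2_def using measure_X[OF A] pA by simp
        show "Q.prob b3 \<le> \<epsilon> / 3" unfolding b3_def using offdiag_W_markov[OF s, of n] by (simp add: s_def)
      qed
      finally show ?thesis by simp
    qed
  qed
qed

end

lemma filterlim_nat_floor_ge_1:
  assumes "filterlim f at_top sequentially"
  shows "eventually (\<lambda>n. 1 \<le> nat \<lfloor>f n :: real\<rfloor>) sequentially"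
proof -
  have "eventually (\<lambda>n. 1 \<le> f n) sequentially" using assms by (simp add: filterlim_at_top)
  then show ?thesis by eventually_elim (simp add: le_nat_iff)
qed

section \<open>The almost sure statements\<close>

context wrg
begin

text \<open>A near-optimal model competes, and a fine step function does the transport at cost at
  most \<delta> / 3. In total 2 \<epsilon> + 5 \<delta> / 6, where \<epsilon> is the block
  approximation error.\<close>

lemma scaled_err_limsup_fixed:
  assumes \<kappa>: "0 < \<kappa>" "\<kappa> \<le> 1" and \<rho>: "\<rho> \<longlonglongrightarrow> 0" and lim: "filterlim (\<lambda>n. real n * \<rho> n) at_top sequentially"
    and alg: "lcn_selection (\<lambda>_. \<kappa>) alg"
  shows "AE \<omega> in Q. limsup (\<lambda>n. ereal (scaled_err M W (\<rho> n) (alg n (G n \<omega>)))) \<le> ereal (2 * eps_block 1 M W \<kappa>)"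
proof -
  have ev: "AE \<omega> in Q. eventually (\<lambda>n. scaled_err M W (\<rho> n) (alg n (G n \<omega>)) \<le> 2 * eps_block 1 M W \<kappa> + \<delta>) sequentially"
    if \<delta>: "0 < \<delta>" for \<delta>
  proof (rule eps_block_attained[OF prob_space_axioms graphon_W \<kappa>(2), of "\<delta> / 6"])
    show "0 < \<delta> / 6" using \<delta> by simp
    fix \<nu> :: "('a \<times> nat) measure" and k and B :: "nat \<Rightarrow> nat \<Rightarrow> real"
    assume b: "block_coupling \<nu> M W fst snd k B" and q: "\<And>i. i < k \<Longrightarrow> \<kappa> \<le> block_coupling.q \<nu> snd i"
      and err: "block_coupling.err \<nu> W fst snd B < eps_block 1 M W \<kappa> + \<delta> / 6"
    obtain lab :: "'a \<Rightarrow> nat" and k' and B' where b': "block_coupling M M W (\<lambda>x. x) lab k' B'"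
      and err': "block_coupling.err M W (\<lambda>x. x) lab B' < \<delta> / 6"
      by (rule step_block_coupling[OF prob_space_axioms graphon_W, of "\<delta> / 6"]) (use \<delta> in auto)
    have "filterlim (\<lambda>n. \<kappa> * real n) at_top sequentially"
      by (rule filterlim_tendsto_pos_mult_at_top[OF tendsto_const \<kappa>(1) filterlim_real_sequentially])
    from filterlim_nat_floor_ge_1[OF this]
    have adm: "eventually (\<lambda>n. 1 \<le> nat \<lfloor>\<kappa> * real n\<rfloor> \<and> 0 < \<kappa> \<and> \<kappa> \<le> 1 \<and> k \<le> lcn_k n \<kappa> \<and>
       (\<forall>i<k. block_coupling.q \<nu> snd i = 0 \<or> \<kappa> \<le> block_coupling.q \<nu> snd i)) sequentially"
    proof eventually_elim
      case (elim n)
      then show ?case using \<kappa> q lcn_k_ge[OF elim \<kappa>(1) block_coupling.card_blocks_le[OF b q]] by auto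
    qed
    have "0 < \<delta> / 6" using \<delta> by simp
    from scaled_err_eventually_le[OF b b' \<rho> lim adm alg this]
    show ?thesis
    proof eventually_elim
      case (elim \<omega>)
      then show ?case
      proof eventually_elim
        case (elim n)
        then show ?case using err err' \<delta> by linarith
      qed
    qed
  qed
  have "AE \<omega> in Q. \<forall>m. eventually (\<lambda>n. scaled_err M W (\<rho> n) (alg n (G n \<omega>)) \<le> 2 * eps_block 1 M W \<kappa> + 1 / real (Suc m)) sequentially"
    unfolding AE_all_countable by (intro allI ev) simp
  then show ?thesis
  proof eventually_elim
    case (elim \<omega>)
    show ?case
    proof (rule ereal_le_epsilon2)
      fix e :: real assume "0 < e"
      then obtain m where m: "1 / real (Suc m) < e" using nat_approx_posE by blast
      show "limsup (\<lambda>n. ereal (scaled_err M W (\<rho> n) (alg n (G n \<omega>)))) \<le> ereal (2 * eps_block 1 M W \<kappa>) + ereal e"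
      proof (rule Limsup_bounded)
        show "eventually (\<lambda>n. ereal (scaled_err M W (\<rho> n) (alg n (G n \<omega>))) \<le> ereal (2 * eps_block 1 M W \<kappa>) + ereal e) sequentially"
          using elim[rule_format, of m] by eventually_elim (use m in auto)
      qed
    qed
  qed
qed

text \<open>One fine step function plays both parts, at total cost at most 4 (\<delta> / 5) +
  \<delta> / 5.\<close>

lemma scaled_err_tendsto:
  assumes \<kappa>: "\<And>n. n \<ge> 2 \<Longrightarrow> 0 < \<kappa> n \<and> \<kappa> n \<le> 1" and \<rho>: "\<rho> \<longlonglongrightarrow> 0" and lim: "filterlim (\<lambda>n. real n * \<rho> n) at_top sequentially"
    and \<kappa>0: "\<kappa> \<longlonglongrightarrow> 0" and ln: "(\<lambda>n. ln (real n) / (real n * \<kappa> n)) \<longlonglongrightarrow> 0"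
    and alg: "lcn_selection \<kappa> alg"
  shows "AE \<omega> in Q. (\<lambda>n. scaled_err M W (\<rho> n) (alg n (G n \<omega>))) \<longlonglongrightarrow> 0"
proof -
  have "eventually (\<lambda>n. ln (real n) / (real n * \<kappa> n) < 1) sequentially" using ln by (rule order_tendstoD(2)) simp
  then have floor: "eventually (\<lambda>n. 1 \<le> nat \<lfloor>\<kappa> n * real n\<rfloor>) sequentially"
    using eventually_ge_at_top[of 3]
  proof eventually_elim
    case (elim n)
    have "exp 1 \<le> real n" using exp_le elim(2) by linarith
    then have "1 \<le> ln (real n)" using elim(2) by (simp add: ln_ge_iff)
    moreover have "0 < real n * \<kappa> n" using \<kappa>[of n] elim(2) by simp
    ultimately have "1 \<le> \<kappa> n * real n" using elim(1) by (simp add: field_simps)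
    then show ?case by (simp add: le_nat_iff)
  qed
  have ev: "AE \<omega> in Q. eventually (\<lambda>n. scaled_err M W (\<rho> n) (alg n (G n \<omega>)) \<le> \<delta>) sequentially"
    if \<delta>: "0 < \<delta>" for \<delta>
  proof -
    have d: "0 < \<delta> / 5" using \<delta> by simp
    obtain lab :: "'a \<Rightarrow> nat" and k and B where b: "block_coupling M M W (\<lambda>x. x) lab k B"
      and err: "block_coupling.err M W (\<lambda>x. x) lab B < \<delta> / 5"
      by (rule step_block_coupling[OF prob_space_axioms graphon_W d])
    interpret b: block_coupling M M W "\<lambda>x. x" lab k B by fact
    \<comment> \<open>The step function is fixed while \<kappa> tends to 0, so \<kappa> eventually
      lies below each of its finitely many positive weights; null classes are left empty.\<close>
    have "eventually (\<lambda>n. b.q i = 0 \<or> \<kappa> n \<le> b.q i) sequentially" for i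
    proof (cases "b.q i = 0")
      case False
      then have "eventually (\<lambda>n. \<kappa> n < b.q i) sequentially"
        using \<kappa>0 b.q_nonneg[of i] by (intro order_tendstoD(2)) auto
      then show ?thesis by eventually_elim simp
    qed simp
    then have evq: "eventually (\<lambda>n. \<forall>i\<in>{..<k}. b.q i = 0 \<or> \<kappa> n \<le> b.q i) sequentially"
      by (intro eventually_ball_finite) auto
    have "(\<lambda>n. real k * \<kappa> n) \<longlonglongrightarrow> real k * 0" by (intro tendsto_intros \<kappa>0)
    then have "eventually (\<lambda>n. real k * \<kappa> n < 1) sequentially" by (rule order_tendstoD(2)) simp
    with evq floor eventually_ge_at_top[of 2]
    have adm: "eventually (\<lambda>n. 1 \<le> nat \<lfloor>\<kappa> n * real n\<rfloor> \<and> 0 < \<kappa> n \<and> \<kappa> n \<le> 1 \<and> k \<le> lcn_k n (\<kappa> n) \<and>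
       (\<forall>i<k. b.q i = 0 \<or> \<kappa> n \<le> b.q i)) sequentially"
    proof eventually_elim
      case (elim n)
      then show ?case using \<kappa>[of n] lcn_k_ge[of "\<kappa> n" n k] by auto
    qed
    from scaled_err_eventually_le[OF b b \<rho> lim adm alg d] show ?thesis
    proof eventually_elim
      case (elim \<omega>)
      then show ?case
      proof eventually_elim
        case (elim n)
        then show ?case using err \<delta> by linarith
      qed
    qed
  qed
  have "AE \<omega> in Q. \<forall>m. eventually (\<lambda>n. scaled_err M W (\<rho> n) (alg n (G n \<omega>)) \<le> 1 / real (Suc m)) sequentially"
    unfolding AE_all_countable by (intro allI ev) simp
  then show ?thesis
  proof eventually_elim
    case (elim \<omega>)
    have nn: "eventually (\<lambda>n. 0 \<le> scaled_err M W (\<rho> n) (alg n (G n \<omega>))) sequentially"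
      using floor eventually_ge_at_top[of 2]
    proof eventually_elim
      case (elim n)
      then show ?case using \<kappa>[of n] output_mem[OF alg, of n]
        by (intro scaled_err_nonneg[OF prob_space_axioms graphon_W, of n]) auto
    qed
    show ?case
    proof (rule order_tendstoI)
      fix a :: real assume "a < 0"
      then show "eventually (\<lambda>n. a < scaled_err M W (\<rho> n) (alg n (G n \<omega>))) sequentially"
        using nn by (auto elim: eventually_mono)
    next
      fix a :: real assume "0 < a"
      then obtain m where "1 / real (Suc m) < a" using nat_approx_posE by blast
      then show "eventually (\<lambda>n. scaled_err M W (\<rho> n) (alg n (G n \<omega>)) < a) sequentially"
        using elim[rule_format, of m] by (auto elim!: eventually_mono)
    qed
  qed
qed

end

theorem theorem4p1:
  fixes M :: "'a measure" and W :: "'a \<Rightarrow> 'a \<Rightarrow> real"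
  assumes "prob_space M" and "graphon M W" and "graphon_norm 1 M W = 1"
  shows
   "(\<forall>(\<rho>::nat \<Rightarrow> real) (\<kappa>::nat \<Rightarrow> real) (Q::'q measure) X G alg.
       (\<forall>n\<ge>2. 0 < \<rho> n \<and> \<rho> n \<le> 1 \<and> ln (real n) / real n \<le> \<kappa> n \<and> \<kappa> n \<le> 1) \<and>
       wrg_sequence M W \<rho> Q X G \<and> lcn_selection \<kappa> alg \<longrightarrow>
       (\<forall>\<epsilon>>0. \<exists>C N. \<forall>n\<ge>N.
          1 - \<epsilon> \<le> measure Q {\<omega>\<in>space Q.
             \<bar>scaled_err M W (\<rho> n) (alg n (G n \<omega>))\<bar>
               \<le> C * \<bar>eps_block 1 M W (\<kappa> n) + sqrt (1 / (\<rho> n * real n))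
                       + sqrt (ln (real n) / (\<kappa> n * real n)) + tail 1 M W (\<rho> n)\<bar>}))
  \<and> (\<forall>(\<rho>::nat \<Rightarrow> real) (\<kappa>::real) (Q::'q measure) X G alg.
       0 < \<kappa> \<and> \<kappa> \<le> 1 \<and> (\<forall>n\<ge>2. 0 < \<rho> n \<and> \<rho> n \<le> 1) \<and>
       \<rho> \<longlonglongrightarrow> 0 \<and> filterlim (\<lambda>n. real n * \<rho> n) at_top sequentially \<and>
       wrg_sequence M W \<rho> Q X G \<and> lcn_selection (\<lambda>_. \<kappa>) alg \<longrightarrow>
       (AE \<omega> in Q. limsup (\<lambda>n. ereal (scaled_err M W (\<rho> n) (alg n (G n \<omega>))))
                      \<le> ereal (2 * eps_block 1 M W \<kappa>)))
  \<and> (\<forall>(\<rho>::nat \<Rightarrow> real) (\<kappa>::nat \<Rightarrow> real) (Q::'q measure) X G alg.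
       (\<forall>n\<ge>2. 0 < \<rho> n \<and> \<rho> n \<le> 1 \<and> 0 < \<kappa> n \<and> \<kappa> n \<le> 1) \<and>
       \<rho> \<longlonglongrightarrow> 0 \<and> filterlim (\<lambda>n. real n * \<rho> n) at_top sequentially \<and>
       \<kappa> \<longlonglongrightarrow> 0 \<and> (\<lambda>n. ln (real n) / (real n * \<kappa> n)) \<longlonglongrightarrow> 0 \<and>
       wrg_sequence M W \<rho> Q X G \<and> lcn_selection \<kappa> alg \<longrightarrow>
       (AE \<omega> in Q. (\<lambda>n. scaled_err M W (\<rho> n) (alg n (G n \<omega>))) \<longlonglongrightarrow> 0))"
proof (intro conjI)
  show "\<forall>(\<rho>::nat \<Rightarrow> real) (\<kappa>::nat \<Rightarrow> real) (Q::'q measure) X G alg.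
       (\<forall>n\<ge>2. 0 < \<rho> n \<and> \<rho> n \<le> 1 \<and> ln (real n) / real n \<le> \<kappa> n \<and> \<kappa> n \<le> 1) \<and>
       wrg_sequence M W \<rho> Q X G \<and> lcn_selection \<kappa> alg \<longrightarrow>
       (\<forall>\<epsilon>>0. \<exists>C N. \<forall>n\<ge>N.
          1 - \<epsilon> \<le> measure Q {\<omega>\<in>space Q.
             \<bar>scaled_err M W (\<rho> n) (alg n (G n \<omega>))\<bar>
               \<le> C * \<bar>eps_block 1 M W (\<kappa> n) + sqrt (1 / (\<rho> n * real n))
                       + sqrt (ln (real n) / (\<kappa> n * real n)) + tail 1 M W (\<rho> n)\<bar>})"
  proof (intro allI impI, elim conjE)
    fix \<rho> \<kappa> :: "nat \<Rightarrow> real" and Q :: "'q measure" and X G alg and \<epsilon> :: real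
    assume h: "\<forall>n\<ge>2. 0 < \<rho> n \<and> \<rho> n \<le> 1 \<and> ln (real n) / real n \<le> \<kappa> n \<and> \<kappa> n \<le> 1"
      and w: "wrg_sequence M W \<rho> Q X G" and alg: "lcn_selection \<kappa> alg" and e: "0 < \<epsilon>"
    have "wrg M W \<rho> Q X G" by (intro wrg.intro wrg_axioms.intro assms w) (use h in auto)
    then show "\<exists>C N. \<forall>n\<ge>N.
          1 - \<epsilon> \<le> measure Q {\<omega>\<in>space Q.
             \<bar>scaled_err M W (\<rho> n) (alg n (G n \<omega>))\<bar>
               \<le> C * \<bar>eps_block 1 M W (\<kappa> n) + sqrt (1 / (\<rho> n * real n))
                       + sqrt (ln (real n) / (\<kappa> n * real n)) + tail 1 M W (\<rho> n)\<bar>}"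
      by (rule wrg.scaled_err_probability[OF _ _ alg e]) (use h in auto)
  qed
  show "\<forall>(\<rho>::nat \<Rightarrow> real) (\<kappa>::real) (Q::'q measure) X G alg.
       0 < \<kappa> \<and> \<kappa> \<le> 1 \<and> (\<forall>n\<ge>2. 0 < \<rho> n \<and> \<rho> n \<le> 1) \<and>
       \<rho> \<longlonglongrightarrow> 0 \<and> filterlim (\<lambda>n. real n * \<rho> n) at_top sequentially \<and>
       wrg_sequence M W \<rho> Q X G \<and> lcn_selection (\<lambda>_. \<kappa>) alg \<longrightarrow>
       (AE \<omega> in Q. limsup (\<lambda>n. ereal (scaled_err M W (\<rho> n) (alg n (G n \<omega>))))
                      \<le> ereal (2 * eps_block 1 M W \<kappa>))"
  proof (intro allI impI, elim conjE)
    fix \<rho> :: "nat \<Rightarrow> real" and \<kappa> :: real and Q :: "'q measure" and X G alg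
    assume k: "0 < \<kappa>" "\<kappa> \<le> 1" and h: "\<forall>n\<ge>2. 0 < \<rho> n \<and> \<rho> n \<le> 1"
      and \<rho>: "\<rho> \<longlonglongrightarrow> 0" "filterlim (\<lambda>n. real n * \<rho> n) at_top sequentially"
      and w: "wrg_sequence M W \<rho> Q X G" and alg: "lcn_selection (\<lambda>_. \<kappa>) alg"
    have "wrg M W \<rho> Q X G" by (intro wrg.intro wrg_axioms.intro assms w) (use h in auto)
    then show "AE \<omega> in Q. limsup (\<lambda>n. ereal (scaled_err M W (\<rho> n) (alg n (G n \<omega>))))
                      \<le> ereal (2 * eps_block 1 M W \<kappa>)"
      by (rule wrg.scaled_err_limsup_fixed[OF _ k \<rho> alg])
  qed
  show "\<forall>(\<rho>::nat \<Rightarrow> real) (\<kappa>::nat \<Rightarrow> real) (Q::'q measure) X G alg.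
       (\<forall>n\<ge>2. 0 < \<rho> n \<and> \<rho> n \<le> 1 \<and> 0 < \<kappa> n \<and> \<kappa> n \<le> 1) \<and>
       \<rho> \<longlonglongrightarrow> 0 \<and> filterlim (\<lambda>n. real n * \<rho> n) at_top sequentially \<and>
       \<kappa> \<longlonglongrightarrow> 0 \<and> (\<lambda>n. ln (real n) / (real n * \<kappa> n)) \<longlonglongrightarrow> 0 \<and>
       wrg_sequence M W \<rho> Q X G \<and> lcn_selection \<kappa> alg \<longrightarrow>
       (AE \<omega> in Q. (\<lambda>n. scaled_err M W (\<rho> n) (alg n (G n \<omega>))) \<longlonglongrightarrow> 0)"
  proof (intro allI impI, elim conjE)
    fix \<rho> \<kappa> :: "nat \<Rightarrow> real" and Q :: "'q measure" and X G alg
    assume h: "\<forall>n\<ge>2. 0 < \<rho> n \<and> \<rho> n \<le> 1 \<and> 0 < \<kappa> n \<and> \<kappa> n \<le> 1"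
      and \<rho>: "\<rho> \<longlonglongrightarrow> 0" "filterlim (\<lambda>n. real n * \<rho> n) at_top sequentially"
      and k: "\<kappa> \<longlonglongrightarrow> 0" "(\<lambda>n. ln (real n) / (real n * \<kappa> n)) \<longlonglongrightarrow> 0"
      and w: "wrg_sequence M W \<rho> Q X G" and alg: "lcn_selection \<kappa> alg"
    have "wrg M W \<rho> Q X G" by (intro wrg.intro wrg_axioms.intro assms w) (use h in auto)
    then show "AE \<omega> in Q. (\<lambda>n. scaled_err M W (\<rho> n) (alg n (G n \<omega>))) \<longlonglongrightarrow> 0"
      by (rule wrg.scaled_err_tendsto[OF _ _ \<rho> k alg]) (use h in auto)
  qed
qed

end
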